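(* Let $p\in[1,\infty)$, let $A$ be an $L^p$-operator algebra, let $G$ be a locally compact group, and let $\alpha\colon G\to\mathrm{Aut}(A)$ be an action. Consider the following statements: (1) $A$ has a left (right, two-sided) contractive approximate identity; (2) $F^p(G,A,\alpha)$ has a left (right, two-sided) contractive approximate identity; (3) $F^p_\lambda(G,A,\alpha)$ has a left (right, two-sided) contractive approximate identity. Then (1) implies (2), and (2) implies (3) (for each of the three versions: left, right, two-sided). If $G$ is discrete, then also (3) implies (1), so all three are equivalent in this case.
   Context: Locally compact groups are Hausdorff, with a fixed left Haar measure $dg$ (counting measure if discrete). An $L^p$-space is a Banach space $L^p(\nu)$ for some measure space. An $L^p$-operator algebra is a Banach algebra that can be isometrically represented on an $L^p$-space. $\mathrm{Aut}(A)$ is the group of isometric automorphisms of $A$ with the strong topology, and actions are continuous. $L^1(G,A,\alpha)$ is the completion of $C_c(G,A)$ in the $L^1$-norm with product $(a*b)(g)=\int_G a(h)\alpha_h(b(h^{-1}g))\,dh$. A contractive covariant representation of $(G,A,\alpha)$ on an $L^p$-space $E$ is a pair $(\pi,v)$ of a nondegenerate contractive homomorphism $\pi\colon A\to\mathcal B(E)$ and a (strongly continuous) isometric group representation $v$ of $G$ on $E$ with $v_g\pi(a)v_{g^{-1}}=\pi(\alpha_g(a))$; its integrated form is $(\pi\rtimes v)(a)\xi=\int_G\pi(a(g))v_g\xi\,dg$ for $a\in L^1(G,A,\alpha)$. Given a nondegenerate contractive representation $\pi_0\colon A\to\mathcal B(E_0)$ on an $L^p$-space, the associated regular covariant representation on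 $L^p(G,E_0)$ is $(\pi,\lambda_p^{E_0})$, with $\pi(a)(\xi)(g)=\pi_0(\alpha_{g^{-1}}(a))(\xi(g))$ and $(\lambda_p^{E_0})_g(\xi)(h)=\xi(g^{-1}h)$. The full crossed product $F^p(G,A,\alpha)$ (resp. reduced crossed product $F^p_\lambda(G,A,\alpha)$) is the completion of $L^1(G,A,\alpha)$ in the norm $\sup\|(\pi\rtimes v)(a)\|$ over all contractive covariant (resp. all regular covariant) representations on $L^p$-spaces.
   Formalization: For (3) implies (1) with G discrete, A is additionally assumed to have a nondegenerate isometric representation on an L^p-space; without this the implication fails, e.g. for trivial G and A = Ce with e an idempotent of norm 2 on a two-dimensional L^p-space. *)

theory Defs
  imports "HOL-Analysis.Analysis"
begin

section \<open>Complex Banach algebras and contractive approximate identities\<close>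

class scaleC =
  fixes scaleC :: "complex \<Rightarrow> 'a \<Rightarrow> 'a" (infixr \<open>*\<^sub>C\<close> 75)

class complex_banach = banach + scaleC +
  assumes scaleC_add_right: "c *\<^sub>C (x + y) = c *\<^sub>C x + c *\<^sub>C y"
    and scaleC_add_left: "(c + d) *\<^sub>C x = c *\<^sub>C x + d *\<^sub>C x"
    and scaleC_scaleC: "c *\<^sub>C d *\<^sub>C x = (c * d) *\<^sub>C x"
    and scaleC_of_real: "complex_of_real r *\<^sub>C x = r *\<^sub>R x"
    and norm_scaleC: "norm (c *\<^sub>C x) = cmod c * norm x"

text \<open>Not assumed unital; submultiplicativity of the norm is part of
  \<^class>\<open>real_normed_algebra\<close>.\<close>

class complex_banach_algebra = complex_banach + real_normed_algebra +
  assumes mult_scaleC_left: "(c *\<^sub>C x) * y = c *\<^sub>C (x * y)"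
    and mult_scaleC_right: "x * (c *\<^sub>C y) = c *\<^sub>C (x * y)"

datatype side = Left | Right | TwoSided

text \<open>Approximate identities are given by filters on the algebra instead of nets: a net induces
  its eventuality filter, and every proper filter arises from a net.\<close>

definition has_contractive_approx_identity ::
    "side \<Rightarrow> 'a::complex_banach_algebra itself \<Rightarrow> bool" where
  "has_contractive_approx_identity s (_ :: 'a itself) \<longleftrightarrow>
    (\<exists>F :: 'a filter. F \<noteq> bot \<and> (\<forall>\<^sub>F e in F. norm e \<le> 1) \<and>
      (s \<in> {Left, TwoSided} \<longrightarrow> (\<forall>a. ((\<lambda>e. e * a) \<longlongrightarrow> a) F)) \<and>
      (s \<in> {Right, TwoSided} \<longrightarrow> (\<forall>a. ((\<lambda>e. a * e) \<longlongrightarrow> a) F)))"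

text \<open>\<open>\<iota>\<close> exhibits the Banach algebra \<open>'b\<close> as the (Hausdorff) completion of the algebra with
  carrier \<open>V\<close> and the given operations with respect to the seminorm \<open>N\<close>. This determines \<open>'b\<close>
  up to isometric isomorphism.\<close>

definition is_completion ::
    "'v set \<Rightarrow> ('v \<Rightarrow> 'v \<Rightarrow> 'v) \<Rightarrow> (complex \<Rightarrow> 'v \<Rightarrow> 'v) \<Rightarrow> ('v \<Rightarrow> 'v \<Rightarrow> 'v) \<Rightarrow> ('v \<Rightarrow> real) \<Rightarrow>
      ('v \<Rightarrow> 'b::complex_banach_algebra) \<Rightarrow> bool" where
  "is_completion V add cmul prd N \<iota> \<longleftrightarrow>
    (\<forall>x\<in>V. \<forall>y\<in>V. \<iota> (add x y) = \<iota> x + \<iota> y) \<and>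
    (\<forall>c. \<forall>x\<in>V. \<iota> (cmul c x) = c *\<^sub>C \<iota> x) \<and>
    (\<forall>x\<in>V. \<forall>y\<in>V. \<iota> (prd x y) = \<iota> x * \<iota> y) \<and>
    (\<forall>x\<in>V. norm (\<iota> x) = N x) \<and>
    closure (\<iota> ` V) = UNIV"


section \<open>Haar measure, actions, and the algebra $L^1(G,A,\alpha)$\<close>

text \<open>Groups are written additively, as instances of \<^class>\<open>topological_group_add\<close>; this class
  does not assume commutativity. So $g^{-1}h$ becomes \<open>- g + h\<close>.\<close>

definition discrete_space :: "'g::topological_space itself \<Rightarrow> bool" where
  "discrete_space (_ :: 'g itself) \<longleftrightarrow> (\<forall>S :: 'g set. open S)"

text \<open>A Radon measure in the usual convention: outer regular on Borel sets and inner regular on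
  open sets.\<close>

definition left_haar_measure :: "'g::{topological_group_add, t2_space} measure \<Rightarrow> bool" where
  "left_haar_measure \<mu> \<longleftrightarrow>
    sets \<mu> = sets borel \<and>
    (\<forall>K. compact K \<longrightarrow> emeasure \<mu> K < \<infinity>) \<and>
    (\<forall>U. open U \<and> U \<noteq> {} \<longrightarrow> 0 < emeasure \<mu> U) \<and>
    (\<forall>g. \<forall>B\<in>sets borel. emeasure \<mu> ((+) g ` B) = emeasure \<mu> B) \<and>
    (\<forall>B\<in>sets borel. emeasure \<mu> B = (INF U\<in>{U. open U \<and> B \<subseteq> U}. emeasure \<mu> U)) \<and>
    (\<forall>U. open U \<longrightarrow> emeasure \<mu> U = (SUP K\<in>{K. compact K \<and> K \<subseteq> U}. emeasure \<mu> K)) \<and>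
    (discrete_space TYPE('g) \<longrightarrow> \<mu> = count_space UNIV)"

definition isometric_automorphism :: "('a::complex_banach_algebra \<Rightarrow> 'a) \<Rightarrow> bool" where
  "isometric_automorphism \<phi> \<longleftrightarrow>
    bij \<phi> \<and> (\<forall>a b. \<phi> (a + b) = \<phi> a + \<phi> b) \<and> (\<forall>c a. \<phi> (c *\<^sub>C a) = c *\<^sub>C \<phi> a) \<and>
    (\<forall>a b. \<phi> (a * b) = \<phi> a * \<phi> b) \<and> (\<forall>a. norm (\<phi> a) = norm a)"

definition group_action ::
    "('g::topological_group_add \<Rightarrow> 'a::complex_banach_algebra \<Rightarrow> 'a) \<Rightarrow> bool" where
  "group_action \<alpha> \<longleftrightarrow>
    (\<forall>g. isometric_automorphism (\<alpha> g)) \<and>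
    (\<forall>g h. \<alpha> (g + h) = \<alpha> g \<circ> \<alpha> h) \<and>
    (\<forall>a. continuous_on UNIV (\<lambda>g. \<alpha> g a))"

text \<open>The library's Bochner integral requires a second countable value space. The following is
  the same definition without this restriction, since \<open>A\<close> need not be separable.\<close>

definition has_bochner_value ::
    "'g measure \<Rightarrow> ('g \<Rightarrow> 'b::real_normed_vector) \<Rightarrow> 'b \<Rightarrow> bool" where
  "has_bochner_value \<mu> f x \<longleftrightarrow>
    f \<in> borel_measurable \<mu> \<and>
    (\<exists>s. (\<forall>i::nat. Bochner_Integration.simple_bochner_integrable \<mu> (s i)) \<and>
      (\<lambda>i. \<integral>\<^sup>+g. ennreal (norm (f g - s i g)) \<partial>\<mu>) \<longlonglongrightarrow> 0 \<and>
      (\<lambda>i. Bochner_Integration.simple_bochner_integral \<mu> (s i)) \<longlonglongrightarrow> x)"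

definition bochner_value :: "'g measure \<Rightarrow> ('g \<Rightarrow> 'b::real_normed_vector) \<Rightarrow> 'b" where
  "bochner_value \<mu> f = (THE x. has_bochner_value \<mu> f x)"

definition compactly_supported :: "('g::topological_space \<Rightarrow> 'a::real_normed_vector) set" where
  "compactly_supported =
    {f. continuous_on UNIV f \<and> (\<exists>K. compact K \<and> (\<forall>g. g \<notin> K \<longrightarrow> f g = 0))}"

definition convolution ::
    "'g::topological_group_add measure \<Rightarrow> ('g \<Rightarrow> 'a \<Rightarrow> 'a) \<Rightarrow> ('g \<Rightarrow> 'a) \<Rightarrow> ('g \<Rightarrow> 'a) \<Rightarrow>
      'g \<Rightarrow> 'a::complex_banach_algebra" where
  "convolution \<mu> \<alpha> a b g = bochner_value \<mu> (\<lambda>h. a h * \<alpha> h (b (- h + g)))"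

definition is_L1_algebra ::
    "'g::topological_group_add measure \<Rightarrow> ('g \<Rightarrow> 'a \<Rightarrow> 'a) \<Rightarrow>
      (('g \<Rightarrow> 'a::complex_banach_algebra) \<Rightarrow> 'l::complex_banach_algebra) \<Rightarrow> bool" where
  "is_L1_algebra \<mu> \<alpha> \<iota> \<longleftrightarrow>
    is_completion compactly_supported (\<lambda>a b g. a g + b g) (\<lambda>c a g. c *\<^sub>C a g)
      (convolution \<mu> \<alpha>) (\<lambda>a. \<integral>g. norm (a g) \<partial>\<mu>) \<iota>"


section \<open>$L^p$-spaces and operators on them\<close>

text \<open>Elements of $L^p(M)$ are represented by functions, and all identities between them are
  required almost everywhere only.\<close>

definition Lp :: "real \<Rightarrow> 'x measure \<Rightarrow> ('x \<Rightarrow> complex) set" where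
  "Lp p M = {f \<in> borel_measurable M. integrable M (\<lambda>x. cmod (f x) powr p)}"

definition Lp_norm :: "real \<Rightarrow> 'x measure \<Rightarrow> ('x \<Rightarrow> complex) \<Rightarrow> real" where
  "Lp_norm p M f = (\<integral>x. cmod (f x) powr p \<partial>M) powr (1 / p)"

definition ae_eq :: "'x measure \<Rightarrow> ('x \<Rightarrow> complex) \<Rightarrow> ('x \<Rightarrow> complex) \<Rightarrow> bool" where
  "ae_eq M f g \<longleftrightarrow> (AE x in M. f x = g x)"

type_synonym 'x opr = "('x \<Rightarrow> complex) \<Rightarrow> 'x \<Rightarrow> complex"

text \<open>Linearity and boundedness imply that \<open>T\<close> respects equality almost everywhere on \<^const>\<open>Lp\<close>, so
  that it defines a bounded operator on the Banach space $L^p(M)$.\<close>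

definition bounded_operator :: "real \<Rightarrow> 'x measure \<Rightarrow> 'x opr \<Rightarrow> bool" where
  "bounded_operator p M T \<longleftrightarrow>
    (\<forall>f\<in>Lp p M. T f \<in> Lp p M) \<and>
    (\<forall>f\<in>Lp p M. \<forall>g\<in>Lp p M. ae_eq M (T (\<lambda>x. f x + g x)) (\<lambda>x. T f x + T g x)) \<and>
    (\<forall>c. \<forall>f\<in>Lp p M. ae_eq M (T (\<lambda>x. c * f x)) (\<lambda>x. c * T f x)) \<and>
    (\<exists>C. \<forall>f\<in>Lp p M. Lp_norm p M (T f) \<le> C * Lp_norm p M f)"

definition operator_norm :: "real \<Rightarrow> 'x measure \<Rightarrow> 'x opr \<Rightarrow> real" where
  "operator_norm p M T = Sup {Lp_norm p M (T f) |f. f \<in> Lp p M \<and> Lp_norm p M f \<le> 1}"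

definition algebra_rep ::
    "real \<Rightarrow> 'x measure \<Rightarrow> ('a::complex_banach_algebra \<Rightarrow> 'x opr) \<Rightarrow> bool" where
  "algebra_rep p M \<pi> \<longleftrightarrow>
    (\<forall>a. bounded_operator p M (\<pi> a)) \<and>
    (\<forall>f\<in>Lp p M. \<forall>a b. ae_eq M (\<pi> (a + b) f) (\<lambda>x. \<pi> a f x + \<pi> b f x)) \<and>
    (\<forall>f\<in>Lp p M. \<forall>c a. ae_eq M (\<pi> (c *\<^sub>C a) f) (\<lambda>x. c * \<pi> a f x)) \<and>
    (\<forall>f\<in>Lp p M. \<forall>a b. ae_eq M (\<pi> (a * b) f) (\<pi> a (\<pi> b f)))"

definition contractive_rep ::
    "real \<Rightarrow> 'x measure \<Rightarrow> ('a::complex_banach_algebra \<Rightarrow> 'x opr) \<Rightarrow> bool" where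
  "contractive_rep p M \<pi> \<longleftrightarrow>
    algebra_rep p M \<pi> \<and> (\<forall>a. operator_norm p M (\<pi> a) \<le> norm a)"

definition isometric_rep ::
    "real \<Rightarrow> 'x measure \<Rightarrow> ('a::complex_banach_algebra \<Rightarrow> 'x opr) \<Rightarrow> bool" where
  "isometric_rep p M \<pi> \<longleftrightarrow>
    algebra_rep p M \<pi> \<and> (\<forall>a. operator_norm p M (\<pi> a) = norm a)"

text \<open>The linear span of $\pi(A)L^p(M)$ is dense.\<close>

definition nondegenerate_rep ::
    "real \<Rightarrow> 'x measure \<Rightarrow> ('a::complex_banach_algebra \<Rightarrow> 'x opr) \<Rightarrow> bool" where
  "nondegenerate_rep p M \<pi> \<longleftrightarrow>
    (\<forall>f\<in>Lp p M. \<forall>\<epsilon>>0. \<exists>n::nat. \<exists>a \<xi>. (\<forall>i<n. \<xi> i \<in> Lp p M) \<and>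
      Lp_norm p M (\<lambda>x. f x - (\<Sum>i<n. \<pi> (a i) (\<xi> i) x)) < \<epsilon>)"

definition Lp_operator_algebra ::
    "real \<Rightarrow> 'a::complex_banach_algebra itself \<Rightarrow> 'x itself \<Rightarrow> bool" where
  "Lp_operator_algebra p (_ :: 'a itself) (_ :: 'x itself) \<longleftrightarrow>
    (\<exists>(M :: 'x measure) (\<pi> :: 'a \<Rightarrow> 'x opr). isometric_rep p M \<pi>)"

text \<open>The passage from $F^p_\lambda(G,A,\alpha)$ back to \<open>A\<close> requires that nondegenerate
  representations recover the norm of \<open>A\<close>. This is not automatic: if $A=\mathbb{C}e$ with \<open>e\<close> an
  idempotent operator of norm 2, then every nondegenerate representation maps \<open>e\<close> to the
  identity.\<close>

definition nondegenerate_Lp_operator_algebra ::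
    "real \<Rightarrow> 'a::complex_banach_algebra itself \<Rightarrow> 'x itself \<Rightarrow> bool" where
  "nondegenerate_Lp_operator_algebra p (_ :: 'a itself) (_ :: 'x itself) \<longleftrightarrow>
    (\<exists>(M :: 'x measure) (\<pi> :: 'a \<Rightarrow> 'x opr). isometric_rep p M \<pi> \<and> nondegenerate_rep p M \<pi>)"


section \<open>Covariant representations\<close>

definition isometric_group_rep ::
    "real \<Rightarrow> 'x measure \<Rightarrow> ('g::topological_group_add \<Rightarrow> 'x opr) \<Rightarrow> bool" where
  "isometric_group_rep p M v \<longleftrightarrow>
    (\<forall>g. bounded_operator p M (v g)) \<and>
    (\<forall>g. \<forall>f\<in>Lp p M. Lp_norm p M (v g f) = Lp_norm p M f) \<and>
    (\<forall>f\<in>Lp p M. ae_eq M (v 0 f) f) \<and>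
    (\<forall>g h. \<forall>f\<in>Lp p M. ae_eq M (v (g + h) f) (v g (v h f))) \<and>
    (\<forall>f\<in>Lp p M. \<forall>g. ((\<lambda>h. Lp_norm p M (\<lambda>x. v h f x - v g f x)) \<longlongrightarrow> 0) (at g))"

definition covariant_rep ::
    "real \<Rightarrow> ('g::topological_group_add \<Rightarrow> 'a \<Rightarrow> 'a) \<Rightarrow> 'x measure \<Rightarrow>
      ('a::complex_banach_algebra \<Rightarrow> 'x opr) \<Rightarrow> ('g \<Rightarrow> 'x opr) \<Rightarrow> bool" where
  "covariant_rep p \<alpha> M \<pi> v \<longleftrightarrow>
    contractive_rep p M \<pi> \<and> nondegenerate_rep p M \<pi> \<and> isometric_group_rep p M v \<and>
    (\<forall>g a. \<forall>f\<in>Lp p M. ae_eq M (v g (\<pi> a (v (- g) f))) (\<pi> (\<alpha> g a) f))"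

text \<open>\<open>\<eta>\<close> is the integral of the $L^p(M)$-valued function \<open>F\<close>, tested against indicator functions
  of sets of finite measure. These lie in the dual of $L^p(M)$ and separate its points.\<close>

definition has_Lp_integral ::
    "real \<Rightarrow> 'x measure \<Rightarrow> 'g measure \<Rightarrow> ('g \<Rightarrow> 'x \<Rightarrow> complex) \<Rightarrow> ('x \<Rightarrow> complex) \<Rightarrow> bool" where
  "has_Lp_integral p M \<mu> F \<eta> \<longleftrightarrow>
    \<eta> \<in> Lp p M \<and>
    (\<forall>B\<in>sets M. emeasure M B < \<infinity> \<longrightarrow>
      (LINT x:B|M. \<eta> x) = (\<integral>g. (LINT x:B|M. F g x) \<partial>\<mu>))"

text \<open>\<open>\<eta>\<close> is $(\pi\rtimes v)(x)\xi$. For \<open>x\<close> in the image of $C_c(G,A)$ this is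
  $\int_G \pi(a(g))v_g\xi\,dg$; for general \<open>x\<close> in the completion $L^1(G,A,\alpha)$, which is given by
  \<open>\<iota>\<close>, it is the extension by continuity.\<close>

definition has_integrated_form ::
    "real \<Rightarrow> 'x measure \<Rightarrow> 'g::topological_group_add measure \<Rightarrow>
      (('g \<Rightarrow> 'a::complex_banach_algebra) \<Rightarrow> 'l::complex_banach_algebra) \<Rightarrow>
      ('a \<Rightarrow> 'x opr) \<Rightarrow> ('g \<Rightarrow> 'x opr) \<Rightarrow> 'l \<Rightarrow> ('x \<Rightarrow> complex) \<Rightarrow> ('x \<Rightarrow> complex) \<Rightarrow> bool" where
  "has_integrated_form p M \<mu> \<iota> \<pi> v x \<xi> \<eta> \<longleftrightarrow>
    \<eta> \<in> Lp p M \<and>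
    (\<exists>a \<zeta>. (\<forall>n::nat. a n \<in> compactly_supported \<and>
          has_Lp_integral p M \<mu> (\<lambda>g. \<pi> (a n g) (v g \<xi>)) (\<zeta> n)) \<and>
        (\<lambda>n. \<iota> (a n)) \<longlonglongrightarrow> x \<and>
        (\<lambda>n. Lp_norm p M (\<lambda>t. \<zeta> n t - \<eta> t)) \<longlonglongrightarrow> 0)"

definition integrated_norm ::
    "real \<Rightarrow> 'x measure \<Rightarrow> 'g::topological_group_add measure \<Rightarrow>
      (('g \<Rightarrow> 'a::complex_banach_algebra) \<Rightarrow> 'l::complex_banach_algebra) \<Rightarrow>
      ('a \<Rightarrow> 'x opr) \<Rightarrow> ('g \<Rightarrow> 'x opr) \<Rightarrow> 'l \<Rightarrow> real" where
  "integrated_norm p M \<mu> \<iota> \<pi> v x =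
    Sup {Lp_norm p M \<eta> |\<xi> \<eta>. \<xi> \<in> Lp p M \<and> Lp_norm p M \<xi> \<le> 1 \<and>
      has_integrated_form p M \<mu> \<iota> \<pi> v x \<xi> \<eta>}"


section \<open>Regular covariant representations\<close>

definition Lp_simple_function ::
    "real \<Rightarrow> 'g measure \<Rightarrow> 'y measure \<Rightarrow> ('g \<Rightarrow> 'y \<Rightarrow> complex) \<Rightarrow> bool" where
  "Lp_simple_function p \<mu> M\<^sub>0 s \<longleftrightarrow>
    finite (range s) \<and> range s \<subseteq> Lp p M\<^sub>0 \<and> (\<forall>y. {g. s g = y} \<in> sets \<mu>)"

text \<open>The Bochner space $L^p(G,L^p(M_0))$: strongly measurable functions with $p$-integrable
  norm.\<close>

definition Lp_valued :: "real \<Rightarrow> 'g measure \<Rightarrow> 'y measure \<Rightarrow> ('g \<Rightarrow> 'y \<Rightarrow> complex) set" where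
  "Lp_valued p \<mu> M\<^sub>0 = {\<xi>.
    (\<forall>g. \<xi> g \<in> Lp p M\<^sub>0) \<and>
    (\<exists>s. (\<forall>n::nat. Lp_simple_function p \<mu> M\<^sub>0 (s n)) \<and>
      (AE g in \<mu>. (\<lambda>n. Lp_norm p M\<^sub>0 (\<lambda>y. s n g y - \<xi> g y)) \<longlonglongrightarrow> 0)) \<and>
    integrable \<mu> (\<lambda>g. Lp_norm p M\<^sub>0 (\<xi> g) powr p)}"

definition Lp_valued_norm ::
    "real \<Rightarrow> 'g measure \<Rightarrow> 'y measure \<Rightarrow> ('g \<Rightarrow> 'y \<Rightarrow> complex) \<Rightarrow> real" where
  "Lp_valued_norm p \<mu> M\<^sub>0 \<xi> = (\<integral>g. Lp_norm p M\<^sub>0 (\<xi> g) powr p \<partial>\<mu>) powr (1 / p)"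

definition ae_eq_valued ::
    "'g measure \<Rightarrow> 'y measure \<Rightarrow> ('g \<Rightarrow> 'y \<Rightarrow> complex) \<Rightarrow> ('g \<Rightarrow> 'y \<Rightarrow> complex) \<Rightarrow> bool" where
  "ae_eq_valued \<mu> M\<^sub>0 \<xi> \<zeta> \<longleftrightarrow> (AE g in \<mu>. ae_eq M\<^sub>0 (\<xi> g) (\<zeta> g))"

text \<open>\<open>\<Phi>\<close> induces an isometric isomorphism from $L^p(M)$ onto $L^p(G,L^p(M_0))$.\<close>

definition Lp_valued_iso ::
    "real \<Rightarrow> 'x measure \<Rightarrow> 'g measure \<Rightarrow> 'y measure \<Rightarrow>
      (('x \<Rightarrow> complex) \<Rightarrow> 'g \<Rightarrow> 'y \<Rightarrow> complex) \<Rightarrow> bool" where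
  "Lp_valued_iso p M \<mu> M\<^sub>0 \<Phi> \<longleftrightarrow>
    (\<forall>f\<in>Lp p M. \<Phi> f \<in> Lp_valued p \<mu> M\<^sub>0 \<and> Lp_valued_norm p \<mu> M\<^sub>0 (\<Phi> f) = Lp_norm p M f) \<and>
    (\<forall>f\<in>Lp p M. \<forall>h\<in>Lp p M.
      ae_eq_valued \<mu> M\<^sub>0 (\<Phi> (\<lambda>x. f x + h x)) (\<lambda>g y. \<Phi> f g y + \<Phi> h g y)) \<and>
    (\<forall>c. \<forall>f\<in>Lp p M. ae_eq_valued \<mu> M\<^sub>0 (\<Phi> (\<lambda>x. c * f x)) (\<lambda>g y. c * \<Phi> f g y)) \<and>
    (\<forall>\<xi>\<in>Lp_valued p \<mu> M\<^sub>0. \<exists>f\<in>Lp p M. ae_eq_valued \<mu> M\<^sub>0 (\<Phi> f) \<xi>)"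

text \<open>The covariant representation \<open>(\<pi>, v)\<close> on $L^p(M)$ is, under an identification
  $L^p(M)\cong L^p(G,L^p(M_0))$, the regular covariant representation associated with \<open>\<pi>\<^sub>0\<close>.\<close>

definition regular_rep_of ::
    "real \<Rightarrow> ('g::topological_group_add \<Rightarrow> 'a \<Rightarrow> 'a) \<Rightarrow> 'g measure \<Rightarrow>
      'y measure \<Rightarrow> ('a::complex_banach_algebra \<Rightarrow> 'y opr) \<Rightarrow>
      'x measure \<Rightarrow> ('a \<Rightarrow> 'x opr) \<Rightarrow> ('g \<Rightarrow> 'x opr) \<Rightarrow> bool" where
  "regular_rep_of p \<alpha> \<mu> M\<^sub>0 \<pi>\<^sub>0 M \<pi> v \<longleftrightarrow>
    covariant_rep p \<alpha> M \<pi> v \<and>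
    (\<exists>\<Phi>. Lp_valued_iso p M \<mu> M\<^sub>0 \<Phi> \<and>
      (\<forall>a. \<forall>f\<in>Lp p M.
        ae_eq_valued \<mu> M\<^sub>0 (\<Phi> (\<pi> a f)) (\<lambda>g. \<pi>\<^sub>0 (\<alpha> (- g) a) (\<Phi> f g))) \<and>
      (\<forall>g. \<forall>f\<in>Lp p M.
        ae_eq_valued \<mu> M\<^sub>0 (\<Phi> (v g f)) (\<lambda>h. \<Phi> f (- g + h))))"


section \<open>Crossed products\<close>

text \<open>The suprema defining the crossed product norms range over all measure spaces whose points
  belong to the following type. Restricting representations to invariant closed sublattices that
  are generated by countably many vectors, one needs only $L^p$-spaces of density character at most
  $\max(|G|,|A|,\aleph_0)$, and each of these is isometrically isomorphic to $L^p(\nu)$ for a measure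
  \<open>\<nu>\<close> on a set of cardinality at most that of \<open>(nat \<times> ('g + 'a)) set\<close> (apart from the trivial
  case \<open>A = 0\<close>). The suprema therefore do not depend on \<open>'m\<close>, which can be chosen to include any
  given measure space.\<close>

type_synonym ('g, 'a, 'm) points = "(nat \<times> ('g + 'a + 'm)) set"

type_synonym ('g, 'a, 'x) rep = "'x measure \<times> ('a \<Rightarrow> 'x opr) \<times> ('g \<Rightarrow> 'x opr)"

definition covariant_reps ::
    "real \<Rightarrow> ('g::topological_group_add \<Rightarrow> 'a::complex_banach_algebra \<Rightarrow> 'a) \<Rightarrow>
      ('g, 'a, ('g, 'a, 'm) points) rep set" where
  "covariant_reps p \<alpha> = {(M, \<pi>, v). covariant_rep p \<alpha> M \<pi> v}"

definition regular_reps ::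
    "real \<Rightarrow> ('g::topological_group_add \<Rightarrow> 'a::complex_banach_algebra \<Rightarrow> 'a) \<Rightarrow> 'g measure \<Rightarrow>
      ('g, 'a, ('g, 'a, 'm) points) rep set" where
  "regular_reps p \<alpha> \<mu> = {(M, \<pi>, v).
    \<exists>(M\<^sub>0 :: ('g, 'a, 'm) points measure) \<pi>\<^sub>0.
      contractive_rep p M\<^sub>0 \<pi>\<^sub>0 \<and> nondegenerate_rep p M\<^sub>0 \<pi>\<^sub>0 \<and>
      regular_rep_of p \<alpha> \<mu> M\<^sub>0 \<pi>\<^sub>0 M \<pi> v}"

definition sup_norm ::
    "real \<Rightarrow> 'g::topological_group_add measure \<Rightarrow>
      (('g \<Rightarrow> 'a::complex_banach_algebra) \<Rightarrow> 'l::complex_banach_algebra) \<Rightarrow>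
      ('g, 'a, 'x) rep set \<Rightarrow> 'l \<Rightarrow> real" where
  "sup_norm p \<mu> \<iota> R x = Sup {integrated_norm p M \<mu> \<iota> \<pi> v x |M \<pi> v. (M, \<pi>, v) \<in> R}"

text \<open>\<open>\<kappa>\<close> exhibits its codomain as $F^p(G,A,\alpha)$, respectively as $F^p_\lambda(G,A,\alpha)$, where
  $L^1(G,A,\alpha)$ is given by \<open>\<iota>\<close>.\<close>

definition is_full_crossed_product ::
    "'m itself \<Rightarrow> real \<Rightarrow> ('g::topological_group_add \<Rightarrow> 'a \<Rightarrow> 'a) \<Rightarrow> 'g measure \<Rightarrow>
      (('g \<Rightarrow> 'a::complex_banach_algebra) \<Rightarrow> 'l::complex_banach_algebra) \<Rightarrow>
      ('l \<Rightarrow> 'f::complex_banach_algebra) \<Rightarrow> bool" where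
  "is_full_crossed_product (_ :: 'm itself) p \<alpha> \<mu> \<iota> \<kappa> \<longleftrightarrow>
    is_completion UNIV (+) (*\<^sub>C) (*)
      (sup_norm p \<mu> \<iota> (covariant_reps p \<alpha> :: ('g, 'a, ('g, 'a, 'm) points) rep set)) \<kappa>"

definition is_reduced_crossed_product ::
    "'m itself \<Rightarrow> real \<Rightarrow> ('g::topological_group_add \<Rightarrow> 'a \<Rightarrow> 'a) \<Rightarrow> 'g measure \<Rightarrow>
      (('g \<Rightarrow> 'a::complex_banach_algebra) \<Rightarrow> 'l::complex_banach_algebra) \<Rightarrow>
      ('l \<Rightarrow> 'f::complex_banach_algebra) \<Rightarrow> bool" where
  "is_reduced_crossed_product (_ :: 'm itself) p \<alpha> \<mu> \<iota> \<kappa> \<longleftrightarrow>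
    is_completion UNIV (+) (*\<^sub>C) (*)
      (sup_norm p \<mu> \<iota> (regular_reps p \<alpha> \<mu> :: ('g, 'a, ('g, 'a, 'm) points) rep set)) \<kappa>"

end

theory Submission
  imports Defs
begin

text \<open>
  A Banach algebra has a contractive approximate identity iff finite subsets of a dense subspace are
  approximately fixed by elements of its unit ball, so the property passes along contractive
  homomorphisms with dense range. By Hoelder duality every integrated form is dominated by the
  $L^1$-norm, which makes $L^1(G,A,\alpha)\to F^p(G,A,\alpha)\to F^p_\lambda(G,A,\alpha)$ such
  homomorphisms. In $L^1(G,A,\alpha)$ one takes $f\otimes e$, where $e$ is almost an identity for the
  compact sets $a(G)$ and $\{\alpha_{g^{-1}}(a(g))\}$, and $f\ge 0$ is a bump function of integral $1$
  near the neutral element with $f(g^{-1})=f(g)$. The symmetry of $f$ replaces the modular function in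
  the estimate for multiplication from the right. If $G$ is discrete, compressing the regular
  representation to the summand at the neutral element shows that $x\mapsto x(0)$ extends to a
  contraction $F^p_\lambda(G,A,\alpha)\to A$, which maps an approximate identity to one of $A$.
\<close>

section \<open>Approximate identities and dense subalgebras\<close>

text \<open>No homomorphism between the crossed products is ever constructed. Both are completions
  of L^1(G,A,\<alpha>), so an approximate unit is moved into the dense image of that algebra, lifted
  to it, and mapped on by the other completion map; only the norm inequality between the two maps
  enters. The coefficient x |-> x(0) is not multiplicative, but it commutes with multiplication by
  functions supported at the neutral element, and an approximate identity of A asks no more: x(0) a
  - a is the coefficient of x * a - a. Three features of the setting shape the rest. The norms are
  suprema of sets of reals, which say something only for nonempty bounded sets; hence the
  representation on a zero space and the early bound by the L^1-norm. Integrals in L^p(M) are given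
  weakly, through integrals over sets of finite measure, so their norms are reached by pairing.
  Finally, A may be nonseparable and G uncountable, so Bochner integrals rest on compactness, and
  null sets of direct sums are assembled fibrewise.\<close>

definition approx_unit_at :: "side \<Rightarrow> 'a::complex_banach_algebra \<Rightarrow> 'a \<Rightarrow> real \<Rightarrow> bool" where
  "approx_unit_at s e a \<epsilon> \<longleftrightarrow>
    (s \<in> {Left, TwoSided} \<longrightarrow> norm (e * a - a) < \<epsilon>) \<and>
    (s \<in> {Right, TwoSided} \<longrightarrow> norm (a * e - a) < \<epsilon>)"

lemma approx_unit_at_mono: "approx_unit_at s e a \<delta> \<Longrightarrow> \<delta> \<le> \<epsilon> \<Longrightarrow> approx_unit_at s e a \<epsilon>"
  by (auto simp: approx_unit_at_def)

lemma approx_unit_at_perturb_left: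
  assumes "approx_unit_at s e a \<epsilon>" "norm (d - e) \<le> \<delta>"
  shows "approx_unit_at s d a (\<epsilon> + \<delta> * norm a)"
proof -
  have "norm (d * a - a) \<le> norm (e * a - a) + \<delta> * norm a"
  proof -
    have "d * a - a = (e * a - a) + (d - e) * a" by (simp add: algebra_simps)
    then have "norm (d * a - a) \<le> norm (e * a - a) + norm ((d - e) * a)"
      by (metis norm_triangle_ineq)
    also have "norm ((d - e) * a) \<le> \<delta> * norm a"
      by (rule order_trans[OF norm_mult_ineq]) (use assms in \<open>auto intro: mult_right_mono\<close>)
    finally show ?thesis by simp
  qed
  moreover have "norm (a * d - a) \<le> norm (a * e - a) + \<delta> * norm a"
  proof -
    have "a * d - a = (a * e - a) + a * (d - e)" by (simp add: algebra_simps)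
    then have "norm (a * d - a) \<le> norm (a * e - a) + norm (a * (d - e))"
      by (metis norm_triangle_ineq)
    also have "norm (a * (d - e)) \<le> norm a * \<delta>"
      by (rule order_trans[OF norm_mult_ineq]) (use assms in \<open>auto intro: mult_left_mono\<close>)
    finally show ?thesis by (simp add: mult.commute)
  qed
  ultimately show ?thesis using assms(1) by (auto simp: approx_unit_at_def)
qed

lemma norm_add_diff_le: "norm (x + (y - z)) \<le> norm x + (norm y + norm z)"
  for x y z :: "'a::real_normed_vector"
  using norm_triangle_ineq[of x "y - z"] norm_triangle_ineq4[of y z] by linarith

text \<open>Since \<open>norm e \<le> 1\<close>, the map a |-> e a - a is 2-Lipschitz, which
  explains the factor 2.\<close>

lemma approx_unit_at_perturb_right:
  assumes "approx_unit_at s e b \<epsilon>" "norm e \<le> 1" "norm (a - b) \<le> \<delta>"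
  shows "approx_unit_at s e a (\<epsilon> + 2 * \<delta>)"
proof -
  have m: "norm e * norm (a - b) \<le> \<delta>"
    using mult_mono[OF assms(2) assms(3)] by simp
  have "norm (e * a - a) \<le> norm (e * b - b) + 2 * \<delta>"
  proof -
    have "e * a - a = (e * b - b) + (e * (a - b) - (a - b))" by (simp add: algebra_simps)
    then have "norm (e * a - a) \<le> norm (e * b - b) + (norm (e * (a - b)) + norm (a - b))"
      by (simp only: norm_add_diff_le)
    then show ?thesis using m assms(3) norm_mult_ineq[of e "a - b"] by linarith
  qed
  moreover have "norm (a * e - a) \<le> norm (b * e - b) + 2 * \<delta>"
  proof -
    have "a * e - a = (b * e - b) + ((a - b) * e - (a - b))" by (simp add: algebra_simps)
    then have "norm (a * e - a) \<le> norm (b * e - b) + (norm ((a - b) * e) + norm (a - b))"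
      by (simp only: norm_add_diff_le)
    then show ?thesis using m assms(3) norm_mult_ineq[of "a - b" e] by (simp add: mult.commute)
  qed
  ultimately show ?thesis using assms(1) by (auto simp: approx_unit_at_def)
qed

text \<open>Unlike the filter, a condition on finite sets and a tolerance can be transported along
  maps with dense image.\<close>

lemma has_contractive_approx_identity_iff:
  "has_contractive_approx_identity s TYPE('a::complex_banach_algebra) \<longleftrightarrow>
    (\<forall>S \<epsilon>. finite S \<longrightarrow> 0 < \<epsilon> \<longrightarrow> (\<exists>e::'a. norm e \<le> 1 \<and> (\<forall>a\<in>S. approx_unit_at s e a \<epsilon>)))"
proof
  assume "has_contractive_approx_identity s TYPE('a)"
  then obtain F :: "'a filter" where F: "F \<noteq> bot" "\<forall>\<^sub>F e in F. norm e \<le> 1"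
    "s \<in> {Left, TwoSided} \<Longrightarrow> ((\<lambda>e. e * a) \<longlongrightarrow> a) F"
    "s \<in> {Right, TwoSided} \<Longrightarrow> ((\<lambda>e. a * e) \<longlongrightarrow> a) F" for a
    unfolding has_contractive_approx_identity_def by blast
  show "\<forall>S \<epsilon>. finite S \<longrightarrow> 0 < \<epsilon> \<longrightarrow> (\<exists>e::'a. norm e \<le> 1 \<and> (\<forall>a\<in>S. approx_unit_at s e a \<epsilon>))"
  proof (intro allI impI)
    fix S :: "'a set" and \<epsilon> :: real assume S: "finite S" "0 < \<epsilon>"
    have "\<forall>\<^sub>F e in F. approx_unit_at s e a \<epsilon>" for a
    proof -
      have "\<forall>\<^sub>F e in F. s \<in> {Left, TwoSided} \<longrightarrow> norm (e * a - a) < \<epsilon>"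
        using tendstoD[OF F(3) S(2), of a]
        by (cases "s \<in> {Left, TwoSided}") (auto simp: dist_norm elim: eventually_mono)
      moreover have "\<forall>\<^sub>F e in F. s \<in> {Right, TwoSided} \<longrightarrow> norm (a * e - a) < \<epsilon>"
        using tendstoD[OF F(4) S(2), of a]
        by (cases "s \<in> {Right, TwoSided}") (auto simp: dist_norm elim: eventually_mono)
      ultimately show ?thesis unfolding approx_unit_at_def by eventually_elim auto
    qed
    then have "\<forall>\<^sub>F e in F. \<forall>a\<in>S. approx_unit_at s e a \<epsilon>"
      using S(1) by (simp add: eventually_ball_finite)
    with F(2) have "\<forall>\<^sub>F e in F. norm e \<le> 1 \<and> (\<forall>a\<in>S. approx_unit_at s e a \<epsilon>)"
      by eventually_elim auto
    then show "\<exists>e::'a. norm e \<le> 1 \<and> (\<forall>a\<in>S. approx_unit_at s e a \<epsilon>)"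
      using F(1) eventually_happens' by blast
  qed
next
  assume *: "\<forall>S \<epsilon>. finite S \<longrightarrow> 0 < \<epsilon> \<longrightarrow> (\<exists>e::'a. norm e \<le> 1 \<and> (\<forall>a\<in>S. approx_unit_at s e a \<epsilon>))"
  have "\<exists>e::'a. norm e \<le> 1 \<and> (\<forall>(a, n)\<in>T. approx_unit_at s e a (1 / Suc n))"
    if T: "finite T" for T :: "('a \<times> nat) set"
  proof -
    \<comment> \<open>\<open>T\<close> asks for several tolerances at once; the strictest one serves
      them all. \<open>insert 0\<close> keeps \<open>Max\<close> meaningful for empty
      \<open>T\<close>.\<close>
    define m where "m = Max (insert 0 (snd ` T))"
    obtain e :: 'a where e: "norm e \<le> 1" "\<forall>a\<in>fst ` T. approx_unit_at s e a (1 / Suc m)"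
      using * T by (metis finite_imageI of_nat_0_less_iff zero_less_Suc zero_less_divide_1_iff)
    have "1 / real (Suc m) \<le> 1 / real (Suc n)" if "(a, n) \<in> T" for a n
    proof -
      have "n \<le> m" unfolding m_def using T that by (auto intro!: Max_ge rev_image_eqI)
      then show ?thesis by (simp add: frac_le)
    qed
    with e show ?thesis by (force intro: approx_unit_at_mono)
  qed
  then obtain e where e: "\<And>T :: ('a \<times> nat) set. finite T \<Longrightarrow> norm (e T :: 'a) \<le> 1"
    "\<And>T a n. finite T \<Longrightarrow> (a, n) \<in> T \<Longrightarrow> approx_unit_at s (e T) a (1 / Suc n)"
    by (metis (mono_tags, lifting) case_prodD)
  \<comment> \<open>Finite sets of demands (point, tolerance), directed by inclusion, index a net of
    units: once \<open>T\<close> contains \<open>(a, n)\<close> with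
    \<open>1 / Suc n < \<epsilon>\<close>, the unit \<open>e T\<close> is good at
    \<open>a\<close>.\<close>
  define F where "F = filtermap e (finite_subsets_at_top (UNIV :: ('a \<times> nat) set))"
  have ev: "\<forall>\<^sub>F d in F. approx_unit_at s d a \<epsilon>" if "0 < \<epsilon>" for a and \<epsilon> :: real
  proof -
    obtain n where "1 / real (Suc n) < \<epsilon>" using \<open>0 < \<epsilon>\<close> nat_approx_posE by blast
    then have "approx_unit_at s (e T) a \<epsilon>" if "finite T" "{(a, n)} \<subseteq> T" for T
      using e(2)[of T a n] that by (auto intro: approx_unit_at_mono)
    then show ?thesis
      unfolding F_def eventually_filtermap eventually_finite_subsets_at_top
      by (intro exI[of _ "{(a, n)}"]) auto
  qed
  have "F \<noteq> bot" unfolding F_def by (simp add: filtermap_bot_iff)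
  moreover have "\<forall>\<^sub>F d in F. norm d \<le> 1"
    unfolding F_def eventually_filtermap using e(1)
    by (auto intro: eventually_finite_subsets_at_top_weakI)
  moreover have "((\<lambda>e. e * a) \<longlongrightarrow> a) F" if "s \<in> {Left, TwoSided}" for a
    unfolding tendsto_iff dist_norm
  proof (intro allI impI)
    fix \<epsilon> :: real assume "0 < \<epsilon>"
    from ev[OF this, of a] show "\<forall>\<^sub>F e in F. norm (e * a - a) < \<epsilon>"
      by eventually_elim (use that in \<open>auto simp: approx_unit_at_def\<close>)
  qed
  moreover have "((\<lambda>e. a * e) \<longlongrightarrow> a) F" if "s \<in> {Right, TwoSided}" for a
    unfolding tendsto_iff dist_norm
  proof (intro allI impI)
    fix \<epsilon> :: real assume "0 < \<epsilon>"
    from ev[OF this, of a] show "\<forall>\<^sub>F e in F. norm (a * e - a) < \<epsilon>"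
      by eventually_elim (use that in \<open>auto simp: approx_unit_at_def\<close>)
  qed
  ultimately show "has_contractive_approx_identity s TYPE('a)"
    unfolding has_contractive_approx_identity_def by blast
qed

text \<open>Contractivity of the units makes a dense set of test points enough: the error
  \<epsilon>/3 at a nearby point plus twice the distance \<epsilon>/3.\<close>

lemma has_contractive_approx_identity_dense:
  fixes D :: "'a::complex_banach_algebra set"
  assumes D: "closure D = UNIV"
    and e: "\<And>S \<epsilon>. finite S \<Longrightarrow> S \<subseteq> D \<Longrightarrow> 0 < \<epsilon> \<Longrightarrow>
      \<exists>e::'a. norm e \<le> 1 \<and> (\<forall>a\<in>S. approx_unit_at s e a \<epsilon>)"
  shows "has_contractive_approx_identity s TYPE('a)"
  unfolding has_contractive_approx_identity_iff
proof (intro allI impI)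
  fix S :: "'a set" and \<epsilon> :: real assume S: "finite S" "0 < \<epsilon>"
  have "\<exists>b\<in>D. norm (a - b) \<le> \<epsilon> / 3" for a
  proof -
    have "\<exists>b\<in>D. dist b a < \<epsilon> / 3" using D S(2) closure_approachable[of a D]
      by (metis UNIV_I divide_pos_pos zero_less_numeral)
    then show ?thesis by (metis dist_commute dist_norm less_imp_le)
  qed
  then obtain b where b: "\<And>a. b a \<in> D" "\<And>a. norm (a - b a) \<le> \<epsilon> / 3" by metis
  obtain e where e: "norm e \<le> 1" "\<forall>a\<in>b ` S. approx_unit_at s e a (\<epsilon> / 3)"
    using e[of "b ` S" "\<epsilon> / 3"] b S by auto
  have "approx_unit_at s e a \<epsilon>" if "a \<in> S" for a
    using approx_unit_at_perturb_right[of s e "b a" "\<epsilon> / 3" a "\<epsilon> / 3"] e b that by auto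
  with e show "\<exists>e::'a. norm e \<le> 1 \<and> (\<forall>a\<in>S. approx_unit_at s e a \<epsilon>)" by auto
qed

text \<open>An element of \<open>D\<close> close to a unit may have norm slightly above 1, so it is
  rescaled; this is why \<open>D\<close> has to be closed under real multiples.\<close>

lemma contractive_approx_identity_in_dense:
  fixes D S :: "'a::complex_banach_algebra set"
  assumes D: "closure D = UNIV" "\<And>r d. d \<in> D \<Longrightarrow> r *\<^sub>R d \<in> D"
    and cai: "has_contractive_approx_identity s TYPE('a)"
    and S: "finite S" "0 < \<epsilon>"
  obtains e where "e \<in> D" "norm e \<le> 1" "\<And>a. a \<in> S \<Longrightarrow> approx_unit_at s e a \<epsilon>"
proof -
  obtain e :: 'a where e: "norm e \<le> 1" "\<And>a. a \<in> S \<Longrightarrow> approx_unit_at s e a (\<epsilon> / 2)"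
    using cai S unfolding has_contractive_approx_identity_iff by (metis half_gt_zero)
  \<comment> \<open>The summand 1 keeps \<open>B\<close> positive. The final element is within
    \<open>2 * \<delta>\<close> of \<open>e\<close>, which costs at most
    \<open>2 * \<delta> * B = \<epsilon> / 2\<close> at each point of \<open>S\<close>.\<close>
  define B where "B = (\<Sum>a\<in>S. norm a) + 1"
  have B: "0 < B" unfolding B_def by (simp add: sum_nonneg add_nonneg_pos)
  have aB: "norm a \<le> B" if "a \<in> S" for a
    unfolding B_def using S(1) that member_le_sum[of a S norm] by simp
  define \<delta> where "\<delta> = \<epsilon> / (4 * B)"
  have \<delta>: "0 < \<delta>" using S B by (simp add: \<delta>_def)
  obtain d where d: "d \<in> D" "norm (d - e) < \<delta>"
    using D(1) \<delta> closure_approachable[of e D] by (auto simp: dist_norm)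
  define d' where "d' = (1 / (1 + \<delta>)) *\<^sub>R d"
  have nd: "norm d \<le> 1 + \<delta>" using d(2) e(1) norm_triangle_ineq2[of d e] by linarith
  have n1: "norm d' \<le> 1" unfolding d'_def using nd \<delta> by simp
  \<comment> \<open>Scaling displaces \<open>d\<close> by at most \<open>\<delta>\<close>, because
    \<open>norm d \<le> 1 + \<delta>\<close>.\<close>
  have "d' - d = - (\<delta> / (1 + \<delta>)) *\<^sub>R d"
    unfolding d'_def using \<delta> scaleR_left_diff_distrib[of "1 / (1 + \<delta>)" 1 d]
    by (simp add: field_simps)
  then have "norm (d' - d) = \<delta> * (norm d / (1 + \<delta>))" using \<delta> by simp
  also have "\<dots> \<le> \<delta> * 1" using nd \<delta> by (intro mult_left_mono) auto
  finally have "norm (d' - e) \<le> 2 * \<delta>"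
    using d(2) norm_triangle_ineq[of "d' - d" "d - e"] by simp
  have "approx_unit_at s d' a \<epsilon>" if "a \<in> S" for a
  proof -
    have "2 * \<delta> * norm a \<le> 2 * \<delta> * B" using aB[OF that] \<delta> by (intro mult_left_mono) auto
    also have "\<dots> = \<epsilon> / 2" using B by (simp add: \<delta>_def)
    finally show ?thesis
      using approx_unit_at_perturb_left[OF e(2)[OF that] \<open>norm (d' - e) \<le> 2 * \<delta>\<close>]
      by (auto intro: approx_unit_at_mono)
  qed
  moreover have "d' \<in> D" unfolding d'_def by (rule D(2)[OF d(1)])
  ultimately show thesis using that n1 by blast
qed

section \<open>Transfer of approximate identities between completions of one algebra\<close>

lemma completion_scaleR:
  assumes "is_completion UNIV (+) (*\<^sub>C) (*) N \<phi>"
  shows "\<phi> (r *\<^sub>R (x::'l::complex_banach_algebra)) = r *\<^sub>R \<phi> x"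
  using assms unfolding is_completion_def by (metis UNIV_I scaleC_of_real)

lemma completion_diff:
  assumes "is_completion UNIV (+) (*\<^sub>C) (*) N \<phi>"
  shows "\<phi> (x - y) = \<phi> x - \<phi> (y::'l::complex_banach_algebra)"
  using assms unfolding is_completion_def by (metis UNIV_I diff_add_cancel eq_diff_eq)

text \<open>The unit for the \<phi>-images is chosen of the form \<open>\<phi> u\<close>; then
  \<open>le\<close>, applied to \<open>u * t - t\<close> and \<open>t * u - t\<close>, carries the
  estimates over to \<open>\<psi> u\<close>.\<close>

lemma contractive_approx_identity_completion_mono:
  fixes \<phi> :: "'l::complex_banach_algebra \<Rightarrow> 'b::complex_banach_algebra"
    and \<psi> :: "'l \<Rightarrow> 'c::complex_banach_algebra"
  assumes \<phi>: "is_completion UNIV (+) (*\<^sub>C) (*) N \<phi>" and \<psi>: "is_completion UNIV (+) (*\<^sub>C) (*) N' \<psi>"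
    and le: "\<And>x. norm (\<psi> x) \<le> norm (\<phi> x)"
    and cai: "has_contractive_approx_identity s TYPE('b)"
  shows "has_contractive_approx_identity s TYPE('c)"
proof (rule has_contractive_approx_identity_dense)
  show "closure (range \<psi>) = UNIV" using \<psi> by (auto simp: is_completion_def)
  fix S \<epsilon> assume S: "finite S" "S \<subseteq> range \<psi>" "0 < (\<epsilon>::real)"
  then obtain T where T: "finite T" "S = \<psi> ` T" using finite_subset_image by (metis subset_UNIV)
  have "closure (range \<phi>) = UNIV" using \<phi> by (auto simp: is_completion_def)
  moreover have "r *\<^sub>R d \<in> range \<phi>" if "d \<in> range \<phi>" for r d
    using that completion_scaleR[OF \<phi>] by (metis (no_types, lifting) imageE rangeI)
  ultimately obtain e where e: "e \<in> range \<phi>" "norm e \<le> 1" "\<And>a. a \<in> \<phi> ` T \<Longrightarrow> approx_unit_at s e a \<epsilon>"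
    using contractive_approx_identity_in_dense[OF _ _ cai, of "range \<phi>" "\<phi> ` T" \<epsilon>] T S
    by (metis finite_imageI)
  then obtain u where u: "e = \<phi> u" by auto
  have mult: "\<phi> (x * y) = \<phi> x * \<phi> y" "\<psi> (x * y) = \<psi> x * \<psi> y" for x y
    using \<phi> \<psi> by (auto simp: is_completion_def)
  have "approx_unit_at s (\<psi> u) (\<psi> t) \<epsilon>" if "t \<in> T" for t
    using e(3)[of "\<phi> t"] le[of "u * t - t"] le[of "t * u - t"] that u
    by (auto simp: approx_unit_at_def mult completion_diff[OF \<phi>] completion_diff[OF \<psi>])
  moreover have "norm (\<psi> u) \<le> 1" using le[of u] e u by simp
  ultimately show "\<exists>e. norm e \<le> 1 \<and> (\<forall>a\<in>S. approx_unit_at s e a \<epsilon>)" using T by auto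
qed

section \<open>$L^p$-norms\<close>

abbreviation (input) simple_bochner_integrable :: "'x measure \<Rightarrow> ('x \<Rightarrow> 'b::real_vector) \<Rightarrow> bool" where
  "simple_bochner_integrable \<equiv> Bochner_Integration.simple_bochner_integrable"

abbreviation (input) simple_bochner_integral :: "'x measure \<Rightarrow> ('x \<Rightarrow> 'b::real_vector) \<Rightarrow> 'b" where
  "simple_bochner_integral \<equiv> Bochner_Integration.simple_bochner_integral"

lemma powr_convex_combination:
  fixes t u x y p :: real
  assumes "1 \<le> p" "0 \<le> x" "0 \<le> y" "0 \<le> t" "0 \<le> u" "t + u = 1"
  shows "(t * x + u * y) powr p \<le> t * x powr p + u * y powr p"
proof -
  \<comment> \<open>Serves the case of a zero argument: \<open>c powr p \<le> c\<close> for
    \<open>c\<close> in [0,1].\<close>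
  have s: "(c * z) powr p \<le> c * z powr p" if "0 \<le> c" "c \<le> 1" "0 \<le> z" for c z :: real
  proof (cases "c = 0")
    case False
    then have "c powr p \<le> c powr 1" using that assms(1) by (intro powr_mono') auto
    then show ?thesis using that by (simp add: powr_mult mult_right_mono)
  qed auto
  show ?thesis
  proof (cases "x = 0 \<or> y = 0")
    case True
    then show ?thesis using s[of u y] s[of t x] assms by auto
  next
    case False
    then show ?thesis
      using convex_onD[OF powr_convex[OF assms(1)], of u x y] assms
      by (auto simp: eq_diff_eq[symmetric])
  qed
qed

text \<open>Young's inequality for u and w = v^(p-1), since w^q = v^p for the conjugate exponent q.
  With the weights 1/p and 1 - 1/p it also makes sense for p = 1.\<close>

lemma weighted_Young:
  fixes u v p :: real
  assumes "1 \<le> p" "0 \<le> u" "0 \<le> v"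
  shows "u * v powr (p - 1) \<le> u powr p / p + (1 - 1 / p) * v powr p"
proof (cases "u = 0 \<or> v = 0")
  case True
  moreover have "0 \<le> (1 - 1 / p) * v powr p" using assms by simp
  ultimately show ?thesis using assms by auto
next
  case False
  then have "(u powr p) powr (1 / p) * (v powr p) powr (1 - 1 / p)
      \<le> 1 / p * u powr p + (1 - 1 / p) * v powr p"
    using assms by (intro Youngs_inequality_0) auto
  moreover have "p * (1 - 1 / p) = p - 1" using assms by (simp add: field_simps)
  then have "(u powr p) powr (1 / p) = u" "(v powr p) powr (1 - 1 / p) = v powr (p - 1)"
    using assms False by (simp_all add: powr_powr)
  ultimately show ?thesis by simp
qed

section \<open>L^p-norms and the inequalities of Minkowski and Hoelder\<close>

lemma Lp_norm_nonneg [simp]: "0 \<le> Lp_norm p M f"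
  by (simp add: Lp_norm_def)

lemma Lp_measurable [measurable_dest]: "f \<in> Lp p M \<Longrightarrow> f \<in> borel_measurable M"
  by (simp add: Lp_def)

lemma Lp_integrable: "f \<in> Lp p M \<Longrightarrow> integrable M (\<lambda>x. cmod (f x) powr p)"
  by (simp add: Lp_def)

lemma Lp_norm_cong: "(AE x in M. f x = g x) \<Longrightarrow> f \<in> borel_measurable M \<Longrightarrow> g \<in> borel_measurable M \<Longrightarrow>
    Lp_norm p M f = Lp_norm p M g"
  unfolding Lp_norm_def by (intro arg_cong2[where f="(powr)"] integral_cong_AE) auto

lemma Lp_dominated:
  assumes "f \<in> Lp p M" "g \<in> borel_measurable M" "AE x in M. cmod (g x) \<le> cmod (f x)" "0 \<le> p"
  shows "g \<in> Lp p M" "Lp_norm p M g \<le> Lp_norm p M f"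
proof -
  have le: "AE x in M. cmod (g x) powr p \<le> cmod (f x) powr p"
    using assms(3) by eventually_elim (use assms(4) in \<open>auto intro: powr_mono2\<close>)
  have i: "integrable M (\<lambda>x. cmod (g x) powr p)"
    by (rule Bochner_Integration.integrable_bound[OF Lp_integrable[OF assms(1)]]) (use assms(2) le in auto)
  then show "g \<in> Lp p M" using assms(2) by (simp add: Lp_def)
  show "Lp_norm p M g \<le> Lp_norm p M f"
    unfolding Lp_norm_def
    by (intro powr_mono2 integral_mono_AE[OF i Lp_integrable[OF assms(1)] le]) (use assms(4) in auto)
qed

lemma Lp_zero [simp]: "0 < p \<Longrightarrow> (\<lambda>_. 0) \<in> Lp p M" "0 < p \<Longrightarrow> Lp_norm p M (\<lambda>_. 0) = 0"
  by (simp_all add: Lp_def Lp_norm_def)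

lemma Lp_minus [simp]: "f \<in> Lp p M \<Longrightarrow> (\<lambda>x. - f x) \<in> Lp p M"
  by (auto simp: Lp_def)

lemma Lp_norm_minus_commute: "Lp_norm p M (\<lambda>x. f x - g x) = Lp_norm p M (\<lambda>x. g x - f x)"
  unfolding Lp_norm_def by (simp add: norm_minus_commute)

context
  fixes p :: real
  assumes p: "1 \<le> p"
begin

lemma Lp_norm_powr: "Lp_norm p M f powr p = (\<integral>x. cmod (f x) powr p \<partial>M)"
  unfolding Lp_norm_def using p by (simp add: powr_powr)

lemma Lp_norm_le_iff: "0 \<le> c \<Longrightarrow> Lp_norm p M f \<le> c \<longleftrightarrow> (\<integral>x. cmod (f x) powr p \<partial>M) \<le> c powr p"
  unfolding Lp_norm_powr[symmetric] using p powr_mono2[of p "Lp_norm p M f" c] powr_less_mono2[of p c "Lp_norm p M f"]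
  by (auto simp: not_le[symmetric])

lemma Lp_cmult [simp]: "f \<in> Lp p M \<Longrightarrow> (\<lambda>x. c * f x) \<in> Lp p M"
  by (auto simp: Lp_def norm_mult powr_mult)

lemma Lp_norm_cmult [simp]: "Lp_norm p M (\<lambda>x. c * f x) = cmod c * Lp_norm p M f"
  unfolding Lp_norm_def using p by (simp add: norm_mult powr_mult powr_powr)

text \<open>Minkowski's inequality from convexity of t^p: f + g is A + B times the convex
  combination of f/A and g/B with weights A/(A+B) and B/(A+B). Positive upper bounds replace the
  norms so that no divisor can vanish.\<close>

lemma Lp_norm_add_aux:
  assumes f: "f \<in> Lp p M" and g: "g \<in> Lp p M" and A: "0 < A" "Lp_norm p M f \<le> A"
    and B: "0 < B" "Lp_norm p M g \<le> B"
  shows "(\<lambda>x. f x + g x) \<in> Lp p M" "Lp_norm p M (\<lambda>x. f x + g x) \<le> A + B"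
proof -
  let ?u = "A / (A + B)" and ?v = "B / (A + B)"
  define b where "b x = (A + B) powr p * (?u * (cmod (f x) powr p / A powr p) +
    ?v * (cmod (g x) powr p / B powr p))" for x
  have pw: "cmod (f x + g x) powr p \<le> b x" for x
  proof -
    have "cmod (f x + g x) \<le> cmod (f x) + cmod (g x)" by (rule norm_triangle_ineq)
    also have "\<dots> = (A + B) * (?u * (cmod (f x) / A) + ?v * (cmod (g x) / B))"
    proof -
      have "A + B \<noteq> 0" "A \<noteq> 0" "B \<noteq> 0" using A B by auto
      then show ?thesis by (simp add: distrib_left)
    qed
    finally have "cmod (f x + g x) powr p \<le>
        ((A + B) * (?u * (cmod (f x) / A) + ?v * (cmod (g x) / B))) powr p"
      using p by (intro powr_mono2) auto
    also have "\<dots> = (A + B) powr p * (?u * (cmod (f x) / A) + ?v * (cmod (g x) / B)) powr p"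
      by (rule powr_mult)
    also have "\<dots> \<le> (A + B) powr p * (?u * (cmod (f x) / A) powr p + ?v * (cmod (g x) / B) powr p)"
      using A B p by (intro mult_left_mono powr_convex_combination)
        (auto simp: add_divide_distrib[symmetric])
    also have "\<dots> = b x" using A B by (simp add: b_def powr_divide)
    finally show ?thesis .
  qed
  have ib: "integrable M b"
    unfolding b_def using Lp_integrable[OF f] Lp_integrable[OF g]
    by (intro integrable_mult_right integrable_add) auto
  have m: "(\<lambda>x. f x + g x) \<in> borel_measurable M" using f g by (auto dest: Lp_measurable)
  have i: "integrable M (\<lambda>x. cmod (f x + g x) powr p)"
    by (rule Bochner_Integration.integrable_bound[OF ib]) (use m pw in \<open>auto intro!: AE_I2 order_trans[OF pw]\<close>)
  then show "(\<lambda>x. f x + g x) \<in> Lp p M" using m by (simp add: Lp_def)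
  have "(\<integral>x. cmod (f x + g x) powr p \<partial>M) \<le> (\<integral>x. b x \<partial>M)"
    by (rule integral_mono[OF i ib pw])
  also have "\<dots> = (A + B) powr p * (?u * ((\<integral>x. cmod (f x) powr p \<partial>M) / A powr p) +
    ?v * ((\<integral>x. cmod (g x) powr p \<partial>M) / B powr p))"
    unfolding b_def using Lp_integrable[OF f] Lp_integrable[OF g] by simp
  also have "\<dots> \<le> (A + B) powr p * (?u * 1 + ?v * 1)"
    using A B by (intro mult_left_mono add_mono) (auto simp: Lp_norm_le_iff[symmetric])
  also have "\<dots> = (A + B) powr p" using A B by (simp add: add_divide_distrib[symmetric])
  finally show "Lp_norm p M (\<lambda>x. f x + g x) \<le> A + B"
    using A B by (subst Lp_norm_le_iff) auto
qed

lemma Lp_add [simp]: "f \<in> Lp p M \<Longrightarrow> g \<in> Lp p M \<Longrightarrow> (\<lambda>x. f x + g x) \<in> Lp p M"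
  by (rule Lp_norm_add_aux(1)[of _ _ _ "Lp_norm p M f + 1" "Lp_norm p M g + 1"])
     (auto intro: add_nonneg_pos)

lemma Lp_norm_triangle:
  assumes "f \<in> Lp p M" "g \<in> Lp p M"
  shows "Lp_norm p M (\<lambda>x. f x + g x) \<le> Lp_norm p M f + Lp_norm p M g"
proof (rule field_le_epsilon)
  fix e :: real assume "0 < e"
  then show "Lp_norm p M (\<lambda>x. f x + g x) \<le> Lp_norm p M f + Lp_norm p M g + e"
    using Lp_norm_add_aux(2)[OF assms, of "Lp_norm p M f + e / 2" "Lp_norm p M g + e / 2"]
    by (auto simp: add_nonneg_pos)
qed

lemma Lp_diff [simp]: "f \<in> Lp p M \<Longrightarrow> g \<in> Lp p M \<Longrightarrow> (\<lambda>x. f x - g x) \<in> Lp p M"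
  using Lp_add[of f M "\<lambda>x. - g x"] by simp

lemma Lp_norm_diff_triangle:
  assumes "f \<in> Lp p M" "g \<in> Lp p M" "h \<in> Lp p M"
  shows "Lp_norm p M (\<lambda>x. f x - h x) \<le> Lp_norm p M (\<lambda>x. f x - g x) + Lp_norm p M (\<lambda>x. g x - h x)"
  using Lp_norm_triangle[of "\<lambda>x. f x - g x" M "\<lambda>x. g x - h x"] assms by simp

lemma Lp_norm_le_diff:
  assumes "f \<in> Lp p M" "g \<in> Lp p M"
  shows "Lp_norm p M f \<le> Lp_norm p M (\<lambda>x. f x - g x) + Lp_norm p M g"
  using Lp_norm_triangle[of "\<lambda>x. f x - g x" M g] assms by simp

lemma Lp_sum [simp]: "finite I \<Longrightarrow> (\<And>i. i \<in> I \<Longrightarrow> f i \<in> Lp p M) \<Longrightarrow> (\<lambda>x. \<Sum>i\<in>I. f i x) \<in> Lp p M"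
  by (induction I rule: finite_induct) (use p in auto)

lemma Lp_norm_eq_0_AE:
  assumes "f \<in> Lp p M" "Lp_norm p M f = 0"
  shows "AE x in M. f x = 0"
proof -
  have "(\<integral>x. cmod (f x) powr p \<partial>M) = 0" using assms(2) p Lp_norm_powr[of M f] by simp
  then have "AE x in M. cmod (f x) powr p = 0"
    using integral_nonneg_eq_0_iff_AE[OF Lp_integrable[OF assms(1)]] by simp
  then show ?thesis by eventually_elim auto
qed

text \<open>\<open>weighted_Young\<close> for |f|/A and |s|/B, integrated; the weights 1/p and 1 -
  1/p add up to 1. As for Minkowski's inequality, positive upper bounds stand in for the
  norms.\<close>

lemma Hoelder_aux:
  assumes f: "f \<in> Lp p M" and s: "s \<in> Lp p M" and A: "0 < A" "Lp_norm p M f \<le> A"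
    and B: "0 < B" "Lp_norm p M s \<le> B"
  shows "integrable M (\<lambda>x. cmod (f x) * cmod (s x) powr (p - 1))"
    and "(\<integral>x. cmod (f x) * cmod (s x) powr (p - 1) \<partial>M) \<le> A * B powr (p - 1)"
proof -
  let ?h = "\<lambda>x. cmod (f x) * cmod (s x) powr (p - 1)" and ?C = "A * B powr (p - 1)"
  define b where "b x = ?C *
    ((cmod (f x) powr p / A powr p) / p + (1 - 1 / p) * (cmod (s x) powr p / B powr p))" for x
  have pw: "?h x \<le> b x" for x
  proof -
    have "?h x =
        ?C * ((cmod (f x) / A) * (cmod (s x) / B) powr (p - 1))"
      using A B by (simp add: powr_divide)
    also have "\<dots> \<le> ?C *
        ((cmod (f x) / A) powr p / p + (1 - 1 / p) * (cmod (s x) / B) powr p)"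
      using A B p by (intro mult_left_mono weighted_Young) auto
    finally show ?thesis using A B by (simp add: b_def powr_divide)
  qed
  have ib: "integrable M b"
    unfolding b_def using Lp_integrable[OF f] Lp_integrable[OF s]
    by (intro integrable_mult_right integrable_add) auto
  have m: "(\<lambda>x. ?h x) \<in> borel_measurable M"
    using f s by (auto dest: Lp_measurable)
  show i: "integrable M (\<lambda>x. ?h x)"
    by (rule Bochner_Integration.integrable_bound[OF ib]) (use m pw in \<open>auto intro!: AE_I2 order_trans[OF pw]\<close>)
  have "(\<integral>x. ?h x \<partial>M) \<le> (\<integral>x. b x \<partial>M)"
    by (rule integral_mono[OF i ib pw])
  also have "\<dots> = ?C * (((\<integral>x. cmod (f x) powr p \<partial>M) / A powr p) / p +
    (1 - 1 / p) * ((\<integral>x. cmod (s x) powr p \<partial>M) / B powr p))"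
    unfolding b_def using Lp_integrable[OF f] Lp_integrable[OF s] by simp
  also have "\<dots> \<le> ?C * (1 / p + (1 - 1 / p) * 1)"
    using A B p by (intro mult_left_mono add_mono divide_right_mono) (auto simp: Lp_norm_le_iff[symmetric])
  finally show "(\<integral>x. ?h x \<partial>M) \<le> ?C" by simp
qed

text \<open>Hoelder's inequality with $|s|^{p-1}$ in place of an element of $L^q$, so that \<open>p = 1\<close> is not an
  exception.\<close>

lemma Hoelder_integrable:
  assumes "f \<in> Lp p M" "s \<in> Lp p M"
  shows "integrable M (\<lambda>x. cmod (f x) * cmod (s x) powr (p - 1))"
  by (rule Hoelder_aux(1)[OF assms, of "Lp_norm p M f + 1" "Lp_norm p M s + 1"])
     (auto intro: add_nonneg_pos)

lemma Hoelder:
  assumes f: "f \<in> Lp p M" and s: "s \<in> Lp p M"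
  shows "(\<integral>x. cmod (f x) * cmod (s x) powr (p - 1) \<partial>M) \<le> Lp_norm p M f * Lp_norm p M s powr (p - 1)"
proof (cases "Lp_norm p M s = 0")
  case True
  \<comment> \<open>Here the weight |s|^(p-1) vanishes almost everywhere, also for p = 1, because
    \<open>0 powr 0 = 0\<close>.\<close>
  have "(\<integral>x. cmod (f x) * cmod (s x) powr (p - 1) \<partial>M) = (\<integral>x. 0 \<partial>M)"
    by (rule integral_cong_AE)
       (use f s Lp_norm_eq_0_AE[OF s True] in \<open>auto dest: Lp_measurable\<close>)
  then show ?thesis by simp
next
  case False
  then have B: "0 < Lp_norm p M s" using Lp_norm_nonneg[of p M s] by linarith
  show ?thesis
  proof (rule field_le_epsilon)
    fix e :: real assume e: "0 < e"
    \<comment> \<open>The norm of \<open>s\<close> is positive, so only the bound for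
      \<open>f\<close> gets some slack; \<open>e / c\<close> becomes \<open>e\<close> after
      multiplication by \<open>c\<close>.\<close>
    define c where "c = Lp_norm p M s powr (p - 1)"
    have c: "0 < c" using B by (simp add: c_def)
    have "(\<integral>x. cmod (f x) * cmod (s x) powr (p - 1) \<partial>M) \<le> (Lp_norm p M f + e / c) * c"
      unfolding c_def using c e B
      by (intro Hoelder_aux(2)[OF f s]) (auto intro: add_nonneg_pos simp: c_def)
    also have "\<dots> = Lp_norm p M f * c + e" using c by (simp add: field_simps)
    finally show "(\<integral>x. cmod (f x) * cmod (s x) powr (p - 1) \<partial>M) \<le>
      Lp_norm p M f * Lp_norm p M s powr (p - 1) + e" by (simp add: c_def)
  qed
qed

lemma Lp_indicator:
  assumes "B \<in> sets M" "emeasure M B < \<infinity>"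
  shows "(indicator B :: _ \<Rightarrow> complex) \<in> Lp p M"
proof -
  have "(\<lambda>x. cmod (indicator B x) powr p) = (indicator B :: _ \<Rightarrow> real)"
    by (auto simp: indicator_def)
  with assms show ?thesis by (auto simp: Lp_def)
qed

text \<open>Hoelder with the indicator of B in the role of \<open>s\<close>: (1_B)^(p-1) = 1_B, even
  for p = 1, because \<open>0 powr 0 = 0\<close>.\<close>

lemma Lp_set_integrable:
  assumes f: "f \<in> Lp p M" and B: "B \<in> sets M" "emeasure M B < \<infinity>"
  shows "set_integrable M B f"
    and "cmod (LINT x:B|M. f x) \<le> Lp_norm p M f * Lp_norm p M (indicator B) powr (p - 1)"
proof -
  have eq: "cmod (indicat_real B x *\<^sub>R f x) = cmod (f x) * cmod (indicator B x) powr (p - 1)" for x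
    by (auto simp: indicator_def)
  show i: "set_integrable M B f"
    unfolding set_integrable_def
    by (rule integrable_norm_cancel, unfold eq, rule Hoelder_integrable[OF f Lp_indicator[OF B]])
       (use f B in \<open>auto dest: Lp_measurable\<close>)
  have "cmod (LINT x:B|M. f x) \<le> (\<integral>x. cmod (indicat_real B x *\<^sub>R f x) \<partial>M)"
    unfolding set_lebesgue_integral_def by (rule integral_norm_bound)
  also have "\<dots> \<le> Lp_norm p M f * Lp_norm p M (indicator B) powr (p - 1)"
    unfolding eq by (rule Hoelder[OF f Lp_indicator[OF B]])
  finally show "cmod (LINT x:B|M. f x) \<le> Lp_norm p M f * Lp_norm p M (indicator B) powr (p - 1)" .
qed

lemma Lp_simple_approx:
  assumes f: "f \<in> Lp p M" and e: "0 < e"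
  obtains s where "simple_bochner_integrable M s" "s \<in> Lp p M" "Lp_norm p M (\<lambda>x. f x - s x) < e"
proof -
  from borel_measurable_implies_sequence_metric[OF Lp_measurable[OF f], of 0]
  obtain s where s: "\<And>i. simple_function M (s i)" "\<And>x. x \<in> space M \<Longrightarrow> (\<lambda>i. s i x) \<longlonglongrightarrow> f x"
    "\<And>i x. x \<in> space M \<Longrightarrow> cmod (s i x) \<le> 2 * cmod (f x)"
    unfolding dist_norm diff_zero by blast
  have sm: "s i \<in> borel_measurable M" for i using s(1) borel_measurable_simple_function by blast
  have sL: "s i \<in> Lp p M" for i
    by (rule Lp_dominated(1)[OF Lp_cmult[OF f, of 2]])
       (use sm s(3) p in \<open>auto simp: norm_mult intro!: AE_I2\<close>)
  have "(\<lambda>i. \<integral>x. cmod (f x - s i x) powr p \<partial>M) \<longlonglongrightarrow> (\<integral>x. 0 \<partial>M)"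
  proof (rule integral_dominated_convergence)
    \<comment> \<open>The approximants satisfy |s_i| \<le> 2|f|, hence |f - s_i| \<le> 3|f|.\<close>
    show "integrable M (\<lambda>x. cmod (3 * f x) powr p)" using Lp_integrable[OF Lp_cmult[OF f]] .
    show "AE x in M. (\<lambda>i. cmod (f x - s i x) powr p) \<longlonglongrightarrow> 0"
    proof (rule AE_I2)
      fix x assume "x \<in> space M"
      then have "(\<lambda>i. cmod (f x - s i x)) \<longlonglongrightarrow> cmod (f x - f x)"
        using s(2) by (intro tendsto_intros)
      then have "(\<lambda>i. cmod (f x - s i x) powr p) \<longlonglongrightarrow> 0 powr p"
        using p by (intro tendsto_powr2) auto
      then show "(\<lambda>i. cmod (f x - s i x) powr p) \<longlonglongrightarrow> 0" by simp
    qed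
    show "AE x in M. norm (cmod (f x - s i x) powr p) \<le> cmod (3 * f x) powr p" for i
    proof (rule AE_I2)
      fix x assume "x \<in> space M"
      from s(3)[OF this, of i] have "cmod (f x - s i x) \<le> cmod (3 * f x)"
        using norm_triangle_ineq4[of "f x" "s i x"] by (simp add: norm_mult)
      then show "norm (cmod (f x - s i x) powr p) \<le> cmod (3 * f x) powr p"
        using p by (auto intro: powr_mono2)
    qed
  qed (use sm f in \<open>auto dest: Lp_measurable\<close>)
  then have "(\<lambda>i. (\<integral>x. cmod (f x - s i x) powr p \<partial>M) powr (1 / p)) \<longlonglongrightarrow> 0 powr (1 / p)"
    using p by (intro tendsto_powr2) auto
  then have "(\<lambda>i. Lp_norm p M (\<lambda>x. f x - s i x)) \<longlonglongrightarrow> 0" by (simp add: Lp_norm_def)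
  from order_tendstoD(2)[OF this e] obtain i where i: "Lp_norm p M (\<lambda>x. f x - s i x) < e"
    by (auto simp: eventually_sequentially)
  \<comment> \<open>A p-integrable simple function has support of finite measure, as
    \<open>simple_bochner_integrable\<close> demands.\<close>
  have "emeasure M {x \<in> space M. ennreal (cmod (s i x) powr p) \<noteq> 0} \<noteq> \<infinity>"
  proof (rule simple_function_finite_support)
    show "simple_function M (\<lambda>x. ennreal (cmod (s i x) powr p))"
      by (rule simple_function_compose1[OF s(1)])
    show "(\<integral>\<^sup>+ x. ennreal (cmod (s i x) powr p) \<partial>M) < \<infinity>"
      using Lp_integrable[OF sL[of i]] by (auto simp: integrable_iff_bounded)
  qed auto
  then have "simple_bochner_integrable M (s i)"
    using s(1) p by (auto simp: simple_bochner_integrable.simps)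
  then show thesis using that sL i by blast
qed

text \<open>The norming function of an L^p-element: z * dual_value z = |z|^p while |dual_value z| =
  |z|^(p-1). It plays the part of an element of L^q and stays meaningful for p = 1.\<close>

definition dual_value :: "complex \<Rightarrow> complex" where
  "dual_value z = cnj (sgn z) * of_real (cmod z powr (p - 1))"

lemma norm_dual_value: "cmod (dual_value z) = cmod z powr (p - 1)"
  by (auto simp: dual_value_def norm_mult norm_sgn)

lemma mult_dual_value: "z * dual_value z = of_real (cmod z powr p)"
proof (cases "z = 0")
  case False
  have "z * dual_value z = (z * cnj z / of_real (cmod z)) * of_real (cmod z powr (p - 1))"
    by (simp add: dual_value_def sgn_div_norm scaleR_conv_of_real field_simps)
  also have "z * cnj z = of_real (cmod z) * of_real (cmod z)"
    by (simp add: complex_norm_square[symmetric] power2_eq_square[symmetric])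
  finally have "z * dual_value z = of_real (cmod z * cmod z powr (p - 1))"
    using False by simp
  also have "cmod z * cmod z powr (p - 1) = cmod z powr p"
    using False by (simp add: powr_mult_base)
  finally show ?thesis .
qed auto

lemma dual_pairing:
  assumes s: "simple_bochner_integrable M s" "s \<in> Lp p M" and h: "h \<in> Lp p M"
  shows "integrable M (\<lambda>x. h x * dual_value (s x))"
    and "cmod (\<integral>x. h x * dual_value (s x) \<partial>M) \<le> Lp_norm p M h * Lp_norm p M s powr (p - 1)"
proof -
  have "simple_function M s" using s(1) by (rule simple_bochner_integrable.cases)
  then have sm: "(\<lambda>x. dual_value (s x)) \<in> borel_measurable M"
    by (auto intro!: borel_measurable_simple_function simple_function_compose1[where g = dual_value])
  have eq: "cmod (h x * dual_value (s x)) = cmod (h x) * cmod (s x) powr (p - 1)" for x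
    by (simp add: norm_mult norm_dual_value)
  show "integrable M (\<lambda>x. h x * dual_value (s x))"
    by (rule integrable_norm_cancel, unfold eq, rule Hoelder_integrable[OF h s(2)])
       (use h sm in \<open>auto dest: Lp_measurable\<close>)
  have "cmod (\<integral>x. h x * dual_value (s x) \<partial>M) \<le> (\<integral>x. cmod (h x * dual_value (s x)) \<partial>M)"
    by (rule integral_norm_bound)
  also have "\<dots> \<le> Lp_norm p M h * Lp_norm p M s powr (p - 1)"
    unfolding eq by (rule Hoelder[OF h s(2)])
  finally show "cmod (\<integral>x. h x * dual_value (s x) \<partial>M) \<le> Lp_norm p M h * Lp_norm p M s powr (p - 1)" .
qed

text \<open>Weak integrals are known only through their integrals over sets of finite measure; this
  expresses a pairing by those.\<close>

lemma dual_pairing_eq_sum: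
  assumes s: "simple_bochner_integrable M s"
  obtains Y B where "finite Y" "\<And>y. y \<in> Y \<Longrightarrow> B y \<in> sets M \<and> emeasure M (B y) < \<infinity>"
    "\<And>h. h \<in> Lp p M \<Longrightarrow> (\<integral>x. h x * dual_value (s x) \<partial>M) = (\<Sum>y\<in>Y. dual_value y * (LINT x:B y|M. h x))"
proof -
  have sf: "simple_function M s" and fin: "emeasure M {x \<in> space M. s x \<noteq> 0} \<noteq> \<infinity>"
    using s by (auto elim: simple_bochner_integrable.cases)
  \<comment> \<open>The value 0 is left out: its level set may have infinite measure, and
    \<open>dual_value\<close> vanishes there.\<close>
  define Y where "Y = s ` space M - {0}"
  define B where "B y = s -` {y} \<inter> space M" for y
  have Y: "finite Y" using sf by (simp add: Y_def simple_function_def)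
  have B: "B y \<in> sets M \<and> emeasure M (B y) < \<infinity>" if "y \<in> Y" for y
  proof -
    have "B y \<in> sets M" using sf that by (auto simp: B_def Y_def simple_function_def)
    moreover have "emeasure M (B y) \<le> emeasure M {x \<in> space M. s x \<noteq> 0}"
      using that borel_measurable_simple_function[OF sf] by (intro emeasure_mono) (auto simp: B_def Y_def)
    ultimately show ?thesis using fin by (auto simp: top.not_eq_extremum intro: le_less_trans)
  qed
  show thesis
  proof (rule that[OF Y B])
    fix h assume h: "h \<in> Lp p M"
    have "h x * dual_value (s x) = (\<Sum>y\<in>Y. dual_value y * (indicator (B y) x *\<^sub>R h x))" if "x \<in> space M" for x
    proof -
      have "(\<Sum>y\<in>Y. dual_value y * (indicator (B y) x *\<^sub>R h x)) =
          (\<Sum>y\<in>Y. if y = s x then dual_value y * h x else 0)"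
        using that by (intro sum.cong) (auto simp: B_def)
      also have "\<dots> = (if s x \<in> Y then dual_value (s x) * h x else 0)"
        using Y by (simp add: sum.delta)
      also have "\<dots> = h x * dual_value (s x)" using that by (auto simp: Y_def dual_value_def)
      finally show ?thesis by simp
    qed
    then have "(\<integral>x. h x * dual_value (s x) \<partial>M) =
        (\<integral>x. (\<Sum>y\<in>Y. dual_value y * (indicator (B y) x *\<^sub>R h x)) \<partial>M)"
      by (intro Bochner_Integration.integral_cong) auto
    also have "\<dots> = (\<Sum>y\<in>Y. \<integral>x. dual_value y * (indicator (B y) x *\<^sub>R h x) \<partial>M)"
      using Lp_set_integrable(1)[OF h] B
      by (intro Bochner_Integration.integral_sum integrable_mult_right) (auto simp: set_integrable_def)
    finally show "(\<integral>x. h x * dual_value (s x) \<partial>M) = (\<Sum>y\<in>Y. dual_value y * (LINT x:B y|M. h x))"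
      by (simp only: set_lebesgue_integral_def integral_mult_right_zero)
  qed auto
qed

text \<open>The test function is a simple s close to f itself. Pairing s with its own dual function
  gives ||s||^p; replacing s by f changes this by at most ||f - s|| ||s||^(p-1); dividing by
  ||s||^(p-1) bounds ||s|| by C plus a small error. This covers p = 1 and measures that are not
  sigma-finite.\<close>

lemma Lp_norm_le_by_duality:
  assumes f: "f \<in> Lp p M" and C: "0 \<le> C"
    and le: "\<And>s. simple_bochner_integrable M s \<Longrightarrow> s \<in> Lp p M \<Longrightarrow>
      cmod (\<integral>x. f x * dual_value (s x) \<partial>M) \<le> C * Lp_norm p M s powr (p - 1)"
  shows "Lp_norm p M f \<le> C"
proof (rule field_le_epsilon)
  fix e :: real assume e: "0 < e"
  then obtain s where s: "simple_bochner_integrable M s" "s \<in> Lp p M"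
    "Lp_norm p M (\<lambda>x. f x - s x) < e / 2"
    using Lp_simple_approx[OF f, of "e / 2"] by auto
  note i = dual_pairing[OF s(1,2)]
  have "Lp_norm p M s \<le> e / 2 + C"
  proof (cases "Lp_norm p M s = 0")
    case False
    then have pos: "0 < Lp_norm p M s" using Lp_norm_nonneg[of p M s] by linarith
    define c where "c = Lp_norm p M s powr (p - 1)"
    have c: "0 < c" using pos by (simp add: c_def)
    have "Lp_norm p M s * c = Lp_norm p M s powr p"
      using pos by (simp add: c_def powr_mult_base)
    also have "\<dots> = (\<integral>x. cmod (s x) powr p \<partial>M)" by (rule Lp_norm_powr)
    also have "\<dots> = cmod (\<integral>x. s x * dual_value (s x) \<partial>M)"
      unfolding mult_dual_value integral_complex_of_real by simp
    also have "(\<integral>x. s x * dual_value (s x) \<partial>M) =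
        (\<integral>x. f x * dual_value (s x) \<partial>M) - (\<integral>x. (f x - s x) * dual_value (s x) \<partial>M)"
      using i(1)[OF f] i(1)[OF Lp_diff[OF f s(2)]]
      by (subst Bochner_Integration.integral_diff[symmetric]) (auto simp: algebra_simps)
    also have "cmod \<dots> \<le> C * c + Lp_norm p M (\<lambda>x. f x - s x) * c"
      unfolding c_def
      by (rule order_trans[OF norm_triangle_ineq4])
         (intro add_mono le[OF s(1,2)] i(2)[OF Lp_diff[OF f s(2)]])
    finally have "Lp_norm p M s * c \<le> (C + Lp_norm p M (\<lambda>x. f x - s x)) * c"
      by (simp add: algebra_simps)
    then have "Lp_norm p M s \<le> C + Lp_norm p M (\<lambda>x. f x - s x)" using c by simp
    then show ?thesis using s(3) by simp
  qed (use C e in simp)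
  then show "Lp_norm p M f \<le> C + e" using Lp_norm_le_diff[OF f s(2)] s(3) by simp
qed

end

section \<open>Norm of the integrated form\<close>

lemma ae_eq_norm:
  assumes "ae_eq M f g" "f \<in> Lp p M" "g \<in> Lp p M"
  shows "Lp_norm p M f = Lp_norm p M g"
  using assms by (intro Lp_norm_cong) (auto simp: ae_eq_def dest: Lp_measurable)

lemma bounded_operator_Lp: "bounded_operator p M T \<Longrightarrow> f \<in> Lp p M \<Longrightarrow> T f \<in> Lp p M"
  by (simp add: bounded_operator_def)

lemma bounded_operator_add:
  "bounded_operator p M T \<Longrightarrow> f \<in> Lp p M \<Longrightarrow> g \<in> Lp p M \<Longrightarrow>
    ae_eq M (T (\<lambda>x. f x + g x)) (\<lambda>x. T f x + T g x)"
  by (simp add: bounded_operator_def)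

text \<open>\<open>operator_norm\<close> is a \<open>Sup\<close> of reals and bounds nothing until
  its set is known to be bounded. The constant from \<open>bounded_operator\<close> provides that,
  and it settles vectors of norm 0, which cannot be normalised.\<close>

lemma operator_norm_bound:
  assumes p: "1 \<le> p" and T: "bounded_operator p M T" and f: "f \<in> Lp p M"
  shows "Lp_norm p M (T f) \<le> operator_norm p M T * Lp_norm p M f"
proof -
  obtain C where C: "\<And>f. f \<in> Lp p M \<Longrightarrow> Lp_norm p M (T f) \<le> C * Lp_norm p M f"
    using T unfolding bounded_operator_def by blast
  show ?thesis
  proof (cases "Lp_norm p M f = 0")
    case True
    then show ?thesis using C[OF f] by simp
  next
    case False
    then have n: "0 < Lp_norm p M f" using Lp_norm_nonneg[of p M f] by linarith
    define c :: complex where "c = of_real (1 / Lp_norm p M f)"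
    have c: "cmod c = 1 / Lp_norm p M f" using n by (simp add: c_def norm_divide)
    have cf: "(\<lambda>x. c * f x) \<in> Lp p M" "Lp_norm p M (\<lambda>x. c * f x) = 1"
      using Lp_cmult[OF p f, of c] Lp_norm_cmult[OF p, of M c f] n by (simp_all add: c)
    have "bdd_above {Lp_norm p M (T f) |f. f \<in> Lp p M \<and> Lp_norm p M f \<le> 1}"
    proof (rule bdd_aboveI)
      fix r assume "r \<in> {Lp_norm p M (T f) |f. f \<in> Lp p M \<and> Lp_norm p M f \<le> 1}"
      then obtain g where g: "r = Lp_norm p M (T g)" "g \<in> Lp p M" "Lp_norm p M g \<le> 1" by auto
      have "r \<le> C * Lp_norm p M g" using C g by simp
      also have "\<dots> \<le> \<bar>C\<bar> * 1" using g(3) by (intro mult_mono) auto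
      finally show "r \<le> \<bar>C\<bar>" by simp
    qed
    then have "Lp_norm p M (T (\<lambda>x. c * f x)) \<le> operator_norm p M T"
      unfolding operator_norm_def using cf by (intro cSup_upper) auto
    moreover have "Lp_norm p M (T (\<lambda>x. c * f x)) = Lp_norm p M (\<lambda>x. c * T f x)"
      using T f p cf by (intro ae_eq_norm) (auto simp: bounded_operator_def)
    ultimately have "Lp_norm p M (T f) / Lp_norm p M f \<le> operator_norm p M T"
      using p n by (simp add: c)
    then show ?thesis using n by (simp add: field_simps)
  qed
qed

lemma bounded_operator_diff:
  assumes p: "1 \<le> p" and T: "bounded_operator p M T" and f: "f \<in> Lp p M" and g: "g \<in> Lp p M"
  shows "Lp_norm p M (\<lambda>x. T f x - T g x) = Lp_norm p M (T (\<lambda>x. f x - g x))"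
proof (rule ae_eq_norm)
  have "ae_eq M (T (\<lambda>x. (f x - g x) + g x)) (\<lambda>x. T (\<lambda>x. f x - g x) x + T g x)"
    by (rule bounded_operator_add[OF T Lp_diff[OF p f g] g])
  then show "ae_eq M (\<lambda>x. T f x - T g x) (T (\<lambda>x. f x - g x))"
    unfolding ae_eq_def by eventually_elim simp
qed (simp_all add: p f g Lp_diff bounded_operator_Lp[OF T])

lemma contractive_rep_bounded: "contractive_rep p M \<pi> \<Longrightarrow> bounded_operator p M (\<pi> a)"
  by (simp add: contractive_rep_def algebra_rep_def)

lemma contractive_rep_bound:
  assumes p: "1 \<le> p" and \<pi>: "contractive_rep p M \<pi>" and f: "f \<in> Lp p M"
  shows "Lp_norm p M (\<pi> a f) \<le> norm a * Lp_norm p M f"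
proof -
  have "Lp_norm p M (\<pi> a f) \<le> operator_norm p M (\<pi> a) * Lp_norm p M f"
    by (rule operator_norm_bound[OF p contractive_rep_bounded[OF \<pi>] f])
  also have "\<dots> \<le> norm a * Lp_norm p M f"
    using \<pi> by (intro mult_right_mono) (auto simp: contractive_rep_def)
  finally show ?thesis .
qed

lemma contractive_rep_diff:
  assumes p: "1 \<le> p" and \<pi>: "contractive_rep p M \<pi>" and f: "f \<in> Lp p M"
  shows "Lp_norm p M (\<lambda>x. \<pi> a f x - \<pi> b f x) \<le> norm (a - b) * Lp_norm p M f"
proof -
  have "ae_eq M (\<pi> ((a - b) + b) f) (\<lambda>x. \<pi> (a - b) f x + \<pi> b f x)"
    using \<pi> f unfolding contractive_rep_def algebra_rep_def by blast
  then have "ae_eq M (\<lambda>x. \<pi> a f x - \<pi> b f x) (\<pi> (a - b) f)"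
    unfolding ae_eq_def by eventually_elim simp
  then have "Lp_norm p M (\<lambda>x. \<pi> a f x - \<pi> b f x) = Lp_norm p M (\<pi> (a - b) f)"
    using p f bounded_operator_Lp[OF contractive_rep_bounded[OF \<pi>]] by (intro ae_eq_norm) auto
  then show ?thesis using contractive_rep_bound[OF p \<pi> f] by simp
qed

section \<open>Continuous functions with compact support and their weak integrals\<close>

abbreviation (input) Cc :: "('g::topological_space \<Rightarrow> 'a::real_normed_vector) set" where
  "Cc \<equiv> compactly_supported"

lemma compactly_supportedE:
  assumes "a \<in> Cc"
  obtains K where "continuous_on UNIV a" "compact K" "\<And>g. g \<notin> K \<Longrightarrow> a g = 0"
  using assms unfolding compactly_supported_def by blast

lemma continuous_bounded_on_compact:
  fixes f :: "'g::topological_space \<Rightarrow> 'b::real_normed_vector"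
  assumes "continuous_on UNIV f" "compact K"
  obtains B where "0 \<le> B" "\<And>g. g \<in> K \<Longrightarrow> norm (f g) \<le> B"
proof -
  have "compact (f ` K)" using assms compact_continuous_image continuous_on_subset by blast
  then obtain B where "\<forall>y\<in>f ` K. norm y \<le> B" using compact_imp_bounded bounded_iff by blast
  then show thesis using that[of "max 0 B"] by fastforce
qed

lemma compact_in_sets:
  fixes K :: "'g::t2_space set"
  assumes "sets \<mu> = sets borel" "compact K" shows "K \<in> sets \<mu>"
  using assms by (simp add: borel_closed compact_imp_closed)

lemma continuous_measurable_on:
  assumes "sets \<mu> = sets borel" "continuous_on UNIV f"
  shows "f \<in> borel_measurable \<mu>"
  using borel_measurable_continuous_onI[OF assms(2)] measurable_cong_sets[OF assms(1) refl] by blast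

lemma integrable_compact_support:
  fixes f :: "'g::t2_space \<Rightarrow> 'b::{banach, second_countable_topology}"
  assumes \<mu>: "sets \<mu> = sets borel" "emeasure \<mu> K < \<infinity>" "compact K"
    and f: "continuous_on UNIV f" "\<And>g. g \<notin> K \<Longrightarrow> f g = 0"
  shows "integrable \<mu> f"
proof -
  obtain B where B: "0 \<le> B" "\<And>g. g \<in> K \<Longrightarrow> norm (f g) \<le> B"
    using continuous_bounded_on_compact[OF f(1) \<mu>(3)] by metis
  show ?thesis
  proof (rule Bochner_Integration.integrable_bound)
    show "integrable \<mu> (\<lambda>g. B * indicator K g)"
      using \<mu> compact_in_sets[OF \<mu>(1,3)] by (intro integrable_mult_right) auto
    show "AE g in \<mu>. norm (f g) \<le> norm (B * indicator K g)"
      using B f(2) by (auto simp: indicator_def)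
  qed (rule continuous_measurable_on[OF \<mu>(1) f(1)])
qed

lemma tendsto_set_integral_Lp:
  assumes p: "1 \<le> p" and B: "B \<in> sets M" "emeasure M B < \<infinity>"
    and F: "\<And>h. F h \<in> Lp p M" "((\<lambda>h. Lp_norm p M (\<lambda>x. F h x - F g x)) \<longlongrightarrow> 0) (at g)"
  shows "((\<lambda>h. LINT x:B|M. F h x) \<longlongrightarrow> (LINT x:B|M. F g x)) (at g)"
proof -
  define C where "C = Lp_norm p M (indicator B) powr (p - 1)"
  have "norm ((LINT x:B|M. F h x) - (LINT x:B|M. F g x)) \<le> Lp_norm p M (\<lambda>x. F h x - F g x) * C" for h
    using Lp_set_integrable(2)[OF p Lp_diff[OF p F(1)[of h] F(1)[of g]] B] Lp_set_integrable(1)[OF p F(1) B]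
    by (simp add: C_def set_integral_diff(2))
  then have "((\<lambda>h. (LINT x:B|M. F h x) - (LINT x:B|M. F g x)) \<longlongrightarrow> 0) (at g)"
    by (intro Lim_null_comparison[OF always_eventually tendsto_mult_left_zero[OF F(2)]]) auto
  then show ?thesis by (simp add: LIM_zero_iff)
qed

lemma covariant_Lp:
  assumes "covariant_rep p \<alpha> M \<pi> v" "\<xi> \<in> Lp p M"
  shows "v g \<xi> \<in> Lp p M" "\<pi> a \<xi> \<in> Lp p M" "Lp_norm p M (v g \<xi>) = Lp_norm p M \<xi>"
  using assms unfolding covariant_rep_def isometric_group_rep_def contractive_rep_def algebra_rep_def
  by (auto simp: bounded_operator_def)

text \<open>Norm continuity of \<open>a\<close> and strong continuity of \<open>v\<close> combine
  because \<pi> is contractive and \<open>v\<close> isometric: \<open>a\<close> is changed first, at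
  the vector \<open>v h \<xi>\<close> of norm ||\<xi>||, and then the vector.\<close>

lemma integrand_tendsto:
  assumes p: "1 \<le> p" and cov: "covariant_rep p \<alpha> M \<pi> v"
    and a: "continuous_on UNIV a" and \<xi>: "\<xi> \<in> Lp p M"
  shows "((\<lambda>h. Lp_norm p M (\<lambda>x. \<pi> (a h) (v h \<xi>) x - \<pi> (a g) (v g \<xi>) x)) \<longlongrightarrow> 0) (at g)"
proof (rule Lim_null_comparison[OF always_eventually])
  have \<pi>: "contractive_rep p M \<pi>" using cov by (simp add: covariant_rep_def)
  note L = covariant_Lp[OF cov]
  show "\<forall>h. norm (Lp_norm p M (\<lambda>x. \<pi> (a h) (v h \<xi>) x - \<pi> (a g) (v g \<xi>) x)) \<le>
    norm (a h - a g) * Lp_norm p M \<xi> + norm (a g) * Lp_norm p M (\<lambda>x. v h \<xi> x - v g \<xi> x)"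
  proof
    fix h
    have "Lp_norm p M (\<lambda>x. \<pi> (a h) (v h \<xi>) x - \<pi> (a g) (v g \<xi>) x) \<le>
      Lp_norm p M (\<lambda>x. \<pi> (a h) (v h \<xi>) x - \<pi> (a g) (v h \<xi>) x) +
      Lp_norm p M (\<lambda>x. \<pi> (a g) (v h \<xi>) x - \<pi> (a g) (v g \<xi>) x)"
      by (rule Lp_norm_diff_triangle[OF p]) (use L \<xi> in auto)
    also have "\<dots> \<le> norm (a h - a g) * Lp_norm p M \<xi> + norm (a g) * Lp_norm p M (\<lambda>x. v h \<xi> x - v g \<xi> x)"
      using contractive_rep_diff[OF p \<pi> L(1)[OF \<xi>, of h], where a = "a h" and b = "a g"]
        contractive_rep_bound[OF p \<pi> Lp_diff[OF p L(1)[OF \<xi>, of h] L(1)[OF \<xi>, of g]], where a = "a g"]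
        bounded_operator_diff[OF p contractive_rep_bounded[OF \<pi>] L(1)[OF \<xi>, of h] L(1)[OF \<xi>, of g], of "a g"]
      by (simp add: L(3)[OF \<xi>])
    finally show "norm (Lp_norm p M (\<lambda>x. \<pi> (a h) (v h \<xi>) x - \<pi> (a g) (v g \<xi>) x)) \<le>
      norm (a h - a g) * Lp_norm p M \<xi> + norm (a g) * Lp_norm p M (\<lambda>x. v h \<xi> x - v g \<xi> x)" by simp
  qed
  have "((\<lambda>h. Lp_norm p M (\<lambda>x. v h \<xi> x - v g \<xi> x)) \<longlongrightarrow> 0) (at g)"
    using cov \<xi> by (auto simp: covariant_rep_def isometric_group_rep_def)
  moreover have "((\<lambda>h. norm (a h - a g)) \<longlongrightarrow> 0) (at g)"
    using a by (metis LIM_zero UNIV_I continuous_on_def tendsto_norm_zero)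
  ultimately show "((\<lambda>h. norm (a h - a g) * Lp_norm p M \<xi> +
      norm (a g) * Lp_norm p M (\<lambda>x. v h \<xi> x - v g \<xi> x)) \<longlongrightarrow> 0) (at g)"
    by (intro tendsto_add_zero tendsto_mult_left_zero tendsto_mult_right_zero)
qed

text \<open>Minkowski's integral inequality for a weak integral. The pairing of \<zeta> with a dual
  function is a finite combination of scalar integrals over G; taken under the integral sign, the
  combination is again a pairing, and Hoelder bounds it pointwise.\<close>

lemma has_Lp_integral_norm_le:
  fixes \<mu> :: "'g::{topological_group_add, t2_space} measure"
  assumes p: "1 \<le> p" and \<mu>: "left_haar_measure \<mu>" and cov: "covariant_rep p \<alpha> M \<pi> v"
    and a: "a \<in> Cc" and \<xi>: "\<xi> \<in> Lp p M"
    and \<zeta>: "has_Lp_integral p M \<mu> (\<lambda>g. \<pi> (a g) (v g \<xi>)) \<zeta>"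
  shows "Lp_norm p M \<zeta> \<le> (\<integral>g. norm (a g) \<partial>\<mu>) * Lp_norm p M \<xi>"
proof (rule Lp_norm_le_by_duality[OF p])
  define F where "F g = \<pi> (a g) (v g \<xi>)" for g
  obtain K where K: "continuous_on UNIV a" "compact K" "\<And>g. g \<notin> K \<Longrightarrow> a g = 0"
    using compactly_supportedE[OF a] by metis
  have s\<mu>: "sets \<mu> = sets borel" and \<mu>K: "emeasure \<mu> K < \<infinity>"
    using \<mu> K by (auto simp: left_haar_measure_def)
  have \<pi>: "contractive_rep p M \<pi>" using cov by (simp add: covariant_rep_def)
  have FL: "F g \<in> Lp p M" for g unfolding F_def using covariant_Lp[OF cov] \<xi> by blast
  have Fn: "Lp_norm p M (F g) \<le> norm (a g) * Lp_norm p M \<xi>" for g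
    unfolding F_def using contractive_rep_bound[OF p \<pi> covariant_Lp(1)[OF cov \<xi>]]
    by (simp add: covariant_Lp(3)[OF cov \<xi>])
  show \<zeta>L: "\<zeta> \<in> Lp p M" using \<zeta> by (simp add: has_Lp_integral_def)
  show "0 \<le> (\<integral>g. norm (a g) \<partial>\<mu>) * Lp_norm p M \<xi>" by simp
  fix s assume s: "Bochner_Integration.simple_bochner_integrable M s" "s \<in> Lp p M"
  obtain Y B where YB: "finite Y" "\<And>y. y \<in> Y \<Longrightarrow> B y \<in> sets M \<and> emeasure M (B y) < \<infinity>"
    "\<And>h. h \<in> Lp p M \<Longrightarrow> (\<integral>x. h x * dual_value p (s x) \<partial>M) =
      (\<Sum>y\<in>Y. dual_value p y * (LINT x:B y|M. h x))"
    by (rule dual_pairing_eq_sum[OF p s(1)]) (rule that)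
  have Fint: "integrable \<mu> (\<lambda>g. LINT x:B y|M. F g x)" if y: "y \<in> Y" for y
  proof (rule integrable_compact_support[OF s\<mu> \<mu>K K(2)])
    have B: "B y \<in> sets M" "emeasure M (B y) < \<infinity>" using YB(2)[OF y] by auto
    have "((\<lambda>h. LINT x:B y|M. F h x) \<longlongrightarrow> (LINT x:B y|M. F g x)) (at g)" for g
      by (rule tendsto_set_integral_Lp[OF p B FL])
         (use integrand_tendsto[OF p cov K(1) \<xi>] in \<open>simp add: F_def\<close>)
    then show "continuous_on UNIV (\<lambda>g. LINT x:B y|M. F g x)" by (simp add: continuous_on_def)
    fix g assume "g \<notin> K"
    \<comment> \<open>\<open>F g\<close> is zero only up to a null set, so the argument goes through
      its norm.\<close>
    then have "Lp_norm p M (F g) = 0" using K(3)[of g] Fn[of g] by (simp add: order_antisym)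
    then show "(LINT x:B y|M. F g x) = 0" using Lp_set_integrable(2)[OF p FL B, of g] by simp
  qed
  have na: "integrable \<mu> (\<lambda>g. norm (a g))"
    by (rule integrable_compact_support[OF s\<mu> \<mu>K K(2)]) (use K in \<open>auto intro: continuous_intros\<close>)
  have "(\<integral>x. \<zeta> x * dual_value p (s x) \<partial>M) = (\<Sum>y\<in>Y. dual_value p y * (\<integral>g. (LINT x:B y|M. F g x) \<partial>\<mu>))"
    using \<zeta> YB(2) by (auto simp: YB(3)[OF \<zeta>L] has_Lp_integral_def F_def intro!: sum.cong)
  also have "\<dots> = (\<integral>g. (\<Sum>y\<in>Y. dual_value p y * (LINT x:B y|M. F g x)) \<partial>\<mu>)"
    using Fint by (simp add: Bochner_Integration.integral_sum)
  also have "cmod \<dots> \<le> (\<integral>g. norm (a g) * (Lp_norm p M \<xi> * Lp_norm p M s powr (p - 1)) \<partial>\<mu>)"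
  proof (rule order_trans[OF integral_norm_bound], rule integral_mono)
    show "integrable \<mu> (\<lambda>g. cmod (\<Sum>y\<in>Y. dual_value p y * (LINT x:B y|M. F g x)))"
      using Fint by (intro integrable_norm Bochner_Integration.integrable_sum integrable_mult_right)
    show "integrable \<mu> (\<lambda>g. norm (a g) * (Lp_norm p M \<xi> * Lp_norm p M s powr (p - 1)))"
      using na by simp
    fix g
    have "cmod (\<Sum>y\<in>Y. dual_value p y * (LINT x:B y|M. F g x)) \<le> Lp_norm p M (F g) * Lp_norm p M s powr (p - 1)"
      using dual_pairing(2)[OF p s FL] by (simp add: YB(3)[OF FL])
    also have "\<dots> \<le> (norm (a g) * Lp_norm p M \<xi>) * Lp_norm p M s powr (p - 1)"
      using Fn by (intro mult_right_mono) auto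
    finally show "cmod (\<Sum>y\<in>Y. dual_value p y * (LINT x:B y|M. F g x)) \<le>
      norm (a g) * (Lp_norm p M \<xi> * Lp_norm p M s powr (p - 1))" by (simp add: mult.assoc)
  qed
  finally show "cmod (\<integral>x. \<zeta> x * dual_value p (s x) \<partial>M) \<le>
    (\<integral>g. norm (a g) \<partial>\<mu>) * Lp_norm p M \<xi> * Lp_norm p M s powr (p - 1)"
    by (simp add: mult.assoc)
qed

text \<open>Its L^p-space is zero, although every function represents an element. It makes the
  families of covariant and of regular representations nonempty; otherwise the \<open>Sup\<close> in
  \<open>sup_norm\<close> would carry no information.\<close>

definition trivial_measure :: "'x measure" where
  "trivial_measure = null_measure (count_space UNIV)"

lemma Lp_trivial [simp]: "Lp p trivial_measure = UNIV"
  by (auto simp: trivial_measure_def Lp_def integrable_iff_bounded nn_integral_null_measure)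

lemma Lp_norm_trivial [simp]: "Lp_norm p trivial_measure f = 0"
  by (simp add: trivial_measure_def Lp_norm_def integral_null_measure)

lemma ae_eq_trivial [simp]: "ae_eq trivial_measure f g"
  unfolding ae_eq_def trivial_measure_def by (rule AE_I[of _ _ UNIV]) auto

lemma bounded_operator_trivial [simp]: "bounded_operator p trivial_measure T"
  by (auto simp: bounded_operator_def)

section \<open>Comparison of the L^1-norm with the full and the reduced norm\<close>

lemma L1_norm:
  "is_L1_algebra \<mu> \<alpha> \<iota> \<Longrightarrow> a \<in> Cc \<Longrightarrow> norm (\<iota> a) = (\<integral>g. norm (a g) \<partial>\<mu>)"
  by (simp add: is_L1_algebra_def is_completion_def)

context
  fixes p :: real and \<mu> :: "'g::{topological_group_add, t2_space} measure"
    and \<alpha> :: "'g \<Rightarrow> 'a::complex_banach_algebra \<Rightarrow> 'a"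
    and \<iota> :: "('g \<Rightarrow> 'a) \<Rightarrow> 'l::complex_banach_algebra"
  assumes p: "1 \<le> p" and \<mu>: "left_haar_measure \<mu>" and \<iota>: "is_L1_algebra \<mu> \<alpha> \<iota>"
begin

lemma L1_approximable:
  obtains a where "\<And>n::nat. a n \<in> Cc" "(\<lambda>n. \<iota> (a n)) \<longlonglongrightarrow> x"
proof -
  have "x \<in> closure (\<iota> ` Cc)"
    using \<iota> by (simp add: is_L1_algebra_def is_completion_def)
  then obtain b where b: "\<And>n. b n \<in> \<iota> ` Cc" "b \<longlonglongrightarrow> x"
    unfolding closure_sequential by blast
  then have "\<forall>n. \<exists>c. c \<in> Cc \<and> b n = \<iota> c" by blast
  then obtain c where c: "\<forall>n. c n \<in> Cc \<and> b n = \<iota> (c n)" by metis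
  then have "b = (\<lambda>n. \<iota> (c n))" by auto
  then show thesis using b that[of c] c by simp
qed

lemma integrated_form_norm_le:
  assumes cov: "covariant_rep p \<alpha> M \<pi> v" and \<xi>: "\<xi> \<in> Lp p M"
    and \<eta>: "has_integrated_form p M \<mu> \<iota> \<pi> v x \<xi> \<eta>"
  shows "Lp_norm p M \<eta> \<le> norm x * Lp_norm p M \<xi>"
proof -
  obtain a \<zeta> where a: "\<And>n::nat. a n \<in> Cc"
    "\<And>n. has_Lp_integral p M \<mu> (\<lambda>g. \<pi> (a n g) (v g \<xi>)) (\<zeta> n)"
    "(\<lambda>n. \<iota> (a n)) \<longlonglongrightarrow> x" "(\<lambda>n. Lp_norm p M (\<lambda>t. \<zeta> n t - \<eta> t)) \<longlonglongrightarrow> 0"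
    and \<eta>L: "\<eta> \<in> Lp p M"
    using \<eta> by (auto simp: has_integrated_form_def)
  have "Lp_norm p M \<eta> \<le> Lp_norm p M (\<lambda>t. \<zeta> n t - \<eta> t) + norm (\<iota> (a n)) * Lp_norm p M \<xi>" for n
  proof -
    have "\<zeta> n \<in> Lp p M" using a(2) by (simp add: has_Lp_integral_def)
    then have "Lp_norm p M \<eta> \<le> Lp_norm p M (\<lambda>t. \<zeta> n t - \<eta> t) + Lp_norm p M (\<zeta> n)"
      using Lp_norm_le_diff[OF p \<eta>L] by (simp add: Lp_norm_minus_commute)
    then show ?thesis
      using has_Lp_integral_norm_le[OF p \<mu> cov a(1) \<xi> a(2)] L1_norm[OF \<iota> a(1)] by (metis add_left_mono order_trans)
  qed
  moreover have "(\<lambda>n. Lp_norm p M (\<lambda>t. \<zeta> n t - \<eta> t) + norm (\<iota> (a n)) * Lp_norm p M \<xi>) \<longlonglongrightarrow>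
      0 + norm x * Lp_norm p M \<xi>"
    using a(3,4) by (intro tendsto_intros)
  ultimately have "Lp_norm p M \<eta> \<le> 0 + norm x * Lp_norm p M \<xi>"
    by (intro LIMSEQ_le_const) auto
  then show ?thesis by simp
qed

text \<open>Keeps the set under the \<open>Sup\<close> of \<open>integrated_norm\<close>
  nonempty.\<close>

lemma integrated_form_zero:
  assumes cov: "covariant_rep p \<alpha> M \<pi> v"
  shows "has_integrated_form p M \<mu> \<iota> \<pi> v x (\<lambda>_. 0) (\<lambda>_. 0)"
proof -
  obtain a where a: "\<And>n::nat. a n \<in> Cc" "(\<lambda>n. \<iota> (a n)) \<longlonglongrightarrow> x"
    using L1_approximable[of x] by blast
  have z: "(\<lambda>_. 0) \<in> Lp p M" using p by simp
  have \<pi>: "contractive_rep p M \<pi>" using cov by (simp add: covariant_rep_def)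
  \<comment> \<open>The operators are linear only up to null sets, so the image of 0 is identified
    through its norm.\<close>
  have "(LINT x:B|M. \<pi> b (v g (\<lambda>_. 0)) x) = 0" if B: "B \<in> sets M" "emeasure M B < \<infinity>" for b g B
  proof -
    have L: "\<pi> b (v g (\<lambda>_. 0)) \<in> Lp p M" using covariant_Lp[OF cov] z by blast
    have "Lp_norm p M (\<pi> b (v g (\<lambda>_. 0))) \<le> norm b * Lp_norm p M (\<lambda>_. 0)"
      using contractive_rep_bound[OF p \<pi> covariant_Lp(1)[OF cov z]] covariant_Lp(3)[OF cov z] by metis
    then have "Lp_norm p M (\<pi> b (v g (\<lambda>_. 0))) = 0" using p by (simp add: order_antisym)
    then show ?thesis using Lp_set_integrable(2)[OF p L B] by simp
  qed
  then have "has_Lp_integral p M \<mu> (\<lambda>g. \<pi> (a n g) (v g (\<lambda>_. 0))) (\<lambda>_. 0)" for n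
    using z by (simp add: has_Lp_integral_def)
  then show ?thesis unfolding has_integrated_form_def using a z p
    by (intro conjI exI[of _ a] exI[of _ "\<lambda>_ _. 0"]) auto
qed

text \<open>The L^1-estimate is an upper bound of the set under the \<open>Sup\<close>; being
  bounded, the set then lies below its \<open>Sup\<close>.\<close>

lemma integrated_norm_bounds:
  assumes cov: "covariant_rep p \<alpha> M \<pi> v"
  shows "integrated_norm p M \<mu> \<iota> \<pi> v x \<le> norm x"
    and "\<xi> \<in> Lp p M \<Longrightarrow> Lp_norm p M \<xi> \<le> 1 \<Longrightarrow> has_integrated_form p M \<mu> \<iota> \<pi> v x \<xi> \<eta> \<Longrightarrow>
      Lp_norm p M \<eta> \<le> integrated_norm p M \<mu> \<iota> \<pi> v x"
proof -
  define S where "S = {Lp_norm p M \<eta> |\<xi> \<eta>. \<xi> \<in> Lp p M \<and> Lp_norm p M \<xi> \<le> 1 \<and>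
      has_integrated_form p M \<mu> \<iota> \<pi> v x \<xi> \<eta>}"
  have le: "r \<le> norm x" if r: "r \<in> S" for r
  proof -
    obtain \<xi> \<eta> where *: "r = Lp_norm p M \<eta>" "\<xi> \<in> Lp p M" "Lp_norm p M \<xi> \<le> 1"
      "has_integrated_form p M \<mu> \<iota> \<pi> v x \<xi> \<eta>" using r by (auto simp: S_def)
    then have "r \<le> norm x * Lp_norm p M \<xi>" using integrated_form_norm_le[OF cov] by simp
    also have "\<dots> \<le> norm x * 1" using * by (intro mult_left_mono) auto
    finally show ?thesis by simp
  qed
  have "Lp_norm p M (\<lambda>_. 0) \<in> S"
    unfolding S_def using integrated_form_zero[OF cov, of x] p by force
  then have "Sup S \<le> norm x" using le by (intro cSup_least) auto
  then show "integrated_norm p M \<mu> \<iota> \<pi> v x \<le> norm x" by (simp add: integrated_norm_def S_def)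
  have bdd: "bdd_above S" by (rule bdd_aboveI[of _ "norm x"]) (rule le)
  assume "\<xi> \<in> Lp p M" "Lp_norm p M \<xi> \<le> 1" "has_integrated_form p M \<mu> \<iota> \<pi> v x \<xi> \<eta>"
  then have "Lp_norm p M \<eta> \<in> S" by (auto simp: S_def)
  then have "Lp_norm p M \<eta> \<le> Sup S" using bdd by (rule cSup_upper)
  then show "Lp_norm p M \<eta> \<le> integrated_norm p M \<mu> \<iota> \<pi> v x" by (simp add: integrated_norm_def S_def)
qed

lemma trivial_contractive_rep: "contractive_rep p trivial_measure (\<lambda>(_::'a) _ _. 0)"
  by (auto simp: contractive_rep_def algebra_rep_def operator_norm_def)

lemma trivial_nondegenerate_rep: "nondegenerate_rep p trivial_measure (\<lambda>(_::'a) _ _. 0)"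
  by (auto simp: nondegenerate_rep_def intro!: exI[of _ 0])

lemma trivial_covariant_rep: "covariant_rep p \<alpha> trivial_measure (\<lambda>_ _ _. 0) (\<lambda>_ _ _. 0)"
  by (auto simp: covariant_rep_def isometric_group_rep_def trivial_contractive_rep trivial_nondegenerate_rep)

lemma trivial_regular_rep:
  "regular_rep_of p \<alpha> \<mu> trivial_measure (\<lambda>_ _ _. 0) trivial_measure (\<lambda>_ _ _. 0) (\<lambda>_ _ _. 0)"
proof -
  have "UNIV \<in> sets \<mu>" using \<mu> by (simp add: left_haar_measure_def)
  then have "(\<lambda>_ _. 0) \<in> Lp_valued p \<mu> trivial_measure"
    by (auto simp: Lp_valued_def Lp_simple_function_def intro!: exI[of _ "\<lambda>_ _ _. 0"])
  then show ?thesis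
    unfolding regular_rep_of_def Lp_valued_iso_def
    by (auto simp: Lp_valued_norm_def ae_eq_valued_def trivial_covariant_rep intro!: exI[of _ "\<lambda>_ _ _. 0"])
qed

lemma null_rep_in_reps:
  "(trivial_measure, (\<lambda>_ _ _. 0), (\<lambda>_ _ _. 0)) \<in>
    (regular_reps p \<alpha> \<mu> :: ('g, 'a, ('g, 'a, 'm) points) rep set)"
  unfolding regular_reps_def using trivial_contractive_rep trivial_nondegenerate_rep trivial_regular_rep by blast

lemma regular_reps_subset: "regular_reps p \<alpha> \<mu> \<subseteq> covariant_reps p \<alpha>"
  by (auto simp: regular_reps_def covariant_reps_def regular_rep_of_def)

text \<open>The third inequality, for regular among covariant representations, is what compares
  F^p_lambda with F^p.\<close>

lemma sup_norm_bounds: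
  fixes R :: "('g, 'a, 'x) rep set"
  assumes R: "\<And>M \<pi> v. (M, \<pi>, v) \<in> R \<Longrightarrow> covariant_rep p \<alpha> M \<pi> v"
  shows "R \<noteq> {} \<Longrightarrow> sup_norm p \<mu> \<iota> R x \<le> norm x"
    and "(M, \<pi>, v) \<in> R \<Longrightarrow> integrated_norm p M \<mu> \<iota> \<pi> v x \<le> sup_norm p \<mu> \<iota> R x"
    and "R' \<subseteq> R \<Longrightarrow> R' \<noteq> {} \<Longrightarrow> sup_norm p \<mu> \<iota> R' x \<le> sup_norm p \<mu> \<iota> R x"
proof -
  define S where "S R = {integrated_norm p M \<mu> \<iota> \<pi> v x |M \<pi> v. (M, \<pi>, v) \<in> R}" for R :: "('g, 'a, 'x) rep set"
  have le: "r \<le> norm x" if r: "r \<in> S R" for r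
  proof -
    obtain M \<pi> v where *: "(M, \<pi>, v) \<in> R" "r = integrated_norm p M \<mu> \<iota> \<pi> v x"
      using r by (auto simp: S_def)
    show ?thesis unfolding *(2) by (rule integrated_norm_bounds(1)[OF R[OF *(1)]])
  qed
  have ne: "R \<noteq> {} \<Longrightarrow> S R \<noteq> {}" for R by (auto simp: S_def)
  have bdd: "bdd_above (S R)" by (rule bdd_aboveI[of _ "norm x"]) (rule le)
  show "R \<noteq> {} \<Longrightarrow> sup_norm p \<mu> \<iota> R x \<le> norm x"
    unfolding sup_norm_def S_def[symmetric] using le ne by (intro cSup_least) auto
  show "(M, \<pi>, v) \<in> R \<Longrightarrow> integrated_norm p M \<mu> \<iota> \<pi> v x \<le> sup_norm p \<mu> \<iota> R x"
    unfolding sup_norm_def S_def[symmetric] using bdd by (intro cSup_upper) (auto simp: S_def)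
  show "R' \<subseteq> R \<Longrightarrow> R' \<noteq> {} \<Longrightarrow> sup_norm p \<mu> \<iota> R' x \<le> sup_norm p \<mu> \<iota> R x"
    unfolding sup_norm_def S_def[symmetric] using bdd ne by (intro cSup_subset_mono) (auto simp: S_def)
qed

lemma full_crossed_product_norm_le:
  assumes "is_full_crossed_product TYPE('m) p \<alpha> \<mu> \<iota> \<kappa>"
  shows "norm (\<kappa> x) \<le> norm x"
proof -
  let ?C = "covariant_reps p \<alpha> :: ('g, 'a, ('g, 'a, 'm) points) rep set"
  have "?C \<noteq> {}"
    using null_rep_in_reps regular_reps_subset by blast
  then have "sup_norm p \<mu> \<iota> ?C x \<le> norm x"
    by (intro sup_norm_bounds(1)) (auto simp: covariant_reps_def)
  then show ?thesis using assms by (simp add: is_full_crossed_product_def is_completion_def)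
qed

lemma reduced_crossed_product_norm_le:
  assumes "is_full_crossed_product TYPE('m) p \<alpha> \<mu> \<iota> \<kappa>" "is_reduced_crossed_product TYPE('m) p \<alpha> \<mu> \<iota> \<kappa>\<^sub>r"
  shows "norm (\<kappa>\<^sub>r x) \<le> norm (\<kappa> x)"
proof -
  let ?C = "covariant_reps p \<alpha> :: ('g, 'a, ('g, 'a, 'm) points) rep set"
  let ?R = "regular_reps p \<alpha> \<mu> :: ('g, 'a, ('g, 'a, 'm) points) rep set"
  have "?R \<noteq> {}" using null_rep_in_reps by blast
  then have "sup_norm p \<mu> \<iota> ?R x \<le>
      sup_norm p \<mu> \<iota> ?C x"
    by (intro sup_norm_bounds(3) regular_reps_subset) (auto simp: covariant_reps_def)
  then show ?thesis
    using assms by (simp add: is_full_crossed_product_def is_reduced_crossed_product_def is_completion_def)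
qed

end

section \<open>Bochner integrals of compactly supported functions\<close>

text \<open>In a nonseparable space the difference of two Borel functions need not be Borel. Since s
  has finitely many values, it is enough to subtract constants.\<close>

lemma norm_diff_simple_measurable:
  fixes f :: "'x \<Rightarrow> 'b::real_normed_vector"
  assumes f: "f \<in> borel_measurable M" and s: "simple_function M s"
  shows "(\<lambda>x. norm (f x - s x)) \<in> borel_measurable M"
proof (rule measurable_compose_countable'[where f = "\<lambda>y x. norm (f x - y)" and g = s and I = "s ` space M"])
  show "(\<lambda>x. norm (f x - y)) \<in> borel_measurable M" for y
    by (rule measurable_compose[OF f]) (intro borel_measurable_continuous_onI continuous_intros)
  show "s \<in> measurable M (count_space (s ` space M))"
    using s by (auto simp: simple_function_def measurable_count_space_eq2)
  show "countable (s ` space M)" using s by (simp add: simple_function_def countable_finite)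
qed

text \<open>Measurability of |f - f'| is assumed because nonseparable values do not supply it. With
  f = f' this gives the Cauchy property of approximating integrals, and otherwise the comparison of
  two integrals.\<close>

lemma simple_bochner_integral_diff_bound:
  fixes f f' :: "'x \<Rightarrow> 'b::real_normed_vector"
  assumes f: "f \<in> borel_measurable M" and f': "f' \<in> borel_measurable M"
    and ff': "(\<lambda>x. norm (f x - f' x)) \<in> borel_measurable M"
    and s: "simple_bochner_integrable M s"
    and t: "simple_bochner_integrable M t"
  shows "ennreal (norm (simple_bochner_integral M s - simple_bochner_integral M t))
    \<le> (\<integral>\<^sup>+x. norm (f x - s x) \<partial>M) + (\<integral>\<^sup>+x. norm (f x - f' x) \<partial>M) + (\<integral>\<^sup>+x. norm (f' x - t x) \<partial>M)"
proof -
  have sf: "simple_function M s" "simple_function M t"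
    using s t by (auto elim: simple_bochner_integrable.cases)
  note [measurable] = norm_diff_simple_measurable[OF f sf(1)] norm_diff_simple_measurable[OF f' sf(2)] ff'
  have st: "simple_bochner_integrable M (\<lambda>x. s x - t x)"
    using simple_bochner_integrable_compose2[OF _ s t, of "(-)"] by simp
  have nst: "simple_bochner_integrable M (\<lambda>x. norm (s x - t x))"
    using simple_bochner_integrable_compose2[OF _ st st, of "\<lambda>x _. norm x"] by simp
  have "ennreal (norm (simple_bochner_integral M s - simple_bochner_integral M t))
      \<le> ennreal (simple_bochner_integral M (\<lambda>x. norm (s x - t x)))"
    using simple_bochner_integral_norm_bound[OF st] by (simp add: simple_bochner_integral_diff[OF s t] ennreal_leI)
  also have "\<dots> = (\<integral>\<^sup>+x. norm (s x - t x) \<partial>M)"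
    by (rule simple_bochner_integral_eq_nn_integral[OF nst]) simp
  also have "\<dots> \<le> (\<integral>\<^sup>+x. ennreal (norm (f x - s x)) + ennreal (norm (f x - f' x)) + ennreal (norm (f' x - t x)) \<partial>M)"
  proof (rule nn_integral_mono)
    fix x
    have "norm (s x - t x) \<le> norm (f x - s x) + norm (f x - f' x) + norm (f' x - t x)"
      using norm_triangle_ineq[of "s x - f x" "f x - t x"] norm_triangle_ineq[of "f x - f' x" "f' x - t x"]
      by (simp add: norm_minus_commute)
    then show "ennreal (norm (s x - t x)) \<le> ennreal (norm (f x - s x)) + ennreal (norm (f x - f' x)) + ennreal (norm (f' x - t x))"
      by (simp add: ennreal_leI flip: ennreal_plus)
  qed
  also have "\<dots> = (\<integral>\<^sup>+x. norm (f x - s x) \<partial>M) + (\<integral>\<^sup>+x. norm (f x - f' x) \<partial>M) + (\<integral>\<^sup>+x. norm (f' x - t x) \<partial>M)"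
    by (simp add: nn_integral_add)
  finally show ?thesis .
qed

text \<open>The case f = f' is the uniqueness that justifies the \<open>THE\<close> in
  \<open>bochner_value\<close>.\<close>

lemma has_bochner_value_diff_bound:
  fixes f f' :: "'x \<Rightarrow> 'b::real_normed_vector"
  assumes x: "has_bochner_value M f x" and x': "has_bochner_value M f' x'"
    and ff': "(\<lambda>x. norm (f x - f' x)) \<in> borel_measurable M"
  shows "ennreal (norm (x - x')) \<le> (\<integral>\<^sup>+x. norm (f x - f' x) \<partial>M)"
proof -
  obtain s where f: "f \<in> borel_measurable M" and s: "\<And>i::nat. simple_bochner_integrable M (s i)"
    "(\<lambda>i. \<integral>\<^sup>+g. ennreal (norm (f g - s i g)) \<partial>M) \<longlonglongrightarrow> 0"
    "(\<lambda>i. simple_bochner_integral M (s i)) \<longlonglongrightarrow> x"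
    using x unfolding has_bochner_value_def by blast
  obtain t where f': "f' \<in> borel_measurable M" and t: "\<And>i::nat. simple_bochner_integrable M (t i)"
    "(\<lambda>i. \<integral>\<^sup>+g. ennreal (norm (f' g - t i g)) \<partial>M) \<longlonglongrightarrow> 0"
    "(\<lambda>i. simple_bochner_integral M (t i)) \<longlonglongrightarrow> x'"
    using x' unfolding has_bochner_value_def by blast
  have "(\<lambda>i. ennreal (norm (simple_bochner_integral M (s i) -
      simple_bochner_integral M (t i)))) \<longlonglongrightarrow> ennreal (norm (x - x'))"
    using s(3) t(3) by (intro tendsto_intros)
  moreover have "(\<lambda>i. (\<integral>\<^sup>+x. norm (f x - s i x) \<partial>M) + (\<integral>\<^sup>+x. norm (f x - f' x) \<partial>M) +
      (\<integral>\<^sup>+x. norm (f' x - t i x) \<partial>M)) \<longlonglongrightarrow> 0 + (\<integral>\<^sup>+x. norm (f x - f' x) \<partial>M) + 0"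
    using s(2) t(2) by (intro tendsto_add tendsto_const) auto
  ultimately have "ennreal (norm (x - x')) \<le> 0 + (\<integral>\<^sup>+x. norm (f x - f' x) \<partial>M) + 0"
    by (rule LIMSEQ_le) (intro exI allI impI simple_bochner_integral_diff_bound[OF f f' ff' s(1) t(1)])
  then show ?thesis by simp
qed

lemma bochner_value_eq:
  assumes "has_bochner_value M f x"
  shows "bochner_value M f = x"
  unfolding bochner_value_def
proof (rule the_equality[where P = "has_bochner_value M f", OF assms])
  fix y assume "has_bochner_value M f y"
  then have "ennreal (norm (y - x)) \<le> (\<integral>\<^sup>+x. norm (f x - f x) \<partial>M)"
    by (rule has_bochner_value_diff_bound[OF _ assms]) simp
  then show "y = x" by simp
qed

lemma has_bochner_value_real:
  fixes f :: "'x \<Rightarrow> real"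
  assumes "integrable M f"
  shows "has_bochner_value M f (integral\<^sup>L M f)"
  using has_bochner_integral_integrable[OF assms]
  unfolding has_bochner_integral.simps has_bochner_value_def by blast

lemma has_bochner_value_scaleR:
  fixes f :: "'x \<Rightarrow> real" and x :: "'b::real_normed_vector"
  assumes "integrable M f"
  shows "has_bochner_value M (\<lambda>h. f h *\<^sub>R x) (integral\<^sup>L M f *\<^sub>R x)"
proof -
  have lin: "linear (\<lambda>r. r *\<^sub>R x)" by (rule bounded_linear.linear[OF bounded_linear_scaleR_left])
  obtain s where f: "f \<in> borel_measurable M" and s: "\<And>i::nat. simple_bochner_integrable M (s i)"
    "(\<lambda>i. \<integral>\<^sup>+g. ennreal (norm (f g - s i g)) \<partial>M) \<longlonglongrightarrow> 0"
    "(\<lambda>i. simple_bochner_integral M (s i)) \<longlonglongrightarrow> integral\<^sup>L M f"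
    using has_bochner_value_real[OF assms] unfolding has_bochner_value_def by blast
  note [measurable] = f
  have sm[measurable]: "s i \<in> borel_measurable M" for i
    using s(1)[of i] by (auto elim!: simple_bochner_integrable.cases intro: borel_measurable_simple_function)
  have "(\<lambda>h. f h *\<^sub>R x) \<in> borel_measurable M"
    by (rule measurable_compose[OF f]) (intro borel_measurable_continuous_onI continuous_intros)
  moreover have "simple_bochner_integrable M (\<lambda>h. s i h *\<^sub>R x)" for i
    using simple_bochner_integrable_compose2[OF _ s(1)[of i] s(1)[of i], of "\<lambda>r _. r *\<^sub>R x"] by simp
  moreover have "(\<lambda>i. \<integral>\<^sup>+g. ennreal (norm (f g *\<^sub>R x - s i g *\<^sub>R x)) \<partial>M) \<longlonglongrightarrow> 0"
  proof -
    have "(\<integral>\<^sup>+g. ennreal (norm (f g *\<^sub>R x - s i g *\<^sub>R x)) \<partial>M) =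
        ennreal (norm x) * (\<integral>\<^sup>+g. ennreal (norm (f g - s i g)) \<partial>M)" for i
      by (subst nn_integral_cmult[symmetric])
         (auto simp: ennreal_mult'[symmetric] mult.commute simp flip: scaleR_left_diff_distrib)
    moreover have "(\<lambda>i. ennreal (norm x) * (\<integral>\<^sup>+g. ennreal (norm (f g - s i g)) \<partial>M)) \<longlonglongrightarrow> ennreal (norm x) * 0"
      using s(2) by (intro ennreal_tendsto_cmult) auto
    ultimately show ?thesis by simp
  qed
  moreover have "(\<lambda>i. simple_bochner_integral M (\<lambda>h. s i h *\<^sub>R x)) \<longlonglongrightarrow> integral\<^sup>L M f *\<^sub>R x"
    unfolding simple_bochner_integral_linear[OF lin s(1)] using s(3) by (intro tendsto_intros)
  ultimately show ?thesis
    unfolding has_bochner_value_def by (intro conjI exI[of _ "\<lambda>i h. s i h *\<^sub>R x"] allI)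
qed

text \<open>Followed by \<open>r\<close>, a function with values in the union of the balls takes
  finitely many values and moves by less than \<epsilon>. This produces simple approximations
  without separability. Each new ball overrides the map built so far.\<close>

lemma finite_ball_retraction:
  fixes T :: "'b::metric_space set"
  assumes "finite T"
  shows "\<exists>r. finite (range r) \<and> (\<forall>y. r -` {y} \<in> sets borel) \<and> (\<forall>z\<in>(\<Union>t\<in>T. ball t \<epsilon>). dist z (r z) < \<epsilon>)"
  using assms
proof (induction T rule: finite_induct)
  case empty
  show ?case by (intro exI[of _ "\<lambda>_. undefined"]) (auto simp: vimage_def)
next
  case (insert t T)
  then obtain r where r: "finite (range r)" "\<And>y. r -` {y} \<in> sets borel"
    "\<And>z. z \<in> (\<Union>t\<in>T. ball t \<epsilon>) \<Longrightarrow> dist z (r z) < \<epsilon>" by blast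
  define r' where "r' z = (if z \<in> ball t \<epsilon> then t else r z)" for z
  have "range r' \<subseteq> insert t (range r)" by (auto simp: r'_def)
  then have "finite (range r')" using r(1) finite_subset by blast
  moreover have "r' -` {y} \<in> sets borel" for y
  proof -
    have "r' -` {y} = (ball t \<epsilon> \<inter> (if y = t then UNIV else {})) \<union> (r -` {y} - ball t \<epsilon>)"
    proof (rule set_eqI)
      show "z \<in> r' -` {y} \<longleftrightarrow> z \<in> (ball t \<epsilon> \<inter> (if y = t then UNIV else {})) \<union> (r -` {y} - ball t \<epsilon>)" for z
        by (cases "z \<in> ball t \<epsilon>"; cases "y = t") (simp_all add: r'_def)
    qed
    also have "\<dots> \<in> sets borel"
      by (intro sets.Un sets.Int sets.Diff r(2) borel_open open_ball) simp
    finally show ?thesis .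
  qed
  moreover have "\<forall>z\<in>(\<Union>t\<in>insert t T. ball t \<epsilon>). dist z (r' z) < \<epsilon>"
  proof
    fix z assume z: "z \<in> (\<Union>t\<in>insert t T. ball t \<epsilon>)"
    show "dist z (r' z) < \<epsilon>"
    proof (cases "z \<in> ball t \<epsilon>")
      case True
      then show ?thesis by (simp add: r'_def dist_commute)
    next
      case False
      then show ?thesis using r(3)[of z] z unfolding r'_def by (simp only: if_False UN_insert Un_iff) simp
    qed
  qed
  ultimately show ?case by blast
qed

lemma compact_image_net:
  fixes f :: "'g::topological_space \<Rightarrow> 'b::metric_space"
  assumes "continuous_on UNIV f" "compact K" "0 < \<epsilon>"
  obtains T where "finite T" "f ` K \<subseteq> (\<Union>t\<in>T. ball t \<epsilon>)"
proof -
  have "compact (f ` K)" using assms compact_continuous_image continuous_on_subset by blast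
  then have "seq_compact (f ` K)" by (simp add: compact_eq_seq_compact_metric)
  then have "\<exists>T. finite T \<and> T \<subseteq> f ` K \<and> f ` K \<subseteq> (\<Union>t\<in>T. ball t \<epsilon>)"
    using assms(3) by (intro seq_compact_imp_totally_bounded[rule_format])
  then show thesis using that by blast
qed

context
  fixes \<mu> :: "'g::{topological_group_add, t2_space} measure" and K :: "'g set"
  assumes \<mu>: "sets \<mu> = sets borel" and K: "compact K" and \<mu>K: "emeasure \<mu> K < \<infinity>"
begin

lemma K_measurable [measurable]: "K \<in> sets \<mu>"
  by (rule compact_in_sets[OF \<mu> K])

lemma nn_integral_norm_le_compact:
  assumes "\<And>g. g \<in> K \<Longrightarrow> norm (f g) \<le> \<epsilon>" "\<And>g. g \<notin> K \<Longrightarrow> f g = 0"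
  shows "(\<integral>\<^sup>+g. norm (f g) \<partial>\<mu>) \<le> ennreal (\<epsilon> * measure \<mu> K)"
\<comment> \<open>For empty \<open>K\<close> the hypotheses leave the sign of
  \<open>\<epsilon>\<close> open.\<close>
proof (cases "K = {}")
  case True
  then show ?thesis using assms by simp
next
  case False
  then obtain g where "g \<in> K" by blast
  then have \<epsilon>: "0 \<le> \<epsilon>" using assms(1) norm_ge_zero order_trans by metis
  have "(\<integral>\<^sup>+g. norm (f g) \<partial>\<mu>) \<le> (\<integral>\<^sup>+g. ennreal \<epsilon> * indicator K g \<partial>\<mu>)"
    using assms by (intro nn_integral_mono) (auto simp: indicator_def ennreal_leI)
  also have "\<dots> = ennreal \<epsilon> * emeasure \<mu> K" by (rule nn_integral_cmult_indicator) simp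
  also have "\<dots> = ennreal (\<epsilon> * measure \<mu> K)"
    using \<epsilon> \<mu>K by (simp add: emeasure_eq_ennreal_measure ennreal_mult)
  finally show ?thesis .
qed

text \<open>The image of \<open>K\<close> is compact, hence totally bounded, so \<open>f\<close> is
  a uniform limit of simple functions supported in \<open>K\<close>; as \<open>K\<close> has finite
  measure, uniform closeness gives closeness in L^1.\<close>

lemma has_bochner_value_compact_support:
  fixes f :: "'g \<Rightarrow> 'b::banach"
  assumes f: "continuous_on UNIV f" "\<And>g. g \<notin> K \<Longrightarrow> f g = 0"
  shows "has_bochner_value \<mu> f (bochner_value \<mu> f)"
proof -
  have fm: "f \<in> borel_measurable \<mu>" by (rule continuous_measurable_on[OF \<mu> f(1)])
  have "\<exists>s. simple_bochner_integrable \<mu> s \<and>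
      (\<integral>\<^sup>+g. norm (f g - s g) \<partial>\<mu>) \<le> ennreal (1 / Suc i * measure \<mu> K)" for i :: nat
  proof -
    obtain T where T: "finite T" "f ` K \<subseteq> (\<Union>t\<in>T. ball t (1 / Suc i))"
      using compact_image_net[OF f(1) K, of "1 / Suc i"] by auto
    obtain r where r: "finite (range r)" "\<And>y. r -` {y} \<in> sets borel"
      "\<And>z. z \<in> (\<Union>t\<in>T. ball t (1 / Suc i)) \<Longrightarrow> dist z (r z) < 1 / Suc i"
      using finite_ball_retraction[OF T(1)] by metis
    \<comment> \<open>The cutoff keeps the support inside a set of finite measure.\<close>
    define s where "s g = (if g \<in> K then r (f g) else 0)" for g
    have "range s \<subseteq> insert 0 (range r)" by (auto simp: s_def)
    then have fin: "finite (range s)" using r(1) finite_subset by blast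
    have "s -` {y} \<inter> space \<mu> \<in> sets \<mu>" for y
    proof -
      have "s -` {y} \<inter> space \<mu> = (K \<inter> (f -` (r -` {y}) \<inter> space \<mu>)) \<union> ((space \<mu> - K) \<inter> (if y = 0 then space \<mu> else {}))"
        using sets.sets_into_space[OF K_measurable] by (auto simp: s_def split: if_splits)
      also have "\<dots> \<in> sets \<mu>"
        by (intro sets.Un sets.Int sets.Diff K_measurable sets.top measurable_sets[OF fm r(2)]) simp
      finally show ?thesis .
    qed
    then have sf: "simple_function \<mu> s"
      using fin by (auto simp: simple_function_def intro: finite_subset[OF image_mono[OF subset_UNIV]])
    have "emeasure \<mu> {y \<in> space \<mu>. s y \<noteq> 0} \<le> emeasure \<mu> K"
      by (intro emeasure_mono) (auto simp: s_def split: if_splits)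
    then have "simple_bochner_integrable \<mu> s"
      using sf \<mu>K by (auto simp: simple_bochner_integrable.simps dest: le_less_trans)
    moreover have "norm (f g - s g) \<le> 1 / Suc i" if "g \<in> K" for g
      using r(3)[of "f g"] T(2) that by (auto simp: s_def dist_norm image_subset_iff intro: less_imp_le)
    ultimately show ?thesis
      using f(2) by (intro exI[of _ s] conjI nn_integral_norm_le_compact) (auto simp: s_def)
  qed
  then obtain s where s: "\<And>i. simple_bochner_integrable \<mu> (s i)"
    "\<And>i::nat. (\<integral>\<^sup>+g. norm (f g - s i g) \<partial>\<mu>) \<le> ennreal (1 / Suc i * measure \<mu> K)" by metis
  define I where "I i = simple_bochner_integral \<mu> (s i)" for i
  have "(\<lambda>i. 1 / Suc i * measure \<mu> K) \<longlonglongrightarrow> 0 * measure \<mu> K"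
    using LIMSEQ_inverse_real_of_nat by (intro tendsto_mult tendsto_const) (simp only: inverse_eq_divide)
  then have r0: "(\<lambda>i. 1 / Suc i * measure \<mu> K) \<longlonglongrightarrow> 0" by simp
  have lim: "(\<lambda>i. \<integral>\<^sup>+g. norm (f g - s i g) \<partial>\<mu>) \<longlonglongrightarrow> 0"
    by (rule tendsto_sandwich[OF _ _ tendsto_const tendsto_ennrealI[OF r0, simplified]])
       (use s(2) in \<open>auto simp: ennreal_0\<close>)
  \<comment> \<open>Comparing \<open>f\<close> with itself: the distance of two approximating
    integrals is at most the sum of their L^1-errors.\<close>
  have d: "norm (I i - I j) \<le> 1 / Suc i * measure \<mu> K + 1 / Suc j * measure \<mu> K" for i j
  proof -
    have "ennreal (norm (I i - I j)) \<le> (\<integral>\<^sup>+g. norm (f g - s i g) \<partial>\<mu>) + (\<integral>\<^sup>+g. norm (f g - f g) \<partial>\<mu>) +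
        (\<integral>\<^sup>+g. norm (f g - s j g) \<partial>\<mu>)"
      unfolding I_def by (rule simple_bochner_integral_diff_bound[OF fm fm _ s(1) s(1)]) simp
    also have "\<dots> \<le> ennreal (1 / Suc i * measure \<mu> K) + ennreal (1 / Suc j * measure \<mu> K)"
      using add_mono[OF s(2)[of i] s(2)[of j]] by simp
    also have "\<dots> = ennreal (1 / Suc i * measure \<mu> K + 1 / Suc j * measure \<mu> K)"
      by (simp flip: ennreal_plus)
    finally show ?thesis by (rule ennreal_le_iff[THEN iffD1, rotated]) simp
  qed
  have "Cauchy I"
  proof (rule metric_CauchyI)
    fix e :: real assume "0 < e"
    then have "\<forall>\<^sub>F i in sequentially. 1 / Suc i * measure \<mu> K < e / 2"
      by (intro order_tendstoD(2)[OF r0]) simp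
    then obtain N where N: "\<And>i. N \<le> i \<Longrightarrow> 1 / Suc i * measure \<mu> K < e / 2"
      by (auto simp: eventually_sequentially)
    show "\<exists>N. \<forall>m\<ge>N. \<forall>n\<ge>N. dist (I m) (I n) < e"
    proof (intro exI allI impI)
      fix m n assume "N \<le> m" "N \<le> n"
      then show "dist (I m) (I n) < e" using N[of m] N[of n] d[of m n] unfolding dist_norm by linarith
    qed
  qed
  then obtain x where "I \<longlonglongrightarrow> x" using Cauchy_convergent convergentD by blast
  then have "has_bochner_value \<mu> f x"
    unfolding has_bochner_value_def I_def using fm s(1) lim by blast
  then show ?thesis using bochner_value_eq by metis
qed

lemma bochner_value_dist:
  fixes f f' :: "'g \<Rightarrow> 'b::banach"
  assumes f: "continuous_on UNIV f" "\<And>g. g \<notin> K \<Longrightarrow> f g = 0"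
    and f': "continuous_on UNIV f'" "\<And>g. g \<notin> K \<Longrightarrow> f' g = 0"
    and le: "\<And>g. g \<in> K \<Longrightarrow> norm (f g - f' g) \<le> \<epsilon>" and \<epsilon>: "0 \<le> \<epsilon>"
  shows "norm (bochner_value \<mu> f - bochner_value \<mu> f') \<le> \<epsilon> * measure \<mu> K"
proof -
  have "ennreal (norm (bochner_value \<mu> f - bochner_value \<mu> f')) \<le> (\<integral>\<^sup>+g. norm (f g - f' g) \<partial>\<mu>)"
    by (intro has_bochner_value_diff_bound has_bochner_value_compact_support f f'
        continuous_measurable_on[OF \<mu>] continuous_intros)
  also have "\<dots> \<le> ennreal (\<epsilon> * measure \<mu> K)"
    using f(2) f'(2) le by (intro nn_integral_norm_le_compact) auto
  finally show ?thesis using \<epsilon> by (simp add: ennreal_le_iff)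
qed

text \<open>As \<open>u\<close> has integral 1, x is itself the integral of
  \<open>u g *\<^sub>R x\<close>, so the two integrands can be compared pointwise.\<close>

lemma bochner_value_near_constant:
  fixes f :: "'g \<Rightarrow> 'b::banach" and u :: "'g \<Rightarrow> real"
  assumes f: "continuous_on UNIV f" "\<And>g. g \<notin> K \<Longrightarrow> f g = 0"
    and u: "continuous_on UNIV u" "\<And>g. g \<notin> K \<Longrightarrow> u g = 0" "(\<integral>g. u g \<partial>\<mu>) = 1" "\<And>g. 0 \<le> u g"
    and le: "\<And>g. norm (f g - u g *\<^sub>R x) \<le> \<epsilon> * u g" and \<epsilon>: "0 \<le> \<epsilon>"
  shows "norm (bochner_value \<mu> f - x) \<le> \<epsilon>"
proof -
  have iu: "integrable \<mu> u" by (rule integrable_compact_support[OF \<mu> \<mu>K K u(1,2)])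
  have "has_bochner_value \<mu> (\<lambda>g. u g *\<^sub>R x) x" using has_bochner_value_scaleR[OF iu, of x] u(3) by simp
  then have "ennreal (norm (bochner_value \<mu> f - x)) \<le> (\<integral>\<^sup>+g. norm (f g - u g *\<^sub>R x) \<partial>\<mu>)"
    by (intro has_bochner_value_diff_bound has_bochner_value_compact_support f
        continuous_measurable_on[OF \<mu>] continuous_intros u(1))
  also have "\<dots> \<le> (\<integral>\<^sup>+g. ennreal (\<epsilon> * u g) \<partial>\<mu>)" by (intro nn_integral_mono ennreal_leI le)
  also have "\<dots> = ennreal (\<integral>g. \<epsilon> * u g \<partial>\<mu>)"
    using iu u(4) \<epsilon> by (intro nn_integral_eq_integral) auto
  also have "\<dots> = ennreal \<epsilon>" using u(3) by simp
  finally show ?thesis using \<epsilon> by (simp add: ennreal_le_iff)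
qed

end

section \<open>An approximate identity of $L^1(G,A,\alpha)$\<close>

lemma group_action_simps:
  assumes "group_action \<alpha>"
  shows "\<alpha> g (a + b) = \<alpha> g a + \<alpha> g b" "\<alpha> g (a - b) = \<alpha> g a - \<alpha> g b" "\<alpha> g 0 = 0"
    "\<alpha> g (c *\<^sub>C a) = c *\<^sub>C \<alpha> g a" "\<alpha> g (r *\<^sub>R a) = r *\<^sub>R \<alpha> g a"
    "\<alpha> g (a * b) = \<alpha> g a * \<alpha> g b" "norm (\<alpha> g a) = norm a"
    "\<alpha> (g + h) a = \<alpha> g (\<alpha> h a)" "\<alpha> 0 a = a" "\<alpha> g (\<alpha> (- g) a) = a" "\<alpha> (- g) (\<alpha> g a) = a"
proof -
  have iso: "isometric_automorphism (\<alpha> g)" for g using assms by (simp add: group_action_def)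
  show add: "\<alpha> g (a + b) = \<alpha> g a + \<alpha> g b" for a b using iso by (simp add: isometric_automorphism_def)
  show "\<alpha> g (a - b) = \<alpha> g a - \<alpha> g b" using add[of "a - b" b] by (simp add: algebra_simps)
  show "\<alpha> g 0 = 0" using add[of 0 0] by simp
  show sc: "\<alpha> g (c *\<^sub>C a) = c *\<^sub>C \<alpha> g a" for c using iso by (simp add: isometric_automorphism_def)
  show "\<alpha> g (r *\<^sub>R a) = r *\<^sub>R \<alpha> g a" using sc[of "complex_of_real r"] by (simp add: scaleC_of_real)
  show "\<alpha> g (a * b) = \<alpha> g a * \<alpha> g b" "norm (\<alpha> g a) = norm a"
    using iso by (simp_all add: isometric_automorphism_def)
  show comp: "\<alpha> (g + h) a = \<alpha> g (\<alpha> h a)" for g h a using assms by (simp add: group_action_def)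
  \<comment> \<open>The axioms do not state that \<alpha>_0 is the identity; it follows since
    \<alpha>_0 is idempotent and injective.\<close>
  have inj: "inj (\<alpha> 0)" using iso by (auto simp: isometric_automorphism_def bij_def)
  show z: "\<alpha> 0 a = a" for a using comp[of 0 0 a] inj by (auto simp: inj_def)
  show "\<alpha> g (\<alpha> (- g) a) = a" "\<alpha> (- g) (\<alpha> g a) = a"
    using comp[of g "- g" a] comp[of "- g" g a] z by auto
qed

text \<open>The action is only strongly continuous; isometry of each automorphism upgrades this to
  joint continuity.\<close>

lemma continuous_on_group_action:
  assumes \<alpha>: "group_action \<alpha>" and u: "continuous_on UNIV u" and w: "continuous_on UNIV w"
  shows "continuous_on UNIV (\<lambda>z. \<alpha> (u z) (w z))"
  unfolding continuous_on_def
proof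
  fix z
  have "((\<lambda>y. \<alpha> (u y) (w z)) \<longlongrightarrow> \<alpha> (u z) (w z)) (at z)"
    using continuous_on_compose2[of UNIV "\<lambda>g. \<alpha> g (w z)" UNIV u] \<alpha> u
    by (auto simp: group_action_def continuous_on_def)
  then have 1: "((\<lambda>y. norm (\<alpha> (u y) (w z) - \<alpha> (u z) (w z))) \<longlongrightarrow> 0) (at z)"
    by (simp add: LIM_zero tendsto_norm_zero)
  have 2: "((\<lambda>y. norm (w y - w z)) \<longlongrightarrow> 0) (at z)"
    using w by (simp add: continuous_on_def LIM_zero tendsto_norm_zero)
  have "((\<lambda>y. \<alpha> (u y) (w y) - \<alpha> (u z) (w z)) \<longlongrightarrow> 0) (at z)"
  proof (rule Lim_null_comparison[OF always_eventually tendsto_add_zero[OF 2 1]], rule)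
    fix y
    have "\<alpha> (u y) (w y) - \<alpha> (u z) (w z) = \<alpha> (u y) (w y - w z) + (\<alpha> (u y) (w z) - \<alpha> (u z) (w z))"
      by (simp add: group_action_simps[OF \<alpha>])
    then show "norm (\<alpha> (u y) (w y) - \<alpha> (u z) (w z)) \<le>
        norm (w y - w z) + norm (\<alpha> (u y) (w z) - \<alpha> (u z) (w z))"
      by (metis norm_triangle_ineq group_action_simps(7)[OF \<alpha>])
  qed
  then show "((\<lambda>y. \<alpha> (u y) (w y)) \<longlongrightarrow> \<alpha> (u z) (w z)) (at z)" by (simp add: LIM_zero_iff)
qed

lemma compact_set_plus:
  fixes A B :: "'g::topological_group_add set"
  assumes "compact A" "compact B"
  shows "compact {x + y |x y. x \<in> A \<and> y \<in> B}"
proof -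
  have "{x + y |x y. x \<in> A \<and> y \<in> B} = (\<lambda>z. fst z + snd z) ` (A \<times> B)" by force
  then show ?thesis
    using assms by (auto intro!: compact_continuous_image continuous_intros compact_Times)
qed

lemma integral_left_translate:
  fixes f :: "'g::{topological_group_add, t2_space} \<Rightarrow> real"
  assumes \<mu>: "left_haar_measure \<mu>" and f: "continuous_on UNIV f"
  shows "(\<integral>h. f (g + h) \<partial>\<mu>) = (\<integral>h. f h \<partial>\<mu>)"
proof -
  have s: "sets \<mu> = sets borel" using \<mu> by (simp add: left_haar_measure_def)
  have sp: "space \<mu> = UNIV" using sets_eq_imp_space_eq[OF s] by simp
  have "(+) g \<in> borel_measurable borel"
    by (intro borel_measurable_continuous_onI continuous_intros)
  then have T: "(+) g \<in> measurable \<mu> \<mu>" using measurable_cong_sets[OF s s] by blast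
  have fm: "f \<in> borel_measurable \<mu>" by (rule continuous_measurable_on[OF s f])
  have "distr \<mu> \<mu> ((+) g) = \<mu>"
  proof (rule measure_eqI)
    fix B assume "B \<in> sets (distr \<mu> \<mu> ((+) g))"
    then have B: "B \<in> sets \<mu>" by simp
    \<comment> \<open>Invariance is stated for images under translations, so the preimage under
      translation by g is rewritten as the image under translation by -g.\<close>
    have "(+) g -` B \<inter> space \<mu> = (+) (- g) ` B"
    proof (intro set_eqI iffI)
      fix x assume "x \<in> (+) g -` B \<inter> space \<mu>"
      then show "x \<in> (+) (- g) ` B" by (intro image_eqI[of _ _ "g + x"]) auto
    qed (auto simp: sp)
    then show "emeasure (distr \<mu> \<mu> ((+) g)) B = emeasure \<mu> B"
      using \<mu> B s T by (simp add: emeasure_distr left_haar_measure_def)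
  qed simp
  then show ?thesis using integral_distr[OF T fm] by simp
qed

lemma Hausdorff_space_euclidean_t2: "Hausdorff_space (euclidean :: 'g::t2_space topology)"
  unfolding Hausdorff_space_def
proof (intro allI impI)
  fix x y :: 'g assume "x \<in> topspace euclidean \<and> y \<in> topspace euclidean \<and> x \<noteq> y"
  then obtain U V where "open U" "open V" "x \<in> U" "y \<in> V" "U \<inter> V = {}" using hausdorff[of x y] by blast
  then show "\<exists>U V. openin euclidean U \<and> openin euclidean V \<and> x \<in> U \<and> y \<in> V \<and> disjnt U V"
    by (intro exI[of _ U] exI[of _ V]) (simp add: disjnt_def)
qed

text \<open>A locally compact Hausdorff space is completely regular, so some \<phi> separates 0 from
  the complement of W. Multiplying 1 - \<phi> by its reflection makes the function symmetric and
  keeps it zero outside W.\<close>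

lemma symmetric_bump:
  fixes \<mu> :: "'g::{topological_group_add, t2_space} measure"
  assumes \<mu>: "left_haar_measure \<mu>" and lc: "locally_compact_space (euclidean :: 'g topology)"
    and W: "open W" "0 \<in> W" and N: "W \<subseteq> N" "compact N"
  obtains f :: "'g \<Rightarrow> real" where "continuous_on UNIV f" "\<And>h. 0 \<le> f h" "\<And>h. f (- h) = f h"
    "\<And>h. h \<notin> W \<Longrightarrow> f h = 0" "(\<integral>h. f h \<partial>\<mu>) = 1"
proof -
  have s: "sets \<mu> = sets borel"
    using \<mu> unfolding left_haar_measure_def by (elim conjE) assumption
  have "\<forall>K. compact K \<longrightarrow> emeasure \<mu> K < \<infinity>"
    using \<mu> unfolding left_haar_measure_def by (elim conjE) assumption
  then have \<mu>N: "emeasure \<mu> N < \<infinity>" using N(2) by (elim allE impE)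
  have pos: "\<forall>U. open U \<and> U \<noteq> {} \<longrightarrow> 0 < emeasure \<mu> U"
    using \<mu> unfolding left_haar_measure_def by (elim conjE) assumption
  have "completely_regular_space (euclidean :: 'g topology)"
    by (rule locally_compact_regular_imp_completely_regular_space[OF lc disjI1[OF Hausdorff_space_euclidean_t2]])
  moreover have "closedin euclidean (- W) \<and> 0 \<in> topspace euclidean - (- W)" using W by auto
  ultimately have "\<exists>\<phi>::'g \<Rightarrow> real. continuous_map euclidean (top_of_set {0..1}) \<phi> \<and> \<phi> 0 = 0 \<and> \<phi> ` (- W) \<subseteq> {1}"
    unfolding completely_regular_space_def by meson
  then obtain \<phi> :: "'g \<Rightarrow> real" where \<phi>: "continuous_map euclidean (top_of_set {0..1}) \<phi>" "\<phi> 0 = 0" "\<phi> ` (- W) \<subseteq> {1}"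
    by blast
  have c\<phi>: "continuous_on UNIV \<phi>" and r\<phi>: "\<And>x. \<phi> x \<le> 1"
    using \<phi>(1) by (auto simp: continuous_map_in_subtopology)
  define f where "f h = (1 - \<phi> h) * (1 - \<phi> (- h))" for h
  have cf: "continuous_on UNIV f"
    unfolding f_def by (intro continuous_intros c\<phi> continuous_on_compose2[OF c\<phi>]) auto
  have f0: "f h = 0" if "h \<notin> W" for h using \<phi>(3) that by (auto simp: f_def)
  have fnn: "0 \<le> f h" for h using r\<phi> by (simp add: f_def)
  have fs: "f (- h) = f h" for h by (simp add: f_def mult.commute)
  have int: "integrable \<mu> f"
    by (rule integrable_compact_support[OF s \<mu>N N(2) cf]) (use f0 N(1) in auto)
  \<comment> \<open>\<open>f 0 = 1\<close>, so \<open>U\<close> is an open neighbourhood of 0. Its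
    positive measure forces the integral of \<open>f\<close> to be positive, which permits
    normalisation.\<close>
  define U where "U = {h. 1 / 2 < f h}"
  have U: "open U" unfolding U_def by (intro open_Collect_less cf continuous_intros)
  have "0 \<in> U" by (simp add: U_def f_def \<phi>(2))
  have UN: "U \<subseteq> N" using f0 N(1) by (force simp: U_def)
  have Um: "U \<in> sets \<mu>" using U s by simp
  have "emeasure \<mu> U \<le> emeasure \<mu> N" using UN compact_in_sets[OF s N(2)] by (intro emeasure_mono)
  then have Ufin: "emeasure \<mu> U < \<infinity>" using \<mu>N by (rule le_less_trans)
  have "0 < measure \<mu> U"
    using pos[rule_format, of U] U \<open>0 \<in> U\<close> Ufin by (auto simp: measure_def enn2real_positive_iff)
  also have "measure \<mu> U = 2 * (\<integral>h. 1 / 2 * indicator U h \<partial>\<mu>)" using Um Ufin by simp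
  also have "(\<integral>h. 1 / 2 * indicator U h \<partial>\<mu>) \<le> (\<integral>h. f h \<partial>\<mu>)"
  proof (rule integral_mono[OF _ int])
    have "integrable \<mu> (indicat_real U)" using Um Ufin by simp
    then show "integrable \<mu> (\<lambda>h. 1 / 2 * indicat_real U h)" by simp
  qed (use fnn in \<open>auto simp: indicator_def U_def\<close>)
  finally have I: "0 < (\<integral>h. f h \<partial>\<mu>)" by simp
  show thesis
    by (rule that[of "\<lambda>h. f h / (\<integral>h. f h \<partial>\<mu>)"])
       (use I cf fnn f0 fs in \<open>auto intro!: continuous_intros\<close>)
qed

section \<open>Convolution of compactly supported functions\<close>

context
  fixes \<mu> :: "'g::{topological_group_add, t2_space} measure"
    and \<alpha> :: "'g \<Rightarrow> 'a::complex_banach_algebra \<Rightarrow> 'a"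
  assumes \<mu>: "left_haar_measure \<mu>" and \<alpha>: "group_action \<alpha>"
begin

lemma haar_sets: "sets \<mu> = sets borel"
  and haar_compact: "compact K \<Longrightarrow> emeasure \<mu> K < \<infinity>"
  using \<mu> by (auto simp: left_haar_measure_def)

text \<open>Joint continuity serves the tube lemma; continuity in the integration variable alone
  serves the existence of the integral.\<close>

lemma convolution_integrand_continuous:
  assumes "continuous_on UNIV a" "continuous_on UNIV b"
  shows "continuous_on UNIV (\<lambda>z. a (snd z) * \<alpha> (snd z) (b (- snd z + fst z)))"
    and "continuous_on UNIV (\<lambda>h. a h * \<alpha> h (b (- h + g)))"
  by (intro continuous_intros continuous_on_group_action[OF \<alpha>]
      continuous_on_compose2[OF assms(1)] continuous_on_compose2[OF assms(2)] subset_UNIV assms)+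

lemma convolution_zero:
  assumes "\<And>h. a h * \<alpha> h (b (- h + g)) = 0"
  shows "convolution \<mu> \<alpha> a b g = 0"
proof -
  have "has_bochner_value \<mu> (\<lambda>_. 0 :: 'a) 0" using has_bochner_value_scaleR[of \<mu> "\<lambda>_. 0" "0 :: 'a"] by simp
  then show ?thesis using assms by (simp add: convolution_def bochner_value_eq)
qed

lemma convolution_support:
  assumes "\<And>g. g \<notin> A \<Longrightarrow> a g = 0" "\<And>g. g \<notin> B \<Longrightarrow> b g = 0" "g \<notin> {x + y |x y. x \<in> A \<and> y \<in> B}"
  shows "convolution \<mu> \<alpha> a b g = 0"
proof (rule convolution_zero)
  fix h
  have "h \<notin> A \<or> - h + g \<notin> B"
  proof (rule ccontr)
    assume "\<not> (h \<notin> A \<or> - h + g \<notin> B)"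
    then have "h + (- h + g) \<in> {x + y |x y. x \<in> A \<and> y \<in> B}" by blast
    then show False using assms(3) by (simp add: add.assoc[symmetric])
  qed
  then show "a h * \<alpha> h (b (- h + g)) = 0"
    using assms(1,2) by (auto simp: group_action_simps[OF \<alpha>])
qed

text \<open>Continuity comes from the tube lemma: near a given point g the integrands are uniformly
  close over the compact support \<open>A\<close> of \<open>a\<close>, and \<open>A\<close> has
  finite measure.\<close>

lemma convolution_compactly_supported:
  assumes a: "a \<in> Cc" and b: "b \<in> Cc"
  shows "convolution \<mu> \<alpha> a b \<in> Cc"
proof -
  obtain A where A: "continuous_on UNIV a" "compact A" "\<And>g. g \<notin> A \<Longrightarrow> a g = 0"
    using compactly_supportedE[OF a] by metis
  obtain B where B: "continuous_on UNIV b" "compact B" "\<And>g. g \<notin> B \<Longrightarrow> b g = 0"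
    using compactly_supportedE[OF b] by metis
  let ?F = "\<lambda>g h. a h * \<alpha> h (b (- h + g))"
  have "continuous_on UNIV (convolution \<mu> \<alpha> a b)"
    unfolding continuous_on_def
  proof
    fix g
    show "(convolution \<mu> \<alpha> a b \<longlongrightarrow> convolution \<mu> \<alpha> a b g) (at g)"
    proof (rule tendstoI)
      fix e :: real assume e: "0 < e"
      \<comment> \<open>The summand 1 keeps the divisor positive when \<open>A\<close> is a null
        set; the factor 2 in \<open>d\<close> leaves room for a strict inequality.\<close>
      define m where "m = measure \<mu> A + 1"
      define d where "d = e / (2 * m)"
      have m: "0 < m" by (simp add: m_def add_nonneg_pos)
      have d: "0 < d" using e m by (simp add: d_def)
      have c: "continuous_on (UNIV \<times> A) (\<lambda>z. ?F (fst z) (snd z))"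
        using convolution_integrand_continuous(1)[OF A(1) B(1)] continuous_on_subset by blast
      obtain X where X: "g \<in> X" "open X" "\<forall>x\<in>X \<inter> UNIV. \<forall>t\<in>A. dist (?F x t) (?F g t) \<le> d"
        using continuous_on_prod_compactE[OF c A(2) UNIV_I d, of g] by (metis fst_conv snd_conv)
      have "dist (convolution \<mu> \<alpha> a b x) (convolution \<mu> \<alpha> a b g) < e" if "x \<in> X" for x
      proof -
        have "dist (convolution \<mu> \<alpha> a b x) (convolution \<mu> \<alpha> a b g) \<le> d * measure \<mu> A"
          unfolding convolution_def dist_norm
          by (rule bochner_value_dist[OF haar_sets A(2) haar_compact[OF A(2)]])
             (use X(3) that A(3) d in \<open>auto simp: dist_norm intro: convolution_integrand_continuous(2)[OF A(1) B(1)]\<close>)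
        also have "\<dots> \<le> d * m" using d by (simp add: m_def)
        also have "\<dots> = e / 2" using m by (simp add: d_def)
        finally show ?thesis using e by simp
      qed
      then show "\<forall>\<^sub>F x in at g. dist (convolution \<mu> \<alpha> a b x) (convolution \<mu> \<alpha> a b g) < e"
        using X(1,2) by (auto simp: eventually_at_topological)
    qed
  qed
  moreover have "compact {x + y |x y. x \<in> A \<and> y \<in> B}" by (rule compact_set_plus[OF A(2) B(2)])
  ultimately show ?thesis
    using convolution_support[of A a B b] A(3) B(3) unfolding compactly_supported_def by blast
qed

end

lemma compactly_supported_diff:
  fixes a b :: "'g::t2_space \<Rightarrow> 'a::real_normed_vector"
  assumes "a \<in> Cc" "b \<in> Cc"
  shows "(\<lambda>g. a g - b g) \<in> Cc"
proof -
  obtain A where A: "continuous_on UNIV a" "compact A" "\<And>g. g \<notin> A \<Longrightarrow> a g = 0"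
    using compactly_supportedE[OF assms(1)] by metis
  obtain B where B: "continuous_on UNIV b" "compact B" "\<And>g. g \<notin> B \<Longrightarrow> b g = 0"
    using compactly_supportedE[OF assms(2)] by metis
  have "continuous_on UNIV (\<lambda>g. a g - b g)" by (intro continuous_intros A B)
  moreover have "compact (A \<union> B)" by (intro compact_Un A B)
  ultimately show ?thesis unfolding compactly_supported_def using A(3) B(3) by force
qed

section \<open>Approximate units of L^1(G,A,\<alpha>)\<close>

context
  fixes \<mu> :: "'g::{topological_group_add, t2_space} measure"
    and \<alpha> :: "'g \<Rightarrow> 'a::complex_banach_algebra \<Rightarrow> 'a"
    and \<iota> :: "('g \<Rightarrow> 'a) \<Rightarrow> 'l::complex_banach_algebra"
  assumes \<mu>: "left_haar_measure \<mu>" and \<alpha>: "group_action \<alpha>" and \<iota>: "is_L1_algebra \<mu> \<alpha> \<iota>"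
begin

lemma L1_mult: "a \<in> Cc \<Longrightarrow> b \<in> Cc \<Longrightarrow> \<iota> (convolution \<mu> \<alpha> a b) = \<iota> a * \<iota> b"
  using \<iota> by (simp add: is_L1_algebra_def is_completion_def)

lemma L1_diff:
  assumes a: "a \<in> Cc" and b: "b \<in> Cc"
  shows "\<iota> (\<lambda>g. a g - b g) = \<iota> a - \<iota> b"
proof -
  have add: "\<iota> (\<lambda>g. x g + y g) = \<iota> x + \<iota> y" if "x \<in> Cc" "y \<in> Cc" for x y
    using \<iota> that by (simp add: is_L1_algebra_def is_completion_def)
  show ?thesis using add[OF compactly_supported_diff[OF a b] b] by simp
qed

lemma L1_scaleR:
  assumes "a \<in> Cc" shows "\<iota> (\<lambda>g. r *\<^sub>R a g) = r *\<^sub>R \<iota> a"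
proof -
  have "\<iota> (\<lambda>g. c *\<^sub>C a g) = c *\<^sub>C \<iota> a" for c
    using \<iota> assms by (simp add: is_L1_algebra_def is_completion_def)
  from this[of "complex_of_real r"] show ?thesis by (simp add: scaleC_of_real)
qed

lemma L1_dist_le:
  assumes a: "a \<in> Cc" and b: "b \<in> Cc" and L: "compact L"
    and le: "\<And>g. g \<in> L \<Longrightarrow> norm (a g - b g) \<le> \<epsilon>" "\<And>g. g \<notin> L \<Longrightarrow> a g = b g" and \<epsilon>: "0 \<le> \<epsilon>"
  shows "norm (\<iota> a - \<iota> b) \<le> \<epsilon> * measure \<mu> L"
proof -
  note s = haar_sets[OF \<mu> \<alpha>] and fin = haar_compact[OF \<mu> \<alpha> L]
  have d: "(\<lambda>g. a g - b g) \<in> Cc" by (rule compactly_supported_diff[OF a b])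
  have cont: "continuous_on UNIV (\<lambda>g. norm (a g - b g))"
    using d by (auto simp: compactly_supported_def intro: continuous_on_norm)
  have int: "integrable \<mu> (\<lambda>g. norm (a g - b g))"
    by (rule integrable_compact_support[OF s fin L cont]) (use le(2) in auto)
  have "norm (\<iota> a - \<iota> b) = (\<integral>g. norm (a g - b g) \<partial>\<mu>)"
    using L1_norm[OF \<iota> d] L1_diff[OF a b] by simp
  then have "ennreal (norm (\<iota> a - \<iota> b)) = (\<integral>\<^sup>+g. norm (a g - b g) \<partial>\<mu>)"
    using int by (simp add: nn_integral_eq_integral)
  also have "\<dots> \<le> ennreal (\<epsilon> * measure \<mu> L)"
    by (rule nn_integral_norm_le_compact[OF s L fin]) (use le in auto)
  finally show ?thesis using \<epsilon> by (simp add: ennreal_le_iff)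
qed

text \<open>All estimates are uniform on one compact set \<open>L\<close> that is fixed before the
  bump function, so that a pointwise error of \<open>4 * \<delta>\<close> yields an L^1-error below
  \<epsilon>.\<close>

lemma L1_contractive_approx_identity:
  assumes lc: "locally_compact_space (euclidean :: 'g topology)"
    and cai: "has_contractive_approx_identity s TYPE('a)"
  shows "has_contractive_approx_identity s TYPE('l)"
proof (rule has_contractive_approx_identity_dense)
  show "closure (\<iota> ` Cc) = UNIV"
    using \<iota> by (simp add: is_L1_algebra_def is_completion_def)
  fix S :: "'l set" and \<epsilon> :: real assume S: "finite S" "S \<subseteq> \<iota> ` Cc" "0 < \<epsilon>"
  then obtain T where T: "T \<subseteq> Cc" "finite T" "S = \<iota> ` T"
    using finite_subset_image by metis
  note sets = haar_sets[OF \<mu> \<alpha>] and fin = haar_compact[OF \<mu> \<alpha>]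
  have "\<forall>a\<in>T. \<exists>K. compact K \<and> (\<forall>g. g \<notin> K \<longrightarrow> a g = 0)"
    using T(1) unfolding compactly_supported_def by blast
  then obtain K0 where K0: "\<And>a. a \<in> T \<Longrightarrow> compact (K0 a)" "\<And>a g. a \<in> T \<Longrightarrow> g \<notin> K0 a \<Longrightarrow> a g = 0" by metis
  define K where "K = (\<Union>a\<in>T. K0 a)"
  have K: "compact K" unfolding K_def using T(2) K0(1) by (intro compact_UN) auto
  have aK: "a g = 0" if "a \<in> T" "g \<notin> K" for a g using K0(2) that by (auto simp: K_def)
  have ac: "continuous_on UNIV a" if "a \<in> T" for a using that T(1) by (auto simp: compactly_supported_def)
  obtain U N where N: "open U" "(0::'g) \<in> U" "U \<subseteq> N" "compact N"
  proof -
    have "\<exists>U N. open U \<and> compact N \<and> (0::'g) \<in> U \<and> U \<subseteq> N" using lc by (simp add: locally_compact_space_def)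
    then show thesis using that by blast
  qed
  \<comment> \<open>Contains the supports of \<open>a\<close>, \<open>b * a\<close> and
    \<open>a * b\<close> for every \<open>b\<close> supported in \<open>N\<close>, where
    \<open>a\<close> ranges over \<open>T\<close>.\<close>
  define L where "L = K \<union> {x + y |x y. x \<in> N \<and> y \<in> K} \<union> {x + y |x y. x \<in> K \<and> y \<in> N}"
  have L: "compact L" unfolding L_def by (intro compact_Un compact_set_plus K N)
  define m where "m = measure \<mu> L + 1"
  \<comment> \<open>The pointwise error will be \<open>3 * \<delta>\<close> from the unit
    \<open>e\<close> and \<open>\<delta>\<close> from the bump function; 5 in place of 4 makes the
    final estimate strict.\<close>
  define \<delta> where "\<delta> = \<epsilon> / (5 * m)"
  have m: "0 < m" by (simp add: m_def add_nonneg_pos)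
  have \<delta>: "0 < \<delta>" using S(3) m by (simp add: \<delta>_def)
  \<comment> \<open>Multiplication from the right involves a(h) \<alpha>_h(e), which is \<alpha>_h
    applied to \<open>c a h * e\<close>; so \<open>e\<close> also has to be a right unit at the
    values of \<open>c a\<close>.\<close>
  define c where "c a g = \<alpha> (- g) (a g)" for a g
  have cc: "continuous_on UNIV (c a)" if "a \<in> T" for a
    unfolding c_def by (intro continuous_on_group_action[OF \<alpha>] continuous_intros ac[OF that])
  have "\<exists>Z. finite Z \<and> a ` L \<union> c a ` L \<subseteq> (\<Union>z\<in>Z. ball z \<delta>)" if a: "a \<in> T" for a
  proof -
    obtain Z1 where "finite Z1" "a ` L \<subseteq> (\<Union>z\<in>Z1. ball z \<delta>)" using compact_image_net[OF ac[OF a] L \<delta>] .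
    moreover obtain Z2 where "finite Z2" "c a ` L \<subseteq> (\<Union>z\<in>Z2. ball z \<delta>)" using compact_image_net[OF cc[OF a] L \<delta>] .
    ultimately show ?thesis by (intro exI[of _ "Z1 \<union> Z2"]) blast
  qed
  then obtain Z where Z: "\<And>a. a \<in> T \<Longrightarrow> finite (Z a)"
    "\<And>a. a \<in> T \<Longrightarrow> a ` L \<union> c a ` L \<subseteq> (\<Union>z\<in>Z a. ball z \<delta>)" by metis
  have "finite (\<Union>a\<in>T. Z a)" using Z(1) T(2) by blast
  then obtain e where e: "norm e \<le> 1" "\<And>z. z \<in> (\<Union>a\<in>T. Z a) \<Longrightarrow> approx_unit_at s e z \<delta>"
    using cai \<delta> unfolding has_contractive_approx_identity_iff by meson
  \<comment> \<open>The error \<delta> at a net point plus twice the distance \<delta> to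
    it.\<close>
  have eu: "approx_unit_at s e w (3 * \<delta>)" if a: "a \<in> T" and w: "w \<in> a ` L \<union> c a ` L" for a w
  proof -
    obtain z where z: "z \<in> Z a" "w \<in> ball z \<delta>" using Z(2)[OF a] w by blast
    have "approx_unit_at s e w (\<delta> + 2 * \<delta>)"
      by (rule approx_unit_at_perturb_right[OF e(2) e(1)])
         (use z a in \<open>auto simp: dist_norm norm_minus_commute\<close>)
    then show ?thesis by simp
  qed
  \<comment> \<open>The tube lemma at h = 0 over the compact set \<open>L\<close>. The first
    inequality serves multiplication from the left, the second multiplication from the
    right.\<close>
  have "\<exists>X. open X \<and> 0 \<in> X \<and> (\<forall>h\<in>X. \<forall>g\<in>L. norm (\<alpha> h (a (- h + g)) - a g) \<le> \<delta> \<and> norm (a (g + h) - a g) \<le> \<delta>)"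
    if a: "a \<in> T" for a
  proof -
    have c1: "continuous_on (UNIV \<times> L) (\<lambda>z. \<alpha> (fst z) (a (- fst z + snd z)))"
      by (rule continuous_on_subset[where s = UNIV], intro continuous_on_group_action[OF \<alpha>]
          continuous_on_compose2[OF ac[OF a]] continuous_intros subset_UNIV) simp
    obtain X where X: "0 \<in> X" "open X" "\<forall>h\<in>X \<inter> UNIV. \<forall>g\<in>L. dist (\<alpha> h (a (- h + g))) (\<alpha> 0 (a (- 0 + g))) \<le> \<delta>"
      using continuous_on_prod_compactE[OF c1 L UNIV_I \<delta>, of 0] unfolding fst_conv snd_conv by metis
    have c2: "continuous_on (UNIV \<times> L) (\<lambda>z. a (snd z + fst z))"
      by (rule continuous_on_subset[where s = UNIV], intro
          continuous_on_compose2[OF ac[OF a]] continuous_intros subset_UNIV) simp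
    obtain Y where Y: "0 \<in> Y" "open Y" "\<forall>h\<in>Y \<inter> UNIV. \<forall>g\<in>L. dist (a (g + h)) (a (g + 0)) \<le> \<delta>"
      using continuous_on_prod_compactE[OF c2 L UNIV_I \<delta>, of 0] unfolding fst_conv snd_conv by metis
    show ?thesis
      using X Y by (intro exI[of _ "X \<inter> Y"]) (auto simp: dist_norm group_action_simps[OF \<alpha>])
  qed
  then have "\<forall>a\<in>T. \<exists>X. open X \<and> 0 \<in> X \<and>
      (\<forall>h\<in>X. \<forall>g\<in>L. norm (\<alpha> h (a (- h + g)) - a g) \<le> \<delta> \<and> norm (a (g + h) - a g) \<le> \<delta>)" ..
  from bchoice[OF this] obtain X where X': "\<forall>a\<in>T. open (X a) \<and> 0 \<in> X a \<and>
      (\<forall>h\<in>X a. \<forall>g\<in>L. norm (\<alpha> h (a (- h + g)) - a g) \<le> \<delta> \<and> norm (a (g + h) - a g) \<le> \<delta>)" ..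
  then have X: "\<And>a. a \<in> T \<Longrightarrow> open (X a)" "\<And>a. a \<in> T \<Longrightarrow> 0 \<in> X a"
    "\<And>a h g. a \<in> T \<Longrightarrow> h \<in> X a \<Longrightarrow> g \<in> L \<Longrightarrow> norm (\<alpha> h (a (- h + g)) - a g) \<le> \<delta>"
    "\<And>a h g. a \<in> T \<Longrightarrow> h \<in> X a \<Longrightarrow> g \<in> L \<Longrightarrow> norm (a (g + h) - a g) \<le> \<delta>" by simp_all
  define W where "W = U \<inter> (\<Inter>a\<in>T. X a)"
  have W: "open W" "0 \<in> W" "W \<subseteq> N"
    unfolding W_def using X(1,2) N T(2) by (auto intro!: open_Int open_INT)
  obtain f :: "'g \<Rightarrow> real" where f: "continuous_on UNIV f" "\<And>h. 0 \<le> f h" "\<And>h. f (- h) = f h"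
    "\<And>h. h \<notin> W \<Longrightarrow> f h = 0" "(\<integral>h. f h \<partial>\<mu>) = 1"
    using symmetric_bump[OF \<mu> lc W(1,2,3) N(4)] by metis
  define b where "b h = f h *\<^sub>R e" for h
  have fN: "f h = 0" if "h \<notin> N" for h using f(4) W(3) that by blast
  have bN: "b h = 0" if "h \<notin> N" for h using fN that by (simp add: b_def)
  have bc: "continuous_on UNIV b" unfolding b_def by (intro continuous_intros f(1))
  have b: "b \<in> Cc" unfolding compactly_supported_def using bc bN N(4) by blast
  have "norm (\<iota> b) = (\<integral>h. f h * norm e \<partial>\<mu>)" using L1_norm[OF \<iota> b] f(2) by (simp add: b_def)
  also have "\<dots> = norm e" using f(5) by simp
  finally have nb: "norm (\<iota> b) \<le> 1" using e(1) by simp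
  have left: "norm (convolution \<mu> \<alpha> b a g - a g) \<le> 4 * \<delta>" if a: "a \<in> T" and g: "g \<in> L" and s: "s \<in> {Left, TwoSided}" for a g
  proof -
    let ?a = "\<lambda>h. \<alpha> h (a (- h + g))"
    show ?thesis
      unfolding convolution_def
      proof (rule bochner_value_near_constant[OF sets N(4) fin[OF N(4)] _ _ f(1) fN f(5,2)])
        show "continuous_on UNIV (\<lambda>h. b h * ?a h)"
          by (rule convolution_integrand_continuous(2)[OF \<mu> \<alpha> bc ac[OF a]])
        show "b h * ?a h = 0" if "h \<notin> N" for h using bN[OF that] by simp
        show "0 \<le> 4 * \<delta>" using \<delta> by simp
        fix h
        show "norm (b h * ?a h - f h *\<^sub>R a g) \<le> 4 * \<delta> * f h"
        proof (cases "h \<in> W")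
          case True
          have 1: "norm (e * a g - a g) \<le> 3 * \<delta>"
            using eu[OF a, of "a g"] g s by (auto simp: approx_unit_at_def)
          have 2: "norm (?a h - a g) \<le> \<delta>"
            using X(3)[OF a _ g] True a by (auto simp: W_def)
          have 3: "norm (e * (?a h - a g)) \<le> 1 * \<delta>"
            by (rule order_trans[OF norm_mult_ineq]) (intro mult_mono e(1) 2, auto)
          \<comment> \<open>Contractivity of \<open>e\<close> separates the translation error
            \<open>\<delta>\<close> from the unit error \<open>3 * \<delta>\<close>.\<close>
          have eq: "e * ?a h - a g = e * (?a h - a g) + (e * a g - a g)"
            by (simp add: algebra_simps)
          have 4: "norm (e * ?a h - a g) \<le> 4 * \<delta>"
            by (subst eq, rule norm_triangle_le) (use 1 3 in linarith)
          have "b h * ?a h - f h *\<^sub>R a g = f h *\<^sub>R (e * ?a h - a g)"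
            by (simp add: b_def scaleR_diff_right)
          then have "norm (b h * ?a h - f h *\<^sub>R a g) = f h * norm (e * ?a h - a g)"
            using f(2)[of h] by simp
          also have "\<dots> \<le> f h * (4 * \<delta>)" by (intro mult_left_mono 4 f(2))
          finally show ?thesis by (simp add: mult.commute)
        qed (simp add: b_def f(4))
      qed
  qed
  have right: "norm (convolution \<mu> \<alpha> a b g - a g) \<le> 4 * \<delta>" if a: "a \<in> T" and g: "g \<in> L" and s: "s \<in> {Right, TwoSided}" for a g
  proof -
    \<comment> \<open>Since -h + g = -(-g + h), symmetry turns the factor in the convolution into
      the left translate h |-> f(-g + h), whose integral is 1 by left invariance.\<close>
    have fg: "f (- h + g) = f (- g + h)" for h using f(3)[of "- g + h"] by (simp add: minus_add)
    let ?u = "\<lambda>h. f (- g + h)"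
    \<comment> \<open>The translate g + N carries the bump function and \<open>K\<close> carries
      \<open>a\<close>; the weight and the integrand both vanish outside the union.\<close>
    let ?C = "{x + y |x y. x \<in> {g} \<and> y \<in> N} \<union> K"
    have C: "compact ?C" by (intro compact_Un compact_set_plus K N(4)) simp
    have uC: "?u h = 0" if "h \<notin> ?C" for h
    proof (rule fN)
      show "- g + h \<notin> N"
      proof
        assume "- g + h \<in> N"
        then have "g + (- g + h) \<in> ?C" by blast
        then show False using that by (simp add: add.assoc[symmetric])
      qed
    qed
    have uc: "continuous_on UNIV ?u" by (intro continuous_on_compose2[OF f(1)] continuous_intros subset_UNIV)
    have u1: "(\<integral>h. ?u h \<partial>\<mu>) = 1" using integral_left_translate[OF \<mu> f(1), of "- g"] f(5) by simp
    show ?thesis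
      unfolding convolution_def
    proof (rule bochner_value_near_constant[OF sets C fin[OF C] _ _ uc uC u1 f(2)])
      show "continuous_on UNIV (\<lambda>h. a h * \<alpha> h (b (- h + g)))"
        by (rule convolution_integrand_continuous(2)[OF \<mu> \<alpha> ac[OF a] bc])
      show "a h * \<alpha> h (b (- h + g)) = 0" if "h \<notin> ?C" for h using aK[OF a, of h] that by simp
      show "0 \<le> 4 * \<delta>" using \<delta> by simp
      fix h
      show "norm (a h * \<alpha> h (b (- h + g)) - ?u h *\<^sub>R a g) \<le> 4 * \<delta> * ?u h"
      proof (cases "- g + h \<in> W")
        case True
        \<comment> \<open>Outside \<open>K\<close> both terms are 0. Inside, \<open>e\<close> is a
          unit at \<open>c a h\<close>, and the isometry \<alpha>_h carries the estimate to
          \<open>a h\<close>.\<close>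
        have "norm (c a h * e - c a h) \<le> 3 * \<delta>"
        proof (cases "h \<in> K")
          case True
          then show ?thesis using eu[OF a, of "c a h"] s by (auto simp: approx_unit_at_def L_def)
        next
          case False
          then show ?thesis using aK[OF a] \<delta> by (simp add: c_def group_action_simps[OF \<alpha>])
        qed
        moreover have "a h * \<alpha> h e - a h = \<alpha> h (c a h * e - c a h)"
          by (simp add: c_def group_action_simps[OF \<alpha>])
        ultimately have 1: "norm (a h * \<alpha> h e - a h) \<le> 3 * \<delta>"
          by (simp only: group_action_simps(7)[OF \<alpha>])
        have "- g + h \<in> X a" using True a by (auto simp: W_def)
        from X(4)[OF a this g] have 2: "norm (a h - a g) \<le> \<delta>" by (simp add: add.assoc[symmetric])
        have 4: "norm (a h * \<alpha> h e - a g) \<le> 4 * \<delta>"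
          using 1 2 norm_triangle_ineq[of "a h * \<alpha> h e - a h" "a h - a g"] by simp
        have "a h * \<alpha> h (b (- h + g)) - ?u h *\<^sub>R a g = ?u h *\<^sub>R (a h * \<alpha> h e - a g)"
          by (simp add: b_def fg scaleR_diff_right group_action_simps[OF \<alpha>])
        then have "norm (a h * \<alpha> h (b (- h + g)) - ?u h *\<^sub>R a g) = ?u h * norm (a h * \<alpha> h e - a g)"
          using f(2)[of "- g + h"] by simp
        also have "\<dots> \<le> ?u h * (4 * \<delta>)" by (intro mult_left_mono 4 f(2))
        finally show ?thesis by (simp add: mult.commute)
      qed (simp add: b_def fg f(4) group_action_simps[OF \<alpha>])
    qed
  qed
  have small: "4 * \<delta> * measure \<mu> L < \<epsilon>"
  proof -
    have "4 * \<delta> * measure \<mu> L \<le> 4 * \<delta> * m" using \<delta> by (simp add: m_def)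
    also have "\<dots> = 4 / 5 * \<epsilon>" using m by (simp add: \<delta>_def)
    also have "\<dots> < \<epsilon>" using S(3) by simp
    finally show ?thesis .
  qed
  have "approx_unit_at s (\<iota> b) (\<iota> a) \<epsilon>" if a: "a \<in> T" for a
  proof -
    let ?l = "convolution \<mu> \<alpha> b a" and ?r = "convolution \<mu> \<alpha> a b"
    have aV: "a \<in> Cc" using a T(1) by blast
    have c: "?l \<in> Cc" "?r \<in> Cc" by (intro convolution_compactly_supported[OF \<mu> \<alpha>] aV b)+
    have off: "?l g = a g" "?r g = a g" if g: "g \<notin> L" for g
    proof -
      have "a g = 0" using aK[OF a] g by (auto simp: L_def)
      moreover have "?l g = 0"
        by (rule convolution_support[OF \<mu> \<alpha> bN aK[OF a]]) (use g in \<open>auto simp: L_def\<close>)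
      moreover have "?r g = 0"
        by (rule convolution_support[OF \<mu> \<alpha> aK[OF a] bN]) (use g in \<open>auto simp: L_def\<close>)
      ultimately show "?l g = a g" "?r g = a g" by simp_all
    qed
    have "norm (\<iota> ?l - \<iota> a) < \<epsilon>" if s: "s \<in> {Left, TwoSided}"
      using L1_dist_le[OF c(1) aV L left[OF a _ s] off(1)] \<delta> small by simp
    moreover have "norm (\<iota> ?r - \<iota> a) < \<epsilon>" if s: "s \<in> {Right, TwoSided}"
      using L1_dist_le[OF c(2) aV L right[OF a _ s] off(2)] \<delta> small by simp
    ultimately show ?thesis unfolding approx_unit_at_def L1_mult[OF b aV] L1_mult[OF aV b] by blast
  qed
  with nb T(3) show "\<exists>e. norm e \<le> 1 \<and> (\<forall>a\<in>S. approx_unit_at s e a \<epsilon>)" by blast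
qed

end

section \<open>Direct sums of representations\<close>

text \<open>The disjoint union of copies of \<open>M\<close> that \<open>J\<close> embeds into one type. The index set may be
  uncountable, so this is not an instance of the library's product measure. Points outside the
  copies form a null set, where the value of \<open>glue\<close> is irrelevant.\<close>

definition sum_measure :: "'m measure \<Rightarrow> ('i \<Rightarrow> 'm \<Rightarrow> 'y) \<Rightarrow> 'y measure" where
  "sum_measure M J = measure_of UNIV {B. \<forall>i. J i -` B \<inter> space M \<in> sets M}
    (\<lambda>B. \<integral>\<^sup>+i. emeasure M (J i -` B \<inter> space M) \<partial>count_space UNIV)"

definition glue :: "('i \<Rightarrow> 'm \<Rightarrow> 'y) \<Rightarrow> ('i \<Rightarrow> 'm \<Rightarrow> 'b) \<Rightarrow> 'y \<Rightarrow> 'b" where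
  "glue J F y = (THE z. \<exists>i m. y = J i m \<and> z = F i m)"

lemma sum_sets_algebra: "sigma_algebra UNIV {B. \<forall>i. J i -` B \<inter> space M \<in> sets M}"
proof (rule sigma_algebra_iff2[THEN iffD2], intro conjI ballI allI impI)
  fix B assume "B \<in> {B. \<forall>i. J i -` B \<inter> space M \<in> sets M}"
  moreover have "J i -` (UNIV - B) \<inter> space M = space M - (J i -` B \<inter> space M)" for i by auto
  ultimately show "UNIV - B \<in> {B. \<forall>i. J i -` B \<inter> space M \<in> sets M}" by auto
next
  fix A :: "nat \<Rightarrow> _" assume A: "range A \<subseteq> {B. \<forall>i. J i -` B \<inter> space M \<in> sets M}"
  have "(\<Union>n. J i -` A n \<inter> space M) \<in> sets M" for i using A by (intro sets.countable_UN) auto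
  moreover have "J i -` (\<Union>n. A n) \<inter> space M = (\<Union>n. J i -` A n \<inter> space M)" for i by auto
  ultimately show "(\<Union>n. A n) \<in> {B. \<forall>i. J i -` B \<inter> space M \<in> sets M}" by (simp only: mem_Collect_eq) blast
qed auto

lemma space_sum_measure [simp]: "space (sum_measure M J) = UNIV"
  by (simp add: sum_measure_def)

lemma sets_sum_measure: "sets (sum_measure M J) = {B. \<forall>i. J i -` B \<inter> space M \<in> sets M}"
  unfolding sum_measure_def by (rule sigma_algebra.sets_measure_of_eq[OF sum_sets_algebra])

lemma sets_sum_measureI: "(\<And>i. J i -` B \<inter> space M \<in> sets M) \<Longrightarrow> B \<in> sets (sum_measure M J)"
  unfolding sets_sum_measure by blast

lemma sets_sum_measureD: "B \<in> sets (sum_measure M J) \<Longrightarrow> J i -` B \<inter> space M \<in> sets M"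
  unfolding sets_sum_measure by blast

text \<open>Summation over the index set is an integral against \<open>count_space\<close>, which
  allows uncountable index sets and can be exchanged with the series in countable
  additivity.\<close>

lemma emeasure_sum_measure:
  assumes "B \<in> sets (sum_measure M J)"
  shows "emeasure (sum_measure M J) B = (\<integral>\<^sup>+i. emeasure M (J i -` B \<inter> space M) \<partial>count_space UNIV)"
  unfolding sum_measure_def
proof (rule emeasure_measure_of_sigma[OF sum_sets_algebra])
  show "positive {B. \<forall>i. J i -` B \<inter> space M \<in> sets M}
      (\<lambda>B. \<integral>\<^sup>+i. emeasure M (J i -` B \<inter> space M) \<partial>count_space UNIV)"
    by (simp add: positive_def)
  show "countably_additive {B. \<forall>i. J i -` B \<inter> space M \<in> sets M}
      (\<lambda>B. \<integral>\<^sup>+i. emeasure M (J i -` B \<inter> space M) \<partial>count_space UNIV)"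
  proof (rule countably_additiveI)
    fix A :: "nat \<Rightarrow> _" assume A: "range A \<subseteq> {B. \<forall>i. J i -` B \<inter> space M \<in> sets M}" "disjoint_family A"
    have "(\<Sum>n. emeasure M (J i -` A n \<inter> space M)) = emeasure M (\<Union>n. J i -` A n \<inter> space M)" for i
    proof (rule suminf_emeasure)
      show "range (\<lambda>n. J i -` A n \<inter> space M) \<subseteq> sets M" using A(1) by auto
      have "A m \<inter> A n = {}" if "m \<noteq> n" for m n using A(2) that by (simp add: disjoint_family_on_def)
      then show "disjoint_family (\<lambda>n. J i -` A n \<inter> space M)" unfolding disjoint_family_on_def by blast
    qed
    moreover have "(\<Union>n. J i -` A n \<inter> space M) = J i -` (\<Union>n. A n) \<inter> space M" for i by auto
    ultimately show "(\<Sum>n. \<integral>\<^sup>+i. emeasure M (J i -` A n \<inter> space M) \<partial>count_space UNIV) =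
        (\<integral>\<^sup>+i. emeasure M (J i -` (\<Union>n. A n) \<inter> space M) \<partial>count_space UNIV)"
      by (subst nn_integral_suminf[symmetric]) auto
  qed
  show "B \<in> {B. \<forall>i. J i -` B \<inter> space M \<in> sets M}" using assms unfolding sets_sum_measure .
qed

lemma measurable_sum_section [measurable]: "J i \<in> measurable M (sum_measure M J)"
  by (rule measurableI) (auto dest: sets_sum_measureD)

lemma borel_measurable_sum_iff:
  "f \<in> borel_measurable (sum_measure M J) \<longleftrightarrow> (\<forall>i. (\<lambda>m. f (J i m)) \<in> borel_measurable M)"
proof
  assume f: "f \<in> borel_measurable (sum_measure M J)"
  show "\<forall>i. (\<lambda>m. f (J i m)) \<in> borel_measurable M"
    using measurable_compose[OF measurable_sum_section f] by blast
next
  assume f: "\<forall>i. (\<lambda>m. f (J i m)) \<in> borel_measurable M"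
  show "f \<in> borel_measurable (sum_measure M J)"
  proof (rule measurableI)
    fix B :: "'b set" assume "B \<in> sets borel"
    then have "(\<lambda>m. f (J i m)) -` B \<inter> space M \<in> sets M" for i using f measurable_sets by blast
    moreover have "J i -` (f -` B \<inter> UNIV) = (\<lambda>m. f (J i m)) -` B" for i by auto
    ultimately show "f -` B \<inter> space (sum_measure M J) \<in> sets (sum_measure M J)"
      unfolding space_sum_measure by (intro sets_sum_measureI) (simp only:)
  qed simp
qed

lemma borel_measurable_sumD:
  "f \<in> borel_measurable (sum_measure M J) \<Longrightarrow> (\<lambda>m. f (J i m)) \<in> borel_measurable M"
  by (rule measurable_compose[OF measurable_sum_section])

text \<open>Tonelli's theorem for the disjoint union, without sigma-finiteness: each step of the
  induction on \<open>f\<close> commutes with the outer sum.\<close>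

lemma nn_integral_sum_measure:
  assumes "f \<in> borel_measurable (sum_measure M J)"
  shows "(\<integral>\<^sup>+y. f y \<partial>sum_measure M J) = (\<integral>\<^sup>+i. (\<integral>\<^sup>+m. f (J i m) \<partial>M) \<partial>count_space UNIV)"
  using assms
proof (induct f rule: borel_measurable_induct)
  case (cong f g)
  then have "f = g" by (auto simp: fun_eq_iff)
  then show ?case using cong by simp
next
  case (set A)
  have "(\<integral>\<^sup>+m. indicator A (J i m) \<partial>M) = emeasure M (J i -` A \<inter> space M)" for i
  proof -
    have "(\<integral>\<^sup>+m. indicator A (J i m) \<partial>M) = (\<integral>\<^sup>+m. indicator (J i -` A \<inter> space M) m \<partial>M)"
      by (intro nn_integral_cong) (auto simp: indicator_def)
    also have "\<dots> = emeasure M (J i -` A \<inter> space M)"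
      by (rule nn_integral_indicator) (rule sets_sum_measureD[OF set])
    finally show ?thesis .
  qed
  then show ?case using set by (simp add: emeasure_sum_measure)
next
  case (mult u c)
  have "(\<lambda>m. u (J i m)) \<in> borel_measurable M" for i by (rule borel_measurable_sumD[OF mult(2)])
  then show ?case using mult by (simp add: nn_integral_cmult)
next
  case (add u v)
  have "(\<lambda>m. u (J i m)) \<in> borel_measurable M" "(\<lambda>m. v (J i m)) \<in> borel_measurable M" for i
    by (rule borel_measurable_sumD[OF add(1)], rule borel_measurable_sumD[OF add(4)])
  then show ?case using add by (simp add: nn_integral_add)
next
  case (seq U)
  have m: "(\<lambda>m. U n (J i m)) \<in> borel_measurable M" for i n by (rule borel_measurable_sumD[OF seq(1)])
  have "(\<integral>\<^sup>+y. (SUP n. U n) y \<partial>sum_measure M J) = (SUP n. \<integral>\<^sup>+y. U n y \<partial>sum_measure M J)"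
    using nn_integral_monotone_convergence_SUP[OF seq(4) seq(1)] by (simp add: SUP_apply image_image)
  also have "\<dots> = (SUP n. \<integral>\<^sup>+i. (\<integral>\<^sup>+m. U n (J i m) \<partial>M) \<partial>count_space UNIV)" using seq by simp
  also have "\<dots> = (\<integral>\<^sup>+i. (SUP n. \<integral>\<^sup>+m. U n (J i m) \<partial>M) \<partial>count_space UNIV)"
    using seq(4) by (intro nn_integral_monotone_convergence_SUP[symmetric])
      (auto simp: incseq_def le_fun_def intro!: nn_integral_mono)
  also have "\<dots> = (\<integral>\<^sup>+i. (\<integral>\<^sup>+m. (SUP n. U n (J i m)) \<partial>M) \<partial>count_space UNIV)"
    using seq(4) m by (intro nn_integral_cong nn_integral_monotone_convergence_SUP[symmetric])
      (auto simp: incseq_def le_fun_def)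
  finally show ?case by (simp add: SUP_apply image_image)
qed

section \<open>L^p-spaces of disjoint unions\<close>

lemma Lp_iff_nn_integral:
  "f \<in> Lp p M \<longleftrightarrow> f \<in> borel_measurable M \<and> (\<integral>\<^sup>+x. ennreal (cmod (f x) powr p) \<partial>M) < \<infinity>"
  by (auto simp: Lp_def integrable_iff_bounded)

lemma Lp_nn_integral:
  assumes "1 \<le> p" "f \<in> Lp p M"
  shows "(\<integral>\<^sup>+x. ennreal (cmod (f x) powr p) \<partial>M) = ennreal (Lp_norm p M f powr p)"
  unfolding Lp_norm_powr[OF assms(1)]
  by (rule nn_integral_eq_integral[OF Lp_integrable[OF assms(2)]]) simp

lemma Lp_sum_section:
  assumes f: "f \<in> Lp p (sum_measure M J)"
  shows "(\<lambda>m. f (J i m)) \<in> Lp p M"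
proof -
  have fm: "(\<lambda>y. ennreal (cmod (f y) powr p)) \<in> borel_measurable (sum_measure M J)"
    using f by (auto dest: Lp_measurable)
  have "(\<integral>\<^sup>+m. ennreal (cmod (f (J i m)) powr p) \<partial>M) \<le> (\<integral>\<^sup>+y. ennreal (cmod (f y) powr p) \<partial>sum_measure M J)"
    unfolding nn_integral_sum_measure[OF fm] by (rule nn_integral_ge_point) simp
  then show ?thesis
    using f by (auto simp: Lp_iff_nn_integral borel_measurable_sum_iff dest: le_less_trans)
qed

context
  fixes p :: real
  assumes p: "1 \<le> p"
begin

lemma Lp_sum_norm:
  assumes f: "f \<in> Lp p (sum_measure M J)"
  shows "(\<integral>\<^sup>+i. ennreal (Lp_norm p M (\<lambda>m. f (J i m)) powr p) \<partial>count_space UNIV) =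
    ennreal (Lp_norm p (sum_measure M J) f powr p)"
proof -
  have fm: "(\<lambda>y. ennreal (cmod (f y) powr p)) \<in> borel_measurable (sum_measure M J)"
    using f by (auto dest: Lp_measurable)
  show ?thesis
    using nn_integral_sum_measure[OF fm] Lp_nn_integral[OF p f] Lp_nn_integral[OF p Lp_sum_section[OF f]] by simp
qed

lemma Lp_sumI:
  assumes s: "\<And>i. (\<lambda>m. f (J i m)) \<in> Lp p M"
    and le: "(\<integral>\<^sup>+i. ennreal (Lp_norm p M (\<lambda>m. f (J i m)) powr p) \<partial>count_space UNIV) \<le> ennreal (C powr p)"
    and C: "0 \<le> C"
  shows "f \<in> Lp p (sum_measure M J)" "Lp_norm p (sum_measure M J) f \<le> C"
proof -
  have fm: "f \<in> borel_measurable (sum_measure M J)"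
    unfolding borel_measurable_sum_iff using s Lp_measurable by blast
  then have fm': "(\<lambda>y. ennreal (cmod (f y) powr p)) \<in> borel_measurable (sum_measure M J)" by auto
  have e: "(\<integral>\<^sup>+y. ennreal (cmod (f y) powr p) \<partial>sum_measure M J) \<le> ennreal (C powr p)"
    using le unfolding nn_integral_sum_measure[OF fm'] Lp_nn_integral[OF p s] .
  then show f: "f \<in> Lp p (sum_measure M J)"
    using fm by (auto simp: Lp_iff_nn_integral intro: le_less_trans)
  have "Lp_norm p (sum_measure M J) f powr p \<le> C powr p"
    using e Lp_nn_integral[OF p f] by simp
  then show "Lp_norm p (sum_measure M J) f \<le> C"
    using p C powr_less_mono2[of p C "Lp_norm p (sum_measure M J) f"] by (meson less_le_trans linorder_not_le zero_less_one)
qed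

lemma Lp_sum_section_norm_le:
  assumes f: "f \<in> Lp p (sum_measure M J)"
  shows "Lp_norm p M (\<lambda>m. f (J i m)) \<le> Lp_norm p (sum_measure M J) f"
proof -
  have "ennreal (Lp_norm p M (\<lambda>m. f (J i m)) powr p) \<le> ennreal (Lp_norm p (sum_measure M J) f powr p)"
    unfolding Lp_sum_norm[OF f, symmetric] by (rule nn_integral_ge_point) simp
  then have "Lp_norm p M (\<lambda>m. f (J i m)) powr p \<le> Lp_norm p (sum_measure M J) f powr p" by simp
  then show ?thesis
    using p powr_less_mono2[of p "Lp_norm p (sum_measure M J) f" "Lp_norm p M (\<lambda>m. f (J i m))"]
    by (meson Lp_norm_nonneg less_le_trans linorder_not_le zero_less_one)
qed

lemma Lp_sum_integrable:
  assumes f: "f \<in> Lp p (sum_measure M J)"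
  shows "integrable (count_space UNIV) (\<lambda>i. Lp_norm p M (\<lambda>m. f (J i m)) powr p)"
    and "(\<integral>i. Lp_norm p M (\<lambda>m. f (J i m)) powr p \<partial>count_space UNIV) = Lp_norm p (sum_measure M J) f powr p"
proof -
  show "integrable (count_space UNIV) (\<lambda>i. Lp_norm p M (\<lambda>m. f (J i m)) powr p)"
    using Lp_sum_norm[OF f] by (simp add: integrable_iff_bounded)
  show "(\<integral>i. Lp_norm p M (\<lambda>m. f (J i m)) powr p \<partial>count_space UNIV) = Lp_norm p (sum_measure M J) f powr p"
    using Lp_sum_norm[OF f] by (simp add: integral_eq_nn_integral)
qed

end

text \<open>Integrability against counting measure is absolute summability, and finite partial sums
  come close to the total even over an uncountable index set.\<close>

lemma integrable_count_space_tail: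
  fixes h :: "'i \<Rightarrow> real"
  assumes h: "integrable (count_space UNIV) h" "\<And>i. 0 \<le> h i" and e: "0 < e"
  obtains F where "finite F" "(\<integral>\<^sup>+i. ennreal (if i \<in> F then 0 else h i) \<partial>count_space UNIV) \<le> ennreal e"
proof -
  have abs: "Infinite_Set_Sum.abs_summable_on h UNIV" using h by (simp add: abs_summable_on_def)
  then have "h summable_on UNIV" using abs_summable_equivalent abs_summable_summable by blast
  then obtain F where F: "finite F" "dist (sum h F) (infsum h UNIV) \<le> e"
    using infsum_finite_approximation[of h UNIV e] e by blast
  have tot: "(\<integral>i. h i \<partial>count_space UNIV) = infsum h UNIV"
    using infsetsum_infsum[OF abs] by (simp add: infsetsum_def)
  have iF: "integrable (count_space UNIV) (\<lambda>i. if i \<in> F then h i else 0)"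
    by (rule Bochner_Integration.integrable_bound[OF h(1)]) auto
  have "(\<integral>i. (if i \<in> F then h i else 0) \<partial>count_space UNIV) = (\<Sum>i\<in>F. h i)"
  proof -
    have "finite {i. (if i \<in> F then h i else 0) \<noteq> 0}" using F(1) by (rule finite_subset[rotated]) auto
    then have "(\<integral>i. (if i \<in> F then h i else 0) \<partial>count_space UNIV) =
        (\<Sum>i | i \<in> UNIV \<and> (if i \<in> F then h i else 0) \<noteq> 0. if i \<in> F then h i else 0)"
      by (intro lebesgue_integral_count_space_finite_support) simp
    also have "\<dots> = (\<Sum>i\<in>F. h i)" using F(1) by (intro sum.mono_neutral_cong_left) auto
    finally show ?thesis .
  qed
  moreover have eq: "(if i \<in> F then 0 else h i) = h i - (if i \<in> F then h i else 0)" for i by simp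
  ultimately have "(\<integral>i. (if i \<in> F then 0 else h i) \<partial>count_space UNIV) = infsum h UNIV - sum h F"
    using h(1) iF tot by (simp only: eq Bochner_Integration.integral_diff)
  also have "\<dots> \<le> e" using F(2) by (simp add: dist_real_def)
  finally have "(\<integral>i. (if i \<in> F then 0 else h i) \<partial>count_space UNIV) \<le> e" .
  moreover have "integrable (count_space UNIV) (\<lambda>i. if i \<in> F then 0 else h i)"
    unfolding eq using h(1) iF by (intro Bochner_Integration.integrable_diff)
  ultimately have "(\<integral>\<^sup>+i. ennreal (if i \<in> F then 0 else h i) \<partial>count_space UNIV) \<le> ennreal e"
    using h(2) by (subst nn_integral_eq_integral) (auto intro: ennreal_leI)
  then show thesis using that F(1) by blast
qed

section \<open>Contractivity and nondegeneracy of direct sums\<close>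

lemma nondegenerate_repD:
  assumes "nondegenerate_rep p M \<pi>" "f \<in> Lp p M" "0 < \<epsilon>"
  shows "\<exists>n::nat. \<exists>a \<xi>. (\<forall>i<n. \<xi> i \<in> Lp p M) \<and> Lp_norm p M (\<lambda>x. f x - (\<Sum>i<n. \<pi> (a i) (\<xi> i) x)) < \<epsilon>"
  using assms(1)[unfolded nondegenerate_rep_def, rule_format, OF assms(2,3)] .

text \<open>In a direct sum the approximating terms are naturally indexed by pairs (summand,
  position); enumerating the pairs gives the initial segment that \<open>nondegenerate_rep\<close>
  demands.\<close>

lemma nondegenerate_repI:
  assumes "\<And>f \<epsilon>. f \<in> Lp p M \<Longrightarrow> 0 < \<epsilon> \<Longrightarrow> \<exists>(I :: ('k \<times> nat) set) a \<xi>. finite I \<and> (\<forall>i\<in>I. \<xi> i \<in> Lp p M) \<and>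
    Lp_norm p M (\<lambda>x. f x - (\<Sum>i\<in>I. \<pi> (a i) (\<xi> i) x)) < \<epsilon>"
  shows "nondegenerate_rep p M \<pi>"
  unfolding nondegenerate_rep_def
proof (intro ballI allI impI)
  fix f and \<epsilon> :: real assume "f \<in> Lp p M" "0 < \<epsilon>"
  from assms[OF this] obtain I :: "('k \<times> nat) set" and a \<xi> where I: "finite I" "\<forall>i\<in>I. \<xi> i \<in> Lp p M"
    "Lp_norm p M (\<lambda>x. f x - (\<Sum>i\<in>I. \<pi> (a i) (\<xi> i) x)) < \<epsilon>"
    by (elim exE conjE) (rule that)
  obtain h where h: "bij_betw h {0..<card I} I" using ex_bij_betw_nat_finite[OF I(1)] by blast
  have h': "bij_betw h {..<card I} I" using h by (simp add: atLeast0LessThan)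
  have eq: "(\<Sum>i\<in>I. \<pi> (a i) (\<xi> i) x) = (\<Sum>i<card I. \<pi> (a (h i)) (\<xi> (h i)) x)" for x
    by (rule sum.reindex_bij_betw[OF h', symmetric])
  show "\<exists>n::nat. \<exists>a \<xi>. (\<forall>i<n. \<xi> i \<in> Lp p M) \<and> Lp_norm p M (\<lambda>x. f x - (\<Sum>i<n. \<pi> (a i) (\<xi> i) x)) < \<epsilon>"
    by (rule exI[of _ "card I"], rule exI[of _ "\<lambda>i. a (h i)"], rule exI[of _ "\<lambda>i. \<xi> (h i)"])
       (use I(2) I(3)[unfolded eq] bij_betwE[OF h'] in auto)
qed

definition sum_rep :: "('i \<Rightarrow> 'm \<Rightarrow> 'y) \<Rightarrow> ('i \<Rightarrow> 'a \<Rightarrow> 'm opr) \<Rightarrow> 'a \<Rightarrow> 'y opr" where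
  "sum_rep J \<rho> a f = glue J (\<lambda>i. \<rho> i a (\<lambda>m. f (J i m)))"

text \<open>The axioms of a representation hold up to null sets, so these equations hold almost
  everywhere; contractivity gives norm 0.\<close>

lemma rep_zero:
  assumes p: "1 \<le> p" and \<pi>: "contractive_rep p M \<pi>"
  shows "AE m in M. \<pi> a (\<lambda>_. 0) m = 0" "f \<in> Lp p M \<Longrightarrow> AE m in M. \<pi> 0 f m = 0"
proof -
  have z: "(\<lambda>_. 0) \<in> Lp p M" using p by simp
  have "Lp_norm p M (\<pi> a (\<lambda>_. 0)) = 0"
    using contractive_rep_bound[OF p \<pi> z, of a] p by (simp add: order_antisym)
  then show "AE m in M. \<pi> a (\<lambda>_. 0) m = 0"
    by (rule Lp_norm_eq_0_AE[OF p bounded_operator_Lp[OF contractive_rep_bounded[OF \<pi>] z]])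
  assume f: "f \<in> Lp p M"
  have "Lp_norm p M (\<pi> 0 f) = 0"
    using contractive_rep_bound[OF p \<pi> f, of 0] by (simp add: order_antisym)
  then show "AE m in M. \<pi> 0 f m = 0"
    by (rule Lp_norm_eq_0_AE[OF p bounded_operator_Lp[OF contractive_rep_bounded[OF \<pi>] f]])
qed

context
  fixes J :: "'i \<Rightarrow> 'm \<Rightarrow> 'y"
  assumes J: "inj (case_prod J)"
begin

lemma sum_injD: "J i m = J i' m' \<Longrightarrow> i = i' \<and> m = m'"
  using injD[OF J, of "(i, m)" "(i', m')"] by simp

lemma glue_apply [simp]: "glue J F (J i m) = F i m"
  unfolding glue_def by (rule the_equality) (auto dest: sum_injD)

lemma sum_rep_section: "sum_rep J \<rho> a f (J i m) = \<rho> i a (\<lambda>m. f (J i m)) m"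
  by (simp add: sum_rep_def)

lemma AE_sum_measureI:
  assumes "\<And>i. AE m in M. P (J i m)"
  shows "AE y in sum_measure M J. P y"
proof -
  have "\<forall>i. \<exists>N. N \<in> null_sets M \<and> {m\<in>space M. \<not> P (J i m)} \<subseteq> N"
    using assms unfolding eventually_ae_filter by blast
  then obtain N where N: "\<And>i. N i \<in> null_sets M" "\<And>i. {m\<in>space M. \<not> P (J i m)} \<subseteq> N i" by metis
  \<comment> \<open>Points outside all copies belong to \<open>B\<close> vacuously.\<close>
  define B where "B = {y. \<forall>i m. m \<in> space M \<longrightarrow> y = J i m \<longrightarrow> m \<in> N i}"
  have sec: "J i -` B \<inter> space M = N i" for i
    using sets.sets_into_space[of "N i" M] N(1) by (auto simp: B_def null_sets_def dest: sum_injD)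
  have Bs: "B \<in> sets (sum_measure M J)" by (rule sets_sum_measureI, unfold sec) (use N(1) in blast)
  moreover have "emeasure (sum_measure M J) B = 0"
    using N(1) by (simp add: emeasure_sum_measure[OF Bs] sec null_sets_def)
  moreover have "{y \<in> space (sum_measure M J). \<not> P y} \<subseteq> B" using N(2) by (auto simp: B_def)
  ultimately show ?thesis by (intro AE_I)
qed

context
  fixes p :: real and M :: "'m measure" and \<rho> :: "'i \<Rightarrow> 'a::complex_banach_algebra \<Rightarrow> 'm opr"
  assumes p: "1 \<le> p" and \<rho>: "\<And>i. contractive_rep p M (\<rho> i)"
begin

abbreviation (input) "sumJ \<equiv> sum_measure M J"

lemma sum_rep_Lp:
  assumes f: "f \<in> Lp p sumJ"
  shows "sum_rep J \<rho> a f \<in> Lp p sumJ"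
    and "Lp_norm p sumJ (sum_rep J \<rho> a f) \<le> norm a * Lp_norm p sumJ f"
proof -
  have s: "(\<lambda>m. sum_rep J \<rho> a f (J i m)) \<in> Lp p M" for i
    unfolding sum_rep_section
    using bounded_operator_Lp[OF contractive_rep_bounded[OF \<rho>] Lp_sum_section[OF f]] .
  have "(\<integral>\<^sup>+i. ennreal (Lp_norm p M (\<lambda>m. sum_rep J \<rho> a f (J i m)) powr p) \<partial>count_space UNIV) \<le>
      (\<integral>\<^sup>+i. ennreal (norm a powr p) * ennreal (Lp_norm p M (\<lambda>m. f (J i m)) powr p) \<partial>count_space UNIV)"
  proof (rule nn_integral_mono)
    fix i
    have "Lp_norm p M (\<lambda>m. sum_rep J \<rho> a f (J i m)) powr p \<le> (norm a * Lp_norm p M (\<lambda>m. f (J i m))) powr p"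
      unfolding sum_rep_section using p contractive_rep_bound[OF p \<rho> Lp_sum_section[OF f]]
      by (intro powr_mono2) auto
    then show "ennreal (Lp_norm p M (\<lambda>m. sum_rep J \<rho> a f (J i m)) powr p) \<le>
        ennreal (norm a powr p) * ennreal (Lp_norm p M (\<lambda>m. f (J i m)) powr p)"
      by (simp add: powr_mult ennreal_mult[symmetric] ennreal_leI)
  qed
  also have "\<dots> = ennreal ((norm a * Lp_norm p sumJ f) powr p)"
    by (simp add: nn_integral_cmult Lp_sum_norm[OF p f] powr_mult ennreal_mult)
  finally show "sum_rep J \<rho> a f \<in> Lp p sumJ"
    "Lp_norm p sumJ (sum_rep J \<rho> a f) \<le> norm a * Lp_norm p sumJ f"
    by (auto intro!: Lp_sumI[OF p, where J = J, OF s])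
qed

lemma sum_rep_contractive: "contractive_rep p sumJ (sum_rep J \<rho>)"
proof -
  have alg: "algebra_rep p M (\<rho> i)" for i using \<rho> by (simp add: contractive_rep_def)
  have b: "bounded_operator p sumJ (sum_rep J \<rho> a)" for a
    unfolding bounded_operator_def
  proof (intro conjI ballI allI)
    fix f g assume f: "f \<in> Lp p sumJ" and g: "g \<in> Lp p sumJ"
    show "ae_eq sumJ (sum_rep J \<rho> a (\<lambda>x. f x + g x)) (\<lambda>x. sum_rep J \<rho> a f x + sum_rep J \<rho> a g x)"
      unfolding ae_eq_def
      by (rule AE_sum_measureI, unfold sum_rep_section)
         (use bounded_operator_add[OF contractive_rep_bounded[OF \<rho>] Lp_sum_section[OF f] Lp_sum_section[OF g]]
           in \<open>simp add: ae_eq_def\<close>)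
  next
    fix c f assume f: "f \<in> Lp p sumJ"
    show "ae_eq sumJ (sum_rep J \<rho> a (\<lambda>x. c * f x)) (\<lambda>x. c * sum_rep J \<rho> a f x)"
      unfolding ae_eq_def
      by (rule AE_sum_measureI, unfold sum_rep_section)
         (use contractive_rep_bounded[OF \<rho>] Lp_sum_section[OF f] in \<open>auto simp: ae_eq_def bounded_operator_def\<close>)
  next
    show "\<exists>C. \<forall>f\<in>Lp p sumJ.
        Lp_norm p sumJ (sum_rep J \<rho> a f) \<le> C * Lp_norm p sumJ f"
      using sum_rep_Lp(2) by blast
  qed (rule sum_rep_Lp(1))
  have "algebra_rep p sumJ (sum_rep J \<rho>)"
    unfolding algebra_rep_def
  proof (intro conjI ballI allI b)
    fix f a b c assume f: "f \<in> Lp p sumJ"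
    note alg' = alg[unfolded algebra_rep_def ae_eq_def] and s = Lp_sum_section[OF f]
    show "ae_eq sumJ (sum_rep J \<rho> (a + b) f) (\<lambda>x. sum_rep J \<rho> a f x + sum_rep J \<rho> b f x)"
      unfolding ae_eq_def by (rule AE_sum_measureI, unfold sum_rep_section) (use alg' s in blast)
    show "ae_eq sumJ (sum_rep J \<rho> (c *\<^sub>C a) f) (\<lambda>x. c * sum_rep J \<rho> a f x)"
      unfolding ae_eq_def by (rule AE_sum_measureI, unfold sum_rep_section) (use alg' s in blast)
    show "ae_eq sumJ (sum_rep J \<rho> (a * b) f) (sum_rep J \<rho> a (sum_rep J \<rho> b f))"
      unfolding ae_eq_def by (rule AE_sum_measureI, unfold sum_rep_section) (use alg' s in blast)
  qed
  moreover have "operator_norm p sumJ (sum_rep J \<rho> a) \<le> norm a" for a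
    unfolding operator_norm_def
  proof (rule cSup_least)
    have "(\<lambda>_. 0) \<in> Lp p sumJ" "Lp_norm p sumJ (\<lambda>_. 0) \<le> 1" using p by simp_all
    then show "{Lp_norm p sumJ (sum_rep J \<rho> a f) |f.
        f \<in> Lp p sumJ \<and> Lp_norm p sumJ f \<le> 1} \<noteq> {}" by blast
    fix r assume "r \<in> {Lp_norm p sumJ (sum_rep J \<rho> a f) |f.
        f \<in> Lp p sumJ \<and> Lp_norm p sumJ f \<le> 1}"
    then obtain f where f: "r = Lp_norm p sumJ (sum_rep J \<rho> a f)"
      "f \<in> Lp p sumJ" "Lp_norm p sumJ f \<le> 1" by blast
    have "r \<le> norm a * Lp_norm p sumJ f" using sum_rep_Lp(2)[OF f(2)] f(1) by simp
    also have "\<dots> \<le> norm a * 1" using f(3) by (intro mult_left_mono) auto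
    finally show "r \<le> norm a" by simp
  qed
  ultimately show ?thesis by (simp add: contractive_rep_def)
qed

lemma Lp_glue_single:
  assumes \<xi>: "\<xi> \<in> Lp p M"
  shows "glue J (\<lambda>j m. if j = i then \<xi> m else 0) \<in> Lp p sumJ"
    and "Lp_norm p sumJ (glue J (\<lambda>j m. if j = i then \<xi> m else 0)) \<le> Lp_norm p M \<xi>"
proof -
  let ?f = "glue J (\<lambda>j m. if j = i then \<xi> m else 0)"
  have s: "(\<lambda>m. ?f (J j m)) = (if j = i then \<xi> else (\<lambda>_. 0))" for j by auto
  have sL: "(\<lambda>m. ?f (J j m)) \<in> Lp p M" for j unfolding s using \<xi> p by simp
  have "(\<integral>\<^sup>+j. ennreal (Lp_norm p M (\<lambda>m. ?f (J j m)) powr p) \<partial>count_space UNIV) =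
      (\<Sum>j\<in>{i}. ennreal (Lp_norm p M (\<lambda>m. ?f (J j m)) powr p))"
    by (rule nn_integral_count_space') (use p in \<open>auto simp: s\<close>)
  then have "(\<integral>\<^sup>+j. ennreal (Lp_norm p M (\<lambda>m. ?f (J j m)) powr p) \<partial>count_space UNIV) \<le>
      ennreal (Lp_norm p M \<xi> powr p)" by simp
  then show "?f \<in> Lp p sumJ" "Lp_norm p sumJ ?f \<le> Lp_norm p M \<xi>"
    by (auto intro!: Lp_sumI[OF p, where J = J, OF sL])
qed

text \<open>Finitely many fibres carry almost all of \<open>f\<close>; nondegeneracy is applied in
  each of them, and the remaining fibres are approximated by 0.\<close>

lemma sum_rep_nondegenerate:
  assumes nd: "\<And>i. nondegenerate_rep p M (\<rho> i)"
  shows "nondegenerate_rep p sumJ (sum_rep J \<rho>)"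
proof (rule nondegenerate_repI)
  fix f and \<epsilon> :: real assume f: "f \<in> Lp p sumJ" and \<epsilon>: "0 < \<epsilon>"
  \<comment> \<open>The budget is set for p-th powers of norms, since these add up over the fibres:
    one half for the tail, one half for the fibres in \<open>F\<close>.\<close>
  define \<eta> where "\<eta> = (\<epsilon> / 2) powr p"
  have \<eta>: "0 < \<eta>" using \<epsilon> by (simp add: \<eta>_def)
  obtain F where F: "finite F"
    "(\<integral>\<^sup>+i. ennreal (if i \<in> F then 0 else Lp_norm p M (\<lambda>m. f (J i m)) powr p) \<partial>count_space UNIV) \<le> ennreal (\<eta> / 2)"
    using integrable_count_space_tail[OF Lp_sum_integrable(1)[OF p f], of "\<eta> / 2"] \<eta> by auto
  \<comment> \<open>The summand 1 avoids division by 0 for empty \<open>F\<close>; with this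
    \<open>\<delta>\<close>, \<open>card F * \<delta> powr p\<close> is at most
    \<open>\<eta> / 2\<close>.\<close>
  define k where "k = real (card F) + 1"
  have k: "0 < k" by (simp add: k_def add_nonneg_pos)
  define \<delta> where "\<delta> = (\<eta> / (2 * k)) powr (1 / p)"
  have \<delta>: "0 < \<delta>" using \<eta> k by (simp add: \<delta>_def)
  have \<delta>p: "\<delta> powr p = \<eta> / (2 * k)" using \<eta> k p by (simp add: \<delta>_def powr_powr)
  let ?P = "\<lambda>i n a \<xi>. (\<forall>k<n::nat. \<xi> k \<in> Lp p M) \<and>
      Lp_norm p M (\<lambda>m. f (J i m) - (\<Sum>k<n. \<rho> i (a k) (\<xi> k) m)) < \<delta>"
  have "\<forall>i. \<exists>n a \<xi>. ?P i n a \<xi>"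
    by (intro allI nondegenerate_repD[OF nd Lp_sum_section[OF f] \<delta>])
  from choice[OF this] obtain n where "\<forall>i. \<exists>a \<xi>. ?P i (n i) a \<xi>" ..
  from choice[OF this] obtain a where "\<forall>i. \<exists>\<xi>. ?P i (n i) (a i) \<xi>" ..
  from choice[OF this] obtain \<xi> where "\<forall>i. ?P i (n i) (a i) (\<xi> i)" ..
  then have a: "\<And>i k. k < n i \<Longrightarrow> \<xi> i k \<in> Lp p M"
    "\<And>i. Lp_norm p M (\<lambda>m. f (J i m) - (\<Sum>k<n i. \<rho> i (a i k) (\<xi> i k) m)) < \<delta>" by simp_all
  define I where "I = (SIGMA i:F. {..<n i})"
  \<comment> \<open>The vector \<open>\<xi> i k\<close> placed in the \<open>i\<close>-th copy and
    extended by 0.\<close>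
  define Z where "Z l = glue J (\<lambda>j m. if j = fst l then \<xi> (fst l) (snd l) m else 0)" for l
  have finI: "finite I" using F(1) by (simp add: I_def)
  have ZL: "Z l \<in> Lp p sumJ" if "l \<in> I" for l
    unfolding Z_def by (rule Lp_glue_single(1)) (use a(1) that in \<open>auto simp: I_def\<close>)
  define r where "r y = f y - (\<Sum>l\<in>I. sum_rep J \<rho> (a (fst l) (snd l)) (Z l) y)" for y
  have rL: "r \<in> Lp p sumJ"
    unfolding r_def by (intro Lp_diff[OF p f] Lp_sum[OF p finI] sum_rep_Lp(1) ZL)
  \<comment> \<open>Terms from other copies act here on the zero vector, which is mapped to 0 only
    almost everywhere; as \<open>I\<close> is finite, all exceptional sets can be discarded
    together.\<close>
  have sec: "AE m in M. r (J j m) = f (J j m) - (if j \<in> F then (\<Sum>k<n j. \<rho> j (a j k) (\<xi> j k) m) else 0)" for j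
  proof -
    have "AE m in M. \<forall>l\<in>I. \<rho> j (a (fst l) (snd l)) (\<lambda>_. 0) m = 0"
      using rep_zero(1)[OF p \<rho>] by (intro AE_finite_allI finI) auto
    then show ?thesis
    proof eventually_elim
      fix m assume z: "\<forall>l\<in>I. \<rho> j (a (fst l) (snd l)) (\<lambda>_. 0) m = 0"
      have "sum_rep J \<rho> (a (fst l) (snd l)) (Z l) (J j m) =
          (if fst l = j then \<rho> j (a j (snd l)) (\<xi> j (snd l)) m else 0)" if "l \<in> I" for l
        using z that by (auto simp: sum_rep_section Z_def)
      then have "(\<Sum>l\<in>I. sum_rep J \<rho> (a (fst l) (snd l)) (Z l) (J j m)) =
          (\<Sum>l\<in>I. if fst l = j then \<rho> j (a j (snd l)) (\<xi> j (snd l)) m else 0)" by (intro sum.cong) auto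
      also have "\<dots> = (\<Sum>i\<in>F. \<Sum>k<n i. if i = j then \<rho> j (a j k) (\<xi> j k) m else 0)"
        unfolding I_def using F(1) by (subst sum.Sigma) (auto simp: split_beta)
      also have "\<dots> = (\<Sum>i\<in>F. if i = j then (\<Sum>k<n j. \<rho> j (a j k) (\<xi> j k) m) else 0)"
        by (intro sum.cong) auto
      also have "\<dots> = (if j \<in> F then (\<Sum>k<n j. \<rho> j (a j k) (\<xi> j k) m) else 0)"
        using F(1) by (simp add: sum.delta)
      finally show "r (J j m) = f (J j m) - (if j \<in> F then (\<Sum>k<n j. \<rho> j (a j k) (\<xi> j k) m) else 0)"
        by (simp add: r_def)
    qed
  qed
  have sL: "(\<lambda>m. f (J j m) - (if j \<in> F then (\<Sum>k<n j. \<rho> j (a j k) (\<xi> j k) m) else 0)) \<in> Lp p M" for j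
  proof (cases "j \<in> F")
    case True
    then show ?thesis
      using a(1) by (auto intro!: Lp_diff[OF p Lp_sum_section[OF f]] Lp_sum[OF p]
          bounded_operator_Lp[OF contractive_rep_bounded[OF \<rho>]])
  qed (simp add: Lp_sum_section[OF f])
  have "Lp_norm p M (\<lambda>m. r (J j m)) =
      Lp_norm p M (\<lambda>m. f (J j m) - (if j \<in> F then (\<Sum>k<n j. \<rho> j (a j k) (\<xi> j k) m) else 0))" for j
    by (rule Lp_norm_cong[OF sec]) (use Lp_sum_section[OF rL] sL Lp_measurable in blast)+
  then have rj: "Lp_norm p M (\<lambda>m. r (J j m)) powr p \<le>
      (if j \<in> F then 0 else Lp_norm p M (\<lambda>m. f (J j m)) powr p) + \<delta> powr p * indicator F j" for j
    using a(2)[of j] p by (auto intro!: powr_mono2)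
  let ?h = "\<lambda>j. if j \<in> F then 0 else Lp_norm p M (\<lambda>m. f (J j m)) powr p"
  have "(\<integral>\<^sup>+j. ennreal (Lp_norm p M (\<lambda>m. r (J j m)) powr p) \<partial>count_space UNIV) \<le>
      (\<integral>\<^sup>+j. ennreal (?h j) + ennreal (\<delta> powr p) * indicator F j \<partial>count_space UNIV)"
  proof (rule nn_integral_mono)
    show "ennreal (Lp_norm p M (\<lambda>m. r (J j m)) powr p) \<le>
        ennreal (?h j) + ennreal (\<delta> powr p) * indicator F j" for j
      using rj[of j] by (cases "j \<in> F") (auto simp: ennreal_leI)
  qed
  also have "\<dots> = (\<integral>\<^sup>+j. ennreal (?h j) \<partial>count_space UNIV) +
      ennreal (\<delta> powr p) * of_nat (card F)"
    using F(1) by (subst nn_integral_add) (auto simp: nn_integral_cmult_indicator emeasure_count_space_finite)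
  also have "\<dots> \<le> ennreal (\<eta> / 2) + ennreal (\<eta> / 2)"
  proof (rule add_mono[OF F(2)])
    have "ennreal (\<delta> powr p) * of_nat (card F) = ennreal (\<delta> powr p * real (card F))"
      by (simp add: ennreal_mult ennreal_of_nat_eq_real_of_nat)
    also have "\<delta> powr p * real (card F) \<le> \<delta> powr p * k" by (intro mult_left_mono) (auto simp: k_def)
    also have "\<delta> powr p * k = \<eta> / 2" using k by (simp add: \<delta>p)
    finally show "ennreal (\<delta> powr p) * of_nat (card F) \<le> ennreal (\<eta> / 2)" by (simp add: ennreal_leI)
  qed
  also have "\<dots> = ennreal (\<eta> / 2 + \<eta> / 2)" using \<eta> by (intro ennreal_plus[symmetric]) auto
  also have "\<dots> = ennreal ((\<epsilon> / 2) powr p)" by (simp add: \<eta>_def)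
  finally have "Lp_norm p sumJ r \<le> \<epsilon> / 2"
    using \<epsilon> by (intro Lp_sumI(2)[OF p, where J = J, OF Lp_sum_section[OF rL]]) auto
  then have "Lp_norm p sumJ (\<lambda>x. f x - (\<Sum>l\<in>I. sum_rep J \<rho> (a (fst l) (snd l)) (Z l) x)) < \<epsilon>"
    using \<epsilon> unfolding r_def by simp
  then show "\<exists>(I :: ('i \<times> nat) set) a \<xi>. finite I \<and> (\<forall>l\<in>I. \<xi> l \<in> Lp p sumJ) \<and>
      Lp_norm p sumJ (\<lambda>x. f x - (\<Sum>l\<in>I. sum_rep J \<rho> (a l) (\<xi> l) x)) < \<epsilon>"
    using finI ZL by (intro exI[of _ I] exI[of _ "\<lambda>l. a (fst l) (snd l)"] exI[of _ Z]) auto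
qed

end

end

section \<open>Regular representations of discrete groups\<close>

lemma isometric_contractive: "isometric_rep p M \<pi> \<Longrightarrow> contractive_rep p M \<pi>"
  by (simp add: isometric_rep_def contractive_rep_def)

lemma haar_discrete:
  fixes \<mu> :: "'g::{topological_group_add, t2_space} measure"
  assumes "left_haar_measure \<mu>" "discrete_space TYPE('g)"
  shows "\<mu> = count_space UNIV"
proof -
  have "discrete_space TYPE('g) \<longrightarrow> \<mu> = count_space UNIV"
    using assms(1) unfolding left_haar_measure_def by (elim conjE) assumption
  then show ?thesis using assms(2) by blast
qed

text \<open>Covering by open singletons shows that compact sets are finite, and every function is
  continuous.\<close>

lemma compactly_supported_discrete:
  fixes x :: "'g::t2_space \<Rightarrow> 'a::real_normed_vector"
  assumes d: "discrete_space TYPE('g)"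
  shows "x \<in> Cc \<longleftrightarrow> finite {g. x g \<noteq> 0}"
proof
  have op: "open S" for S :: "'g set" using d by (simp add: discrete_space_def)
  assume "x \<in> Cc"
  then obtain K where K: "compact K" "\<And>g. g \<notin> K \<Longrightarrow> x g = 0" using compactly_supportedE by metis
  have "finite K"
  proof -
    obtain D where "D \<subseteq> (\<lambda>g. {g}) ` K" "finite D" "K \<subseteq> \<Union>D"
      using compactE[OF K(1), of "(\<lambda>g. {g}) ` K"] op by blast
    moreover have "finite (\<Union>D)" using calculation by (intro finite_Union) auto
    ultimately show ?thesis using finite_subset by blast
  qed
  moreover have "{g. x g \<noteq> 0} \<subseteq> K" using K(2) by blast
  ultimately show "finite {g. x g \<noteq> 0}" using finite_subset by blast
next
  have op: "open S" for S :: "'g set" using d by (simp add: discrete_space_def)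
  assume f: "finite {g. x g \<noteq> 0}"
  have "continuous_on UNIV x" using op by (auto simp: continuous_on_open_vimage)
  moreover have "compact {g. x g \<noteq> 0}" by (rule finite_imp_compact[OF f])
  ultimately show "x \<in> Cc" unfolding compactly_supported_def by blast
qed

lemma Lp_norm_eqI:
  assumes "1 \<le> p" "ennreal (Lp_norm p M f powr p) = ennreal (Lp_norm p N g powr p)"
  shows "Lp_norm p M f = Lp_norm p N g"
proof -
  have "(Lp_norm p M f powr p) powr (1 / p) = (Lp_norm p N g powr p) powr (1 / p)" using assms(2) by simp
  then show ?thesis using assms(1) by (simp add: powr_powr)
qed

context
  fixes p :: real and \<alpha> :: "'g::{topological_group_add, t2_space} \<Rightarrow> 'a::complex_banach_algebra \<Rightarrow> 'a"
    and M :: "'m measure" and \<pi> :: "'a \<Rightarrow> 'm opr"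
    and J :: "'g \<Rightarrow> 'm \<Rightarrow> 'x" and K :: "unit \<Rightarrow> 'm \<Rightarrow> 'y"
  assumes p: "1 \<le> p" and discrete: "discrete_space TYPE('g)" and \<alpha>: "group_action \<alpha>"
    and \<pi>: "contractive_rep p M \<pi>" and nd: "nondegenerate_rep p M \<pi>"
    and J: "inj (case_prod J)" and K: "inj (case_prod K)"
begin

abbreviation (input) "regM \<equiv> sum_measure M J"
abbreviation (input) "baseM \<equiv> sum_measure M K"

text \<open>The fibre at g of the regular representation.\<close>

definition twisted_rep :: "'g \<Rightarrow> 'a \<Rightarrow> 'm opr" where
  "twisted_rep g a = \<pi> (\<alpha> (- g) a)"

definition translation :: "'g \<Rightarrow> 'x opr" where
  "translation g f = glue J (\<lambda>h m. f (J (- g + h) m))"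

text \<open>The identification of L^p(M) with L^p(G,L^p(M_0)) that \<open>regular_rep_of\<close>
  asks for. In \<open>regular_reps\<close> the base space has to live on the type
  \<open>points\<close> too, so \<open>K\<close> replaces \<open>M\<close> by a copy of itself, a
  direct sum over \<open>unit\<close>.\<close>

definition slice :: "('x \<Rightarrow> complex) \<Rightarrow> 'g \<Rightarrow> 'y \<Rightarrow> complex" where
  "slice f g = glue K (\<lambda>_ m. f (J g m))"

lemmas glue_J = glue_apply[OF J]
  and glue_K = glue_apply[OF K]

lemma translation_section: "translation g f (J h m) = f (J (- g + h) m)"
  by (simp add: translation_def glue_J)

lemma slice_section: "slice f g (K i m) = f (J g m)"
  using glue_K[of "\<lambda>_ m. f (J g m)" i m] by (simp only: slice_def)

lemma twisted_contractive: "contractive_rep p M (twisted_rep g)"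
proof -
  have alg: "algebra_rep p M \<pi>" and n: "operator_norm p M (\<pi> (\<alpha> (- g) a)) \<le> norm (\<alpha> (- g) a)" for a
    using \<pi> by (auto simp: contractive_rep_def)
  have "algebra_rep p M (twisted_rep g)"
    using alg unfolding algebra_rep_def twisted_rep_def group_action_simps(1,4,6)[OF \<alpha>] by simp
  then show ?thesis
    using n unfolding contractive_rep_def group_action_simps(7)[OF \<alpha>] by (simp add: twisted_rep_def)
qed

lemma twisted_nondegenerate: "nondegenerate_rep p M (twisted_rep g)"
  unfolding nondegenerate_rep_def
proof (intro ballI allI impI)
  fix f and \<epsilon> :: real assume "f \<in> Lp p M" "0 < \<epsilon>"
  from nondegenerate_repD[OF nd this] obtain n :: nat and a \<xi> where n: "\<forall>i<n. \<xi> i \<in> Lp p M"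
    "Lp_norm p M (\<lambda>x. f x - (\<Sum>i<n. \<pi> (a i) (\<xi> i) x)) < \<epsilon>"
    by (elim exE conjE) (rule that)
  \<comment> \<open>The twist undoes \<alpha>_g, so the same vectors work with \<alpha>_g(a_i) in
    place of a_i.\<close>
  show "\<exists>n::nat. \<exists>a \<xi>. (\<forall>i<n. \<xi> i \<in> Lp p M) \<and>
      Lp_norm p M (\<lambda>x. f x - (\<Sum>i<n. twisted_rep g (a i) (\<xi> i) x)) < \<epsilon>"
    by (rule exI[of _ n], rule exI[of _ "\<lambda>i. \<alpha> g (a i)"], rule exI[of _ \<xi>])
       (use n in \<open>simp add: twisted_rep_def group_action_simps[OF \<alpha>]\<close>)
qed

lemma ae_eq_sumI: "(\<And>i. AE m in M. f (J i m) = h (J i m)) \<Longrightarrow> ae_eq regM f h"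
  unfolding ae_eq_def by (rule AE_sum_measureI[OF J])

lemma ae_eq_sum0I: "(\<And>i. AE m in M. f (K i m) = h (K i m)) \<Longrightarrow> ae_eq baseM f h"
  unfolding ae_eq_def by (rule AE_sum_measureI[OF K])

lemma translation_Lp:
  assumes f: "f \<in> Lp p regM"
  shows "translation g f \<in> Lp p regM"
    and "Lp_norm p regM (translation g f) = Lp_norm p regM f"
proof -
  have s: "(\<lambda>m. translation g f (J h m)) \<in> Lp p M" for h
    unfolding translation_section by (rule Lp_sum_section[OF f])
  have bij: "bij_betw (\<lambda>h. - g + h) UNIV UNIV"
    by (rule bij_betw_byWitness[where f' = "\<lambda>h. g + h"]) (auto simp: add.assoc[symmetric])
  have "(\<integral>\<^sup>+h. ennreal (Lp_norm p M (\<lambda>m. translation g f (J h m)) powr p) \<partial>count_space UNIV) =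
      (\<integral>\<^sup>+h. ennreal (Lp_norm p M (\<lambda>m. f (J h m)) powr p) \<partial>count_space UNIV)"
    unfolding translation_section
    by (rule nn_integral_bij_count_space[OF bij, where f = "\<lambda>h. ennreal (Lp_norm p M (\<lambda>m. f (J h m)) powr p)"])
  also have "\<dots> = ennreal (Lp_norm p regM f powr p)" by (rule Lp_sum_norm[OF p f])
  finally have eq: "(\<integral>\<^sup>+h. ennreal (Lp_norm p M (\<lambda>m. translation g f (J h m)) powr p) \<partial>count_space UNIV) =
      ennreal (Lp_norm p regM f powr p)" .
  show L: "translation g f \<in> Lp p regM"
    by (rule Lp_sumI(1)[OF p, where J = J, OF s eq_refl[OF eq]]) simp
  show "Lp_norm p regM (translation g f) = Lp_norm p regM f"
    by (rule Lp_norm_eqI[OF p]) (use eq Lp_sum_norm[OF p L] in simp)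
qed

lemma translation_isometric: "isometric_group_rep p regM translation"
  unfolding isometric_group_rep_def
proof (intro conjI allI ballI)
  fix g
  show "bounded_operator p regM (translation g)"
    unfolding bounded_operator_def
  proof (intro conjI ballI allI)
    show "\<exists>C. \<forall>f\<in>Lp p regM. Lp_norm p regM (translation g f) \<le> C * Lp_norm p regM f"
      using translation_Lp(2) by (intro exI[of _ 1]) simp
  qed (auto intro!: translation_Lp(1) ae_eq_sumI simp: translation_section)
next
  fix f assume "f \<in> Lp p regM"
  show "ae_eq regM (translation 0 f) f"
    by (rule ae_eq_sumI) (simp add: translation_section)
next
  fix g h f assume "f \<in> Lp p regM"
  show "ae_eq regM (translation (g + h) f) (translation g (translation h f))"
    by (rule ae_eq_sumI, unfold translation_section minus_add add.assoc) simp
next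
  fix f and g :: 'g
  \<comment> \<open>In a discrete group the punctured neighbourhood filter is trivial, so strong
    continuity holds vacuously.\<close>
  have "at g = bot" using discrete by (simp add: at_eq_bot_iff discrete_space_def)
  then show "((\<lambda>h. Lp_norm p regM (\<lambda>x. translation h f x - translation g f x)) \<longlongrightarrow> 0) (at g)"
    by simp
qed (rule translation_Lp(2))

lemma regular_covariant: "covariant_rep p \<alpha> regM (sum_rep J twisted_rep) translation"
  unfolding covariant_rep_def
proof (intro conjI allI ballI)
  show "contractive_rep p regM (sum_rep J twisted_rep)"
    by (rule sum_rep_contractive[OF J p twisted_contractive])
  show "nondegenerate_rep p regM (sum_rep J twisted_rep)"
    by (rule sum_rep_nondegenerate[OF J p twisted_contractive twisted_nondegenerate])
  fix g a f assume "f \<in> Lp p regM"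
  \<comment> \<open>In the fibre at h both sides involve \<alpha>_{-h+g}(a), since -(-g + h) = -h +
    g; the two translations cancel on \<open>f\<close>.\<close>
  show "ae_eq regM (translation g (sum_rep J twisted_rep a (translation (- g) f)))
      (sum_rep J twisted_rep (\<alpha> g a) f)"
    by (intro ae_eq_sumI)
       (simp add: translation_section sum_rep_section[OF J] twisted_rep_def minus_add
         group_action_simps(8)[OF \<alpha>])
qed (rule translation_isometric)

section \<open>Identification with L^p(G,L^p(M_0))\<close>

lemma Lp_sum0_iff:
  shows "f \<in> Lp p baseM \<longleftrightarrow> (\<lambda>m. f (K () m)) \<in> Lp p M"
    and "f \<in> Lp p baseM \<Longrightarrow> Lp_norm p baseM f = Lp_norm p M (\<lambda>m. f (K () m))"
proof -
  have c: "(\<integral>\<^sup>+i. h i \<partial>count_space (UNIV :: unit set)) = h ()" for h :: "unit \<Rightarrow> ennreal"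
    by (simp add: nn_integral_count_space_finite UNIV_unit)
  show "f \<in> Lp p baseM \<longleftrightarrow> (\<lambda>m. f (K () m)) \<in> Lp p M"
  proof
    assume s: "(\<lambda>m. f (K () m)) \<in> Lp p M"
    have s': "(\<lambda>m. f (K i m)) \<in> Lp p M" for i using s by (cases i) simp
    show "f \<in> Lp p baseM"
      by (rule Lp_sumI(1)[OF p, where J = K, OF s', of "Lp_norm p M (\<lambda>m. f (K () m))"]) (simp_all add: c)
  qed (rule Lp_sum_section)
  show "Lp_norm p baseM f = Lp_norm p M (\<lambda>m. f (K () m))" if f: "f \<in> Lp p baseM"
    by (rule Lp_norm_eqI[OF p]) (use Lp_sum_norm[OF p f] in \<open>simp add: c\<close>)
qed

lemma slice_Lp:
  assumes f: "f \<in> Lp p regM"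
  shows "slice f g \<in> Lp p baseM"
    and "Lp_norm p baseM (slice f g) = Lp_norm p M (\<lambda>m. f (J g m))"
proof -
  show L: "slice f g \<in> Lp p baseM"
    using Lp_sum_section[OF f] by (simp add: Lp_sum0_iff(1) slice_section)
  show "Lp_norm p baseM (slice f g) = Lp_norm p M (\<lambda>m. f (J g m))"
    by (simp add: Lp_sum0_iff(2)[OF L] slice_section)
qed

text \<open>Strong measurability is the point when G is uncountable: finiteness of the norm leaves
  only countably many nonzero fibres, and truncation to the first n of them gives the simple
  functions.\<close>

lemma slice_Lp_valued:
  assumes f: "f \<in> Lp p regM"
  shows "slice f \<in> Lp_valued p (count_space UNIV) baseM"
    and "Lp_valued_norm p (count_space UNIV) baseM (slice f) = Lp_norm p regM f"
proof -
  define C where "C = {g. Lp_norm p M (\<lambda>m. f (J g m)) powr p \<noteq> 0}"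
  have "Infinite_Set_Sum.abs_summable_on (\<lambda>g. Lp_norm p M (\<lambda>m. f (J g m)) powr p) UNIV"
    using Lp_sum_integrable(1)[OF p f] by (simp add: abs_summable_on_def)
  then have "Infinite_Sum.abs_summable_on (\<lambda>g. Lp_norm p M (\<lambda>m. f (J g m)) powr p) UNIV"
    by (rule abs_summable_equivalent[THEN iffD2])
  from abs_summable_countable[OF this] have C: "countable C" by (simp add: C_def)
  \<comment> \<open>If \<open>C\<close> is finite or empty, the enumeration repeats or takes an
    arbitrary value; this is harmless, because \<open>s n\<close> agrees with the slice of
    \<open>f\<close> at every enumerated point.\<close>
  define s where "s n g = (if g \<in> from_nat_into C ` {..<n} then slice f g else (\<lambda>_. 0))" for n :: nat and g
  have z: "(\<lambda>_. 0) \<in> Lp p baseM" using p by simp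
  have "Lp_simple_function p (count_space UNIV) baseM (s n)" for n
    unfolding Lp_simple_function_def
  proof (intro conjI allI)
    have "range (s n) \<subseteq> insert (\<lambda>_. 0) (slice f ` from_nat_into C ` {..<n})" by (auto simp: s_def)
    then show "finite (range (s n))" by (rule finite_subset) simp
    show "range (s n) \<subseteq> Lp p baseM" using slice_Lp(1)[OF f] z by (auto simp: s_def)
  qed simp
  moreover have "(\<lambda>n. Lp_norm p baseM (\<lambda>y. s n g y - slice f g y)) \<longlonglongrightarrow> 0" for g
  proof (cases "g \<in> C")
    case True
    then obtain k where k: "from_nat_into C k = g" using from_nat_into_surj[OF C] by blast
    have "Lp_norm p baseM (\<lambda>y. s n g y - slice f g y) = 0" if "Suc k \<le> n" for n
    proof -
      have "s n g = slice f g" using k that by (auto simp: s_def)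
      then show ?thesis using p by simp
    qed
    then show ?thesis by (intro tendsto_eventually) (auto simp: eventually_sequentially)
  next
    case False
    then have "Lp_norm p M (\<lambda>m. f (J g m)) = 0" using p by (simp add: C_def)
    then have "Lp_norm p baseM (slice f g) = 0" by (simp add: slice_Lp(2)[OF f])
    then have "Lp_norm p baseM (\<lambda>y. s n g y - slice f g y) = 0" for n
      using p Lp_norm_minus_commute[of p "baseM" "slice f g" "\<lambda>_. 0"] by (simp add: s_def)
    then show ?thesis by simp
  qed
  ultimately show "slice f \<in> Lp_valued p (count_space UNIV) baseM"
    unfolding Lp_valued_def using slice_Lp[OF f] Lp_sum_integrable(1)[OF p f]
    by (auto intro!: exI[of _ s])
  show "Lp_valued_norm p (count_space UNIV) baseM (slice f) = Lp_norm p regM f"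
    using p by (simp add: Lp_valued_norm_def slice_Lp(2)[OF f] Lp_sum_integrable(2)[OF p f] powr_powr)
qed

lemma slice_surjective:
  assumes \<xi>: "\<xi> \<in> Lp_valued p (count_space UNIV) baseM"
  shows "\<exists>f\<in>Lp p regM. ae_eq_valued (count_space UNIV) baseM (slice f) \<xi>"
proof
  define f where "f = glue J (\<lambda>g m. \<xi> g (K () m))"
  have \<xi>L: "\<xi> g \<in> Lp p baseM" for g using \<xi> by (simp add: Lp_valued_def)
  have f: "f (J g m) = \<xi> g (K () m)" for g m by (simp add: f_def glue_J)
  have s: "(\<lambda>m. f (J g m)) \<in> Lp p M" for g unfolding f using \<xi>L by (simp add: Lp_sum0_iff(1))
  have int: "integrable (count_space UNIV) (\<lambda>g. Lp_norm p baseM (\<xi> g) powr p)"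
    using \<xi> by (simp add: Lp_valued_def)
  define I where "I = (\<integral>g. Lp_norm p baseM (\<xi> g) powr p \<partial>count_space UNIV)"
  have "0 \<le> I" unfolding I_def by simp
  then have "(I powr (1 / p)) powr p = I" using p by (simp add: powr_powr)
  moreover have "(\<integral>\<^sup>+g. ennreal (Lp_norm p M (\<lambda>m. f (J g m)) powr p) \<partial>count_space UNIV) = ennreal I"
    unfolding f I_def Lp_sum0_iff(2)[OF \<xi>L, symmetric] using int by (intro nn_integral_eq_integral) auto
  ultimately show "f \<in> Lp p regM"
    by (intro Lp_sumI(1)[OF p, where J = J, OF s, of "I powr (1 / p)"]) simp_all
  have "slice f g (K i m) = \<xi> g (K i m)" for g i m by (cases i) (simp add: slice_section f)
  then show "ae_eq_valued (count_space UNIV) baseM (slice f) \<xi>"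
    unfolding ae_eq_valued_def by (intro AE_I2 ae_eq_sum0I) simp
qed

lemma regular_rep_exists:
  "regular_rep_of p \<alpha> (count_space UNIV) baseM (sum_rep K (\<lambda>_. \<pi>))
    regM (sum_rep J twisted_rep) translation"
  unfolding regular_rep_of_def
proof (intro conjI exI[of _ slice] regular_covariant allI ballI)
  show "Lp_valued_iso p regM (count_space UNIV) baseM slice"
    unfolding Lp_valued_iso_def ae_eq_valued_def
  proof (intro conjI ballI allI)
    fix f h and c :: complex
    show "AE g in count_space UNIV. ae_eq baseM (slice (\<lambda>x. f x + h x) g) (\<lambda>y. slice f g y + slice h g y)"
      by (intro AE_I2 ae_eq_sum0I) (simp add: slice_section)
    show "AE g in count_space UNIV. ae_eq baseM (slice (\<lambda>x. c * f x) g) (\<lambda>y. c * slice f g y)"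
      by (intro AE_I2 ae_eq_sum0I) (simp add: slice_section)
  qed (use slice_Lp_valued slice_surjective[unfolded ae_eq_valued_def] in blast)+
next
  fix a f
  show "ae_eq_valued (count_space UNIV) baseM (slice (sum_rep J twisted_rep a f))
      (\<lambda>g. sum_rep K (\<lambda>_. \<pi>) (\<alpha> (- g) a) (slice f g))"
    unfolding ae_eq_valued_def
    by (intro AE_I2 ae_eq_sum0I)
       (simp add: slice_section sum_rep_section[OF J] sum_rep_section[OF K] twisted_rep_def)
next
  fix g f
  show "ae_eq_valued (count_space UNIV) baseM (slice (translation g f)) (\<lambda>h. slice f (- g + h))"
    unfolding ae_eq_valued_def
    by (intro AE_I2 ae_eq_sum0I) (simp add: slice_section translation_section)
qed

lemma base_rep: "contractive_rep p baseM (sum_rep K (\<lambda>_. \<pi>))"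
  "nondegenerate_rep p baseM (sum_rep K (\<lambda>_. \<pi>))"
  using sum_rep_contractive[OF K p \<pi>]
    sum_rep_nondegenerate[OF K p \<pi> nd] .

text \<open>The vector \<xi> sits in the fibre at 0 and v_g moves it to the fibre at g, so in the
  fibre at 0 only the term g = 0 survives, where the twist is trivial. Passing to one fibre does not
  increase the norm.\<close>

lemma regular_integrated_form:
  fixes \<iota> :: "('g \<Rightarrow> 'a) \<Rightarrow> 'l::complex_banach_algebra"
  assumes x: "x \<in> Cc" and \<xi>: "\<xi> \<in> Lp p M"
  defines "\<xi>' \<equiv> glue J (\<lambda>g m. if g = 0 then \<xi> m else 0)"
  obtains \<eta> where
    "has_integrated_form p regM (count_space UNIV) \<iota> (sum_rep J twisted_rep) translation (\<iota> x) \<xi>' \<eta>"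
    "Lp_norm p M (\<pi> (x 0) \<xi>) \<le> Lp_norm p regM \<eta>"
proof -
  \<comment> \<open>Adding 0 ensures that the term g = 0 occurs in the sum even if
    \<open>x 0 = 0\<close>.\<close>
  define S where "S = insert 0 {g. x g \<noteq> 0}"
  have S: "finite S" using x compactly_supported_discrete[OF discrete, of x] by (simp add: S_def)
  define F where "F g = sum_rep J twisted_rep (x g) (translation g \<xi>')" for g
  have \<xi>'L: "\<xi>' \<in> Lp p regM"
    unfolding \<xi>'_def by (rule Lp_glue_single(1)[OF J p twisted_contractive \<xi>])
  have FL: "F g \<in> Lp p regM" for g
    unfolding F_def by (rule sum_rep_Lp(1)[OF J p twisted_contractive translation_Lp(1)[OF \<xi>'L]])
  have F_sec: "F g (J h m) = \<pi> (\<alpha> (- h) (x g)) (\<lambda>m. if - g + h = 0 then \<xi> m else 0) m" for g h m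
    by (simp add: F_def sum_rep_section[OF J] twisted_rep_def translation_section \<xi>'_def glue_J)
  have F0: "AE y in regM. F g y = 0" if g: "g \<notin> S" for g
  proof (rule AE_sum_measureI[OF J])
    fix h
    have xg: "\<alpha> (- h) (x g) = 0" using g by (simp add: S_def group_action_simps[OF \<alpha>])
    have L: "(\<lambda>m. if - g + h = 0 then \<xi> m else 0) \<in> Lp p M" using \<xi> p by (cases "- g + h = 0") simp_all
    show "AE m in M. F g (J h m) = 0"
      unfolding F_sec xg by (rule rep_zero(2)[OF p \<pi> L])
  qed
  define \<eta> where "\<eta> y = (\<Sum>g\<in>S. F g y)" for y
  have \<eta>L: "\<eta> \<in> Lp p regM" unfolding \<eta>_def by (rule Lp_sum[OF p S FL])
  have "has_Lp_integral p regM (count_space UNIV) F \<eta>"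
    unfolding has_Lp_integral_def
  proof (intro conjI \<eta>L ballI impI)
    fix B assume B: "B \<in> sets regM" "emeasure regM B < \<infinity>"
    define c where "c g = (LINT y:B|regM. F g y)" for g
    have c0: "c g = 0" if "g \<notin> S" for g
    proof -
      have "c g = (\<integral>y. 0 \<partial>regM)"
        unfolding c_def set_lebesgue_integral_def
        by (rule integral_cong_AE) (use F0[OF that] B FL in \<open>auto dest: Lp_measurable elim: eventually_mono\<close>)
      then show ?thesis by simp
    qed
    then have sub: "{g. c g \<noteq> 0} \<subseteq> S" by blast
    have "(LINT y:B|regM. \<eta> y) = (\<Sum>g\<in>S. c g)"
      unfolding c_def \<eta>_def set_lebesgue_integral_def scaleR_sum_right
      using Lp_set_integrable(1)[OF p FL B] by (intro Bochner_Integration.integral_sum) (simp add: set_integrable_def)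
    also have "\<dots> = (\<Sum>g | g \<in> UNIV \<and> c g \<noteq> 0. c g)"
      using S sub by (intro sum.mono_neutral_right) auto
    also have "\<dots> = (\<integral>g. c g \<partial>count_space UNIV)"
      using finite_subset[OF sub S] by (intro lebesgue_integral_count_space_finite_support[symmetric]) simp
    finally show "(LINT y:B|regM. \<eta> y) = (\<integral>g. (LINT y:B|regM. F g y) \<partial>count_space UNIV)"
      by (simp add: c_def)
  qed
  \<comment> \<open>Since \<open>x\<close> lies in the dense subspace, constant sequences serve as
    approximants.\<close>
  then have "has_integrated_form p regM (count_space UNIV) \<iota> (sum_rep J twisted_rep) translation (\<iota> x) \<xi>' \<eta>"
    unfolding has_integrated_form_def F_def[abs_def] using x \<eta>L p
    by (intro conjI exI[of _ "\<lambda>_. x"] exI[of _ "\<lambda>_. \<eta>"]) auto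
  moreover have "Lp_norm p M (\<pi> (x 0) \<xi>) \<le> Lp_norm p regM \<eta>"
  proof -
    \<comment> \<open>In the fibre at 0 every term with g \<noteq> 0 is an operator applied to the
      zero vector, and this vanishes only almost everywhere.\<close>
    have "AE m in M. \<forall>g\<in>S. \<pi> (x g) (\<lambda>_. 0) m = 0"
      using rep_zero(1)[OF p \<pi>] by (intro AE_finite_allI S) auto
    then have "AE m in M. \<pi> (x 0) \<xi> m = \<eta> (J 0 m)"
    proof eventually_elim
      fix m assume z: "\<forall>g\<in>S. \<pi> (x g) (\<lambda>_. 0) m = 0"
      have "F g (J 0 m) = (if g = 0 then \<pi> (x 0) \<xi> m else 0)" if "g \<in> S" for g
        using z that by (auto simp: F_sec group_action_simps[OF \<alpha>])
      then have "\<eta> (J 0 m) = (\<Sum>g\<in>S. if g = 0 then \<pi> (x 0) \<xi> m else 0)"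
        unfolding \<eta>_def by (intro sum.cong) auto
      also have "\<dots> = \<pi> (x 0) \<xi> m" using S by (simp add: S_def)
      finally show "\<pi> (x 0) \<xi> m = \<eta> (J 0 m)" by simp
    qed
    then have "Lp_norm p M (\<pi> (x 0) \<xi>) = Lp_norm p M (\<lambda>m. \<eta> (J 0 m))"
      using Lp_sum_section[OF \<eta>L] bounded_operator_Lp[OF contractive_rep_bounded[OF \<pi>] \<xi>]
      by (intro Lp_norm_cong) (auto dest: Lp_measurable)
    then show ?thesis using Lp_sum_section_norm_le[OF p \<eta>L] by simp
  qed
  ultimately show thesis by (rule that)
qed

end

text \<open>The base representation is isometric, so the fibre at 0 recovers the norm of
  \<open>x 0\<close>; its nondegeneracy is what admits the induced representation to
  \<open>regular_reps\<close>.\<close>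

lemma reduced_crossed_product_norm_ge:
  fixes \<mu> :: "'g::{topological_group_add, t2_space} measure"
    and \<alpha> :: "'g \<Rightarrow> 'a::complex_banach_algebra \<Rightarrow> 'a"
    and \<iota> :: "('g \<Rightarrow> 'a) \<Rightarrow> 'l::complex_banach_algebra"
    and \<kappa> :: "'l \<Rightarrow> 'r::complex_banach_algebra"
  assumes p: "1 \<le> p" and A: "nondegenerate_Lp_operator_algebra p TYPE('a) TYPE('m)"
    and \<mu>: "left_haar_measure \<mu>" and \<alpha>: "group_action \<alpha>" and \<iota>: "is_L1_algebra \<mu> \<alpha> \<iota>"
    and \<kappa>: "is_reduced_crossed_product TYPE('m) p \<alpha> \<mu> \<iota> \<kappa>"
    and discrete: "discrete_space TYPE('g)" and x: "x \<in> Cc"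
  shows "norm (x 0) \<le> norm (\<kappa> (\<iota> x))"
proof -
  obtain M :: "'m measure" and \<pi> :: "'a \<Rightarrow> 'm opr" where
    iso: "isometric_rep p M \<pi>" and nd: "nondegenerate_rep p M \<pi>"
    using A unfolding nondegenerate_Lp_operator_algebra_def by blast
  have con: "contractive_rep p M \<pi>" by (rule isometric_contractive[OF iso])
  \<comment> \<open>A point is a set of tagged elements: the pair (g, m) becomes a two-element set
    with tags 0 and 1, and a point of the base space becomes a singleton.\<close>
  define J :: "'g \<Rightarrow> 'm \<Rightarrow> ('g, 'a, 'm) points" where "J g m = {(0, Inl g), (1, Inr (Inr m))}" for g m
  define K :: "unit \<Rightarrow> 'm \<Rightarrow> ('g, 'a, 'm) points" where "K i m = {(0, Inr (Inr m))}" for i m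
  have J: "inj (case_prod J)" by (auto simp: J_def inj_def doubleton_eq_iff)
  have K: "inj (case_prod K)" by (auto simp: K_def inj_def)
  let ?M = "sum_measure M J" and ?\<pi> = "sum_rep J (twisted_rep \<alpha> \<pi>)" and ?v = "translation J"
  have count: "\<mu> = count_space UNIV" by (rule haar_discrete[OF \<mu> discrete])
  note reg = p discrete \<alpha> con nd J K
  note rr = regular_rep_exists[OF reg]
  have mem: "(?M, ?\<pi>, ?v) \<in> (regular_reps p \<alpha> \<mu> :: ('g, 'a, ('g, 'a, 'm) points) rep set)"
    unfolding regular_reps_def using rr base_rep[OF reg] count by blast
  have cov: "covariant_rep p \<alpha> ?M ?\<pi> ?v" using rr by (simp add: regular_rep_of_def)
  have le: "Lp_norm p M (\<pi> (x 0) \<xi>) \<le> norm (\<kappa> (\<iota> x))" if \<xi>: "\<xi> \<in> Lp p M" "Lp_norm p M \<xi> \<le> 1" for \<xi>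
  proof -
    define \<xi>' where "\<xi>' = glue J (\<lambda>g m. if g = 0 then \<xi> m else 0)"
    obtain \<eta> where \<eta>: "has_integrated_form p ?M (count_space UNIV) \<iota> ?\<pi> ?v (\<iota> x) \<xi>' \<eta>"
      "Lp_norm p M (\<pi> (x 0) \<xi>) \<le> Lp_norm p ?M \<eta>"
      using regular_integrated_form[OF reg x \<xi>(1), of \<iota>]
      unfolding \<xi>'_def by blast
    note single = Lp_glue_single[OF J p con \<xi>(1), of 0, folded \<xi>'_def]
    have "Lp_norm p ?M \<eta> \<le> integrated_norm p ?M \<mu> \<iota> ?\<pi> ?v (\<iota> x)"
      using \<eta>(1) single \<xi>(2) unfolding count[symmetric]
      by (intro integrated_norm_bounds(2)[OF p \<mu> \<iota> cov]) auto
    also have "\<dots> \<le> sup_norm p \<mu> \<iota> (regular_reps p \<alpha> \<mu> :: ('g, 'a, ('g, 'a, 'm) points) rep set) (\<iota> x)"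
      by (rule sup_norm_bounds(2)[OF p \<mu> \<iota> _ mem]) (auto simp: regular_reps_def regular_rep_of_def)
    also have "\<dots> = norm (\<kappa> (\<iota> x))" using \<kappa> by (simp add: is_reduced_crossed_product_def is_completion_def)
    finally show ?thesis using \<eta>(2) by simp
  qed
  have "operator_norm p M (\<pi> (x 0)) \<le> norm (\<kappa> (\<iota> x))"
    unfolding operator_norm_def
  proof (rule cSup_least)
    have "(\<lambda>_. 0) \<in> Lp p M" "Lp_norm p M (\<lambda>_. 0) \<le> 1" using p by simp_all
    then show "{Lp_norm p M (\<pi> (x 0) f) |f. f \<in> Lp p M \<and> Lp_norm p M f \<le> 1} \<noteq> {}" by blast
  qed (use le in blast)
  then show ?thesis using iso by (simp add: isometric_rep_def)
qed

section \<open>From the reduced crossed product back to $A$\<close>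

lemma has_bochner_value_single:
  "has_bochner_value (count_space UNIV) (\<lambda>h. if h = g then c else 0) (c :: 'b::real_normed_vector)"
proof -
  have int: "integrable (count_space UNIV) (indicat_real {g})" by simp
  have eq: "(\<lambda>h. indicat_real {g} h *\<^sub>R c) = (\<lambda>h. if h = g then c else 0)"
    by (auto simp: fun_eq_iff)
  show ?thesis using has_bochner_value_scaleR[OF int, of c] unfolding eq by simp
qed

lemma convolution_delta:
  fixes \<alpha> :: "'g::{topological_group_add, t2_space} \<Rightarrow> 'a::complex_banach_algebra \<Rightarrow> 'a"
  assumes \<alpha>: "group_action \<alpha>"
  shows "convolution (count_space UNIV) \<alpha> x (\<lambda>g. if g = 0 then a else 0) 0 = x 0 * a"
    and "convolution (count_space UNIV) \<alpha> (\<lambda>g. if g = 0 then a else 0) x 0 = a * x 0"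
proof -
  have "(\<lambda>h. x h * \<alpha> h (if - h + 0 = 0 then a else 0)) = (\<lambda>h. if h = 0 then x 0 * a else 0)"
    by (auto simp: fun_eq_iff group_action_simps[OF \<alpha>])
  then show "convolution (count_space UNIV) \<alpha> x (\<lambda>g. if g = 0 then a else 0) 0 = x 0 * a"
    unfolding convolution_def by (simp only: bochner_value_eq[OF has_bochner_value_single])
  have "(\<lambda>h. (if h = 0 then a else 0) * \<alpha> h (x (- h + 0))) = (\<lambda>h. if h = 0 then a * x 0 else 0)"
    by (auto simp: fun_eq_iff group_action_simps[OF \<alpha>])
  then show "convolution (count_space UNIV) \<alpha> (\<lambda>g. if g = 0 then a else 0) x 0 = a * x 0"
    unfolding convolution_def by (simp only: bochner_value_eq[OF has_bochner_value_single])
qed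

text \<open>The coefficient bound is available only for compactly supported functions, so the unit
  is first moved into the image of these under \<kappa> and \<iota>; its coefficient at 0 is the
  unit of \<open>A\<close>.\<close>

lemma coefficient_contractive_approx_identity:
  fixes \<mu> :: "'g::{topological_group_add, t2_space} measure"
    and \<alpha> :: "'g \<Rightarrow> 'a::complex_banach_algebra \<Rightarrow> 'a"
    and \<iota> :: "('g \<Rightarrow> 'a) \<Rightarrow> 'l::complex_banach_algebra"
    and \<kappa> :: "'l \<Rightarrow> 'r::complex_banach_algebra"
  assumes \<mu>: "left_haar_measure \<mu>" and \<alpha>: "group_action \<alpha>" and \<iota>: "is_L1_algebra \<mu> \<alpha> \<iota>"
    and \<kappa>: "is_completion UNIV (+) (*\<^sub>C) (*) N \<kappa>" and \<kappa>_le: "\<And>x. norm (\<kappa> x) \<le> norm x"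
    and coeff: "\<And>x. x \<in> Cc \<Longrightarrow> norm (x 0) \<le> norm (\<kappa> (\<iota> x))"
    and discrete: "discrete_space TYPE('g)"
    and cai: "has_contractive_approx_identity s TYPE('r)"
  shows "has_contractive_approx_identity s TYPE('a)"
  unfolding has_contractive_approx_identity_iff
proof (intro allI impI)
  fix S :: "'a set" and \<epsilon> :: real assume S: "finite S" "0 < \<epsilon>"
  let ?V = "Cc :: ('g \<Rightarrow> 'a) set"
  define \<delta> where "\<delta> a g = (if g = 0 then a else 0)" for a :: 'a and g :: 'g
  have \<delta>V: "\<delta> a \<in> ?V" for a
    unfolding compactly_supported_discrete[OF discrete] by (rule finite_subset[of _ "{0}"]) (auto simp: \<delta>_def)
  have mult: "\<kappa> (x * y) = \<kappa> x * \<kappa> y" for x y using \<kappa> by (simp add: is_completion_def)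
  \<comment> \<open>Continuity is needed to carry density of the compactly supported functions in
    L^1 over to the codomain of \<open>\<kappa>\<close>.\<close>
  have cont: "continuous_on UNIV \<kappa>"
  proof (rule continuous_onI)
    fix x and e :: real assume "0 < e"
    moreover have "dist (\<kappa> y) (\<kappa> x) \<le> dist y x" for y
      using \<kappa>_le[of "y - x"] by (simp add: dist_norm completion_diff[OF \<kappa>])
    ultimately show "\<exists>d>0. \<forall>x'\<in>UNIV. dist x' x < d \<longrightarrow> dist (\<kappa> x') (\<kappa> x) \<le> e"
      by (intro exI[of _ e]) (auto intro: order_trans less_imp_le)
  qed
  have "closure (\<iota> ` ?V) = UNIV" "closure (range \<kappa>) = UNIV"
    using \<iota> \<kappa> by (simp_all add: is_L1_algebra_def is_completion_def)
  moreover have "\<kappa> ` closure (\<iota> ` ?V) \<subseteq> closure (\<kappa> ` \<iota> ` ?V)"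
    by (rule image_closure_subset[OF continuous_on_subset[OF cont subset_UNIV] closed_closure closure_subset])
  ultimately have "closure (range \<kappa>) \<subseteq> closure (\<kappa> ` \<iota> ` ?V)"
    by (intro closure_minimal) auto
  then have dense: "closure (\<kappa> ` \<iota> ` ?V) = UNIV" using \<open>closure (range \<kappa>) = UNIV\<close> by blast
  have sc: "r *\<^sub>R d \<in> \<kappa> ` \<iota> ` ?V" if d: "d \<in> \<kappa> ` \<iota> ` ?V" for r d
  proof -
    obtain x where x: "x \<in> ?V" "d = \<kappa> (\<iota> x)" using d by blast
    have "(\<lambda>g. r *\<^sub>R x g) \<in> ?V"
      using x(1) unfolding compactly_supported_discrete[OF discrete] by (rule finite_subset[rotated]) auto
    moreover have "r *\<^sub>R d = \<kappa> (\<iota> (\<lambda>g. r *\<^sub>R x g))"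
      by (simp add: x(2) L1_scaleR[OF \<mu> \<alpha> \<iota> x(1)] completion_scaleR[OF \<kappa>])
    ultimately show ?thesis by blast
  qed
  have "finite ((\<lambda>a. \<kappa> (\<iota> (\<delta> a))) ` S)" using S(1) by simp
  then obtain e where e: "e \<in> \<kappa> ` \<iota> ` ?V" "norm e \<le> 1"
    "\<And>b. b \<in> (\<lambda>a. \<kappa> (\<iota> (\<delta> a))) ` S \<Longrightarrow> approx_unit_at s e b \<epsilon>"
    using contractive_approx_identity_in_dense[OF dense sc cai _ S(2)] by blast
  obtain x where x: "x \<in> ?V" "e = \<kappa> (\<iota> x)" using e(1) by blast
  have count: "\<mu> = count_space UNIV" by (rule haar_discrete[OF \<mu> discrete])
  \<comment> \<open>The coefficient bound for the function
    \<open>convolution \<mu> \<alpha> y z - w\<close>; later \<open>w\<close> and one of the factors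
    are \<open>\<delta> a\<close>.\<close>
  have key: "norm (convolution \<mu> \<alpha> y z 0 - w 0) \<le> norm (\<kappa> (\<iota> y) * \<kappa> (\<iota> z) - \<kappa> (\<iota> w))"
    if "y \<in> ?V" "z \<in> ?V" "w \<in> ?V" for y z w
  proof -
    have c: "convolution \<mu> \<alpha> y z \<in> ?V" by (rule convolution_compactly_supported[OF \<mu> \<alpha> that(1,2)])
    show ?thesis
      using coeff[OF compactly_supported_diff[OF c that(3)]]
      by (simp add: L1_diff[OF \<mu> \<alpha> \<iota> c that(3)] L1_mult[OF \<mu> \<alpha> \<iota> that(1,2)] completion_diff[OF \<kappa>] mult)
  qed
  have "approx_unit_at s (x 0) a \<epsilon>" if "a \<in> S" for a
  proof -
    have "approx_unit_at s e (\<kappa> (\<iota> (\<delta> a))) \<epsilon>" using e(3) that by blast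
    moreover have "norm (x 0 * a - a) \<le> norm (e * \<kappa> (\<iota> (\<delta> a)) - \<kappa> (\<iota> (\<delta> a)))"
      using key[OF x(1) \<delta>V \<delta>V, of a a] convolution_delta(1)[OF \<alpha>, of x a, folded count]
      by (simp add: x(2) \<delta>_def[abs_def])
    moreover have "norm (a * x 0 - a) \<le> norm (\<kappa> (\<iota> (\<delta> a)) * e - \<kappa> (\<iota> (\<delta> a)))"
      using key[OF \<delta>V x(1) \<delta>V, of a a] convolution_delta(2)[OF \<alpha>, of a x, folded count]
      by (simp add: x(2) \<delta>_def[abs_def])
    ultimately show ?thesis by (auto simp: approx_unit_at_def)
  qed
  moreover have "norm (x 0) \<le> 1" using coeff[OF x(1)] e(2) x(2) by simp
  ultimately show "\<exists>e::'a. norm e \<le> 1 \<and> (\<forall>a\<in>S. approx_unit_at s e a \<epsilon>)" by blast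
qed

theorem theorem5p5:
  fixes p :: real
    and \<mu> :: "'g::{topological_group_add, t2_space} measure"
    and \<alpha> :: "'g \<Rightarrow> 'a::complex_banach_algebra \<Rightarrow> 'a"
    and \<iota> :: "('g \<Rightarrow> 'a) \<Rightarrow> 'l::complex_banach_algebra"
    and \<kappa> :: "'l \<Rightarrow> 'f::complex_banach_algebra"
    and \<kappa>\<^sub>r :: "'l \<Rightarrow> 'r::complex_banach_algebra"
    and s :: side
  assumes "1 \<le> p"
    and "Lp_operator_algebra p TYPE('a) TYPE('m)"
    and "locally_compact_space (euclidean :: 'g topology)"
    and "left_haar_measure \<mu>"
    and "group_action \<alpha>"
    and "is_L1_algebra \<mu> \<alpha> \<iota>"
    and "is_full_crossed_product TYPE('m) p \<alpha> \<mu> \<iota> \<kappa>"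
    and "is_reduced_crossed_product TYPE('m) p \<alpha> \<mu> \<iota> \<kappa>\<^sub>r"
  shows "(has_contractive_approx_identity s TYPE('a) \<longrightarrow> has_contractive_approx_identity s TYPE('f)) \<and>
    (has_contractive_approx_identity s TYPE('f) \<longrightarrow> has_contractive_approx_identity s TYPE('r)) \<and>
    (discrete_space TYPE('g) \<and> nondegenerate_Lp_operator_algebra p TYPE('a) TYPE('m) \<longrightarrow>
      has_contractive_approx_identity s TYPE('r) \<longrightarrow> has_contractive_approx_identity s TYPE('a))"
proof (intro conjI impI)
  note \<kappa> = assms(7)[unfolded is_full_crossed_product_def]
    and \<kappa>r = assms(8)[unfolded is_reduced_crossed_product_def]
  have full_le: "norm (\<kappa> x) \<le> norm x" for x
    by (rule full_crossed_product_norm_le[OF assms(1,4,6,7)])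
  have reduced_le: "norm (\<kappa>\<^sub>r x) \<le> norm (\<kappa> x)" for x
    by (rule reduced_crossed_product_norm_le[OF assms(1,4,6,7,8)])
  \<comment> \<open>L^1 with its own norm is its own completion, so the comparison of completions
    also covers the passage from L^1 to F^p.\<close>
  have id: "is_completion UNIV (+) (*\<^sub>C) (*) norm (\<lambda>x::'l. x)" by (simp add: is_completion_def)
  show "has_contractive_approx_identity s TYPE('f)" if cai: "has_contractive_approx_identity s TYPE('a)"
    using contractive_approx_identity_completion_mono[OF id \<kappa> full_le
        L1_contractive_approx_identity[OF assms(4,5,6,3) cai]] .
  show "has_contractive_approx_identity s TYPE('r)" if cai: "has_contractive_approx_identity s TYPE('f)"
    by (rule contractive_approx_identity_completion_mono[OF \<kappa> \<kappa>r reduced_le cai])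
  assume d: "discrete_space TYPE('g) \<and> nondegenerate_Lp_operator_algebra p TYPE('a) TYPE('m)"
    and cai: "has_contractive_approx_identity s TYPE('r)"
  show "has_contractive_approx_identity s TYPE('a)"
  proof (rule coefficient_contractive_approx_identity[OF assms(4,5,6) \<kappa>r _ _ _ cai])
    show "norm (\<kappa>\<^sub>r x) \<le> norm x" for x using reduced_le[of x] full_le[of x] by linarith
    show "norm (x 0) \<le> norm (\<kappa>\<^sub>r (\<iota> x))" if "x \<in> Cc" for x
      using reduced_crossed_product_norm_ge[OF assms(1) _ assms(4,5,6,8) _ that] d by blast
  qed (use d in blast)
qed

end
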